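(* Let $M\subset\Omega_1$ be a measurable set of finite $w$-perimeter, i.e. $P_w(M,\Omega_1)<+\infty$, for which $T(M)$ is defined, i.e. $\int_{\{y\in I_1:\,(x',y)\in M\}}w(y)\,dy<+\infty$ for a.e. $x'\in\Omega'$. Then $$P_w(M,\Omega_1)\ \ge\ P_w(T(M),\Omega_1).$$
   Context: Points of $\mathbb R^N$ ($N\ge2$) are written $x=(x',y)$ with $x'=(x_1,\dots,x_{N-1})$, $y=x_N$. Let $\Omega'\subset\mathbb R^{N-1}$ be a bounded domain with Lipschitz boundary, $\alpha,\alpha_1\in(0,+\infty]$, $I=(0,\alpha)$, $I_1=(0,\alpha_1)$, $\Omega=\Omega'\times I$, $\Omega_1=\Omega'\times I_1$. Closures are taken in Euclidean space. Weight: $w\in C(\overline{I_1})$, $w(y)>0$ for all $y\in I_1$, $W(y):=\int_0^y w(t)\,dt$ for $y\in\overline{I_1}$, and $\alpha=\lim_{y\to\alpha_1}W(y)$. The function $f(z):=w(W^{-1}(z))$ is assumed to belong to $C(\overline I)$ (with continuous extension to $z=\alpha$ if $\alpha<+\infty=\alpha_1$) and to satisfy: $f(z_2-z_1)\le f(z_1)+f(z_2)$ whenever $z_1,z_2\in\overline I$, $z_1\le z_2$; and, if $\alpha<+\infty$, also $f(z)=f(\alpha-z)$ for all $z\in\overline I$. Rearrangement: for a measurable $A\subset I$ of finite measure put $A^*:=(0,|A|)$. For a nonnegative measurable function $v$ on $\Omega_1$ set $u(x',z):=v(x',W^{-1}(z))$ for $(x',z)\in\Omega$, let $$u^*(x',z):=\sup\{c>0:\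 z\in\{u(x',\cdot)>c\}^*\}\quad(\sup\emptyset=0),$$ and $T(v)(x',y):=u^*(x',W(y))$, $(x',y)\in\Omega_1$; this is defined for every $x'$ such that $|\{z\in I:u(x',z)>c\}|<+\infty$ for all $c>0$. For a measurable set $M\subset\Omega_1$ with characteristic function $\chi(M)$, the $w$-rearrangement $T(M)$ is the set (determined up to null sets) given by $\chi(T(M))=T(\chi(M))$. Perimeter: for measurable $M\subset\Omega_1$, with $w=w(y)$, $$P_w(M,\Omega_1):=\sup\left\{\int_M\mathrm{div}\,\varphi\,dx:\ \varphi\in C^1_0(\Omega_1,\mathbb R^N),\ |\varphi|\le w\right\},$$ where $C^1_0$ means $C^1$ with compact support. *)

theory Defs
  imports "HOL-Analysis.Analysis"
begin

section \<open>Bounded domains with Lipschitz boundary\<close>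

text \<open>
  Near each boundary point, after a rotation taking the last coordinate axis to \<^term>\<open>e\<close>,
  the set is the strict epigraph of a Lipschitz function defined on the hyperplane orthogonal
  to \<^term>\<open>e\<close>. In dimension one that hyperplane is a single point.
\<close>

definition lipschitz_boundary :: "'a::euclidean_space set \<Rightarrow> bool" where
  "lipschitz_boundary U \<longleftrightarrow>
     (\<forall>p\<in>frontier U. \<exists>r>0. \<exists>e L g. norm e = 1 \<and> L-lipschitz_on {v. v \<bullet> e = 0} g \<and>
        U \<inter> ball p r = {x \<in> ball p r. g (x - (x \<bullet> e) *\<^sub>R e) < x \<bullet> e})"

definition bounded_lipschitz_domain :: "'a::euclidean_space set \<Rightarrow> bool" where
  "bounded_lipschitz_domain U \<longleftrightarrow>
     open U \<and> connected U \<and> U \<noteq> {} \<and> bounded U \<and> lipschitz_boundary U"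

section \<open>The weight and its primitive\<close>

definition W_prim :: "(real \<Rightarrow> real) \<Rightarrow> real \<Rightarrow> real" where
  "W_prim w y = integral {0..y} w"

definition W_inv :: "(real \<Rightarrow> real) \<Rightarrow> ereal \<Rightarrow> real \<Rightarrow> real" where
  "W_inv w \<alpha>\<^sub>1 = inv_into (closure (einterval 0 \<alpha>\<^sub>1)) (W_prim w)"

text \<open>
  The function \<open>f(z) = w(W\<inverse>(z))\<close> on the closure of \<open>(0, \<alpha>)\<close>. The only point of this closure
  that \<open>W\<close> can miss is \<open>z = \<alpha>\<close>, in the case of finite \<open>\<alpha>\<close> and infinite \<open>\<alpha>\<^sub>1\<close>; there \<open>f\<close> is given by
  its limit, and if this limit does not exist then \<open>f\<close> is discontinuous at \<open>\<alpha>\<close>.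
\<close>

definition weight_f :: "(real \<Rightarrow> real) \<Rightarrow> ereal \<Rightarrow> ereal \<Rightarrow> real \<Rightarrow> real" where
  "weight_f w \<alpha> \<alpha>\<^sub>1 z =
     (if z \<in> W_prim w ` closure (einterval 0 \<alpha>\<^sub>1) then w (W_inv w \<alpha>\<^sub>1 z)
      else Lim (at z within einterval 0 \<alpha>) (\<lambda>t. w (W_inv w \<alpha>\<^sub>1 t)))"

section \<open>Rearrangement\<close>

definition star_set :: "real set \<Rightarrow> real set" where
  "star_set A = {0<..<measure lebesgue A}"

definition star_fun :: "ereal \<Rightarrow> ('a \<times> real \<Rightarrow> real) \<Rightarrow> 'a \<times> real \<Rightarrow> real" where
  "star_fun \<alpha> u = (\<lambda>(x', z).
     let S = {c. 0 < c \<and> z \<in> star_set {t \<in> einterval 0 \<alpha>. c < u (x', t)}}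
     in if S = {} then 0 else Sup S)"

text \<open>
  The value of the following function at \<open>(x', y)\<close> is meaningful only if all superlevel sets of
  the transported function \<open>u(x', \<cdot>)\<close> at positive levels have finite measure.
\<close>

definition w_rearr_fun ::
  "(real \<Rightarrow> real) \<Rightarrow> ereal \<Rightarrow> ereal \<Rightarrow> ('a \<times> real \<Rightarrow> real) \<Rightarrow> 'a \<times> real \<Rightarrow> real" where
  "w_rearr_fun w \<alpha> \<alpha>\<^sub>1 v =
     (\<lambda>(x', y). star_fun \<alpha> (\<lambda>(x', z). v (x', W_inv w \<alpha>\<^sub>1 z)) (x', W_prim w y))"

text \<open>
  The rearrangement of a set is determined up to null sets only, hence a predicate:
  \<open>TM\<close> is a representative of \<open>T(M)\<close>.
\<close>

definition is_w_rearrangement ::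
  "(real \<Rightarrow> real) \<Rightarrow> ereal \<Rightarrow> ereal \<Rightarrow> 'a::euclidean_space set
     \<Rightarrow> ('a \<times> real) set \<Rightarrow> ('a \<times> real) set \<Rightarrow> bool" where
  "is_w_rearrangement w \<alpha> \<alpha>\<^sub>1 \<Omega>' M TM \<longleftrightarrow>
     TM \<subseteq> \<Omega>' \<times> einterval 0 \<alpha>\<^sub>1 \<and>
     (AE p in lebesgue. p \<in> \<Omega>' \<times> einterval 0 \<alpha>\<^sub>1 \<longrightarrow>
        indicator TM p = w_rearr_fun w \<alpha> \<alpha>\<^sub>1 (indicator M) p)"

lemma w_rearr_fun_indicator_cases:
  "w_rearr_fun w \<alpha> \<alpha>\<^sub>1 (indicator M) p \<in> {0, 1}"
proof -
  obtain x' y where p: "p = (x', y)" by (cases p)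
  define A where "A = {t \<in> einterval 0 \<alpha>. (x', W_inv w \<alpha>\<^sub>1 t) \<in> M}"
  define S where "S = {c::real. 0 < c \<and>
      W_prim w y \<in> star_set {t \<in> einterval 0 \<alpha>. c < indicator M (x', W_inv w \<alpha>\<^sub>1 t)}}"
  have T: "w_rearr_fun w \<alpha> \<alpha>\<^sub>1 (indicator M) p = (if S = {} then 0 else Sup S)"
    unfolding w_rearr_fun_def star_fun_def p S_def Let_def prod.case ..
  have lev: "{t \<in> einterval 0 \<alpha>. c < (indicator M (x', W_inv w \<alpha>\<^sub>1 t) :: real)}
               = (if c < 1 then A else {})" if "0 < c" for c :: real
    using that unfolding A_def indicator_def by (cases "c < 1") auto
  have "c \<in> S \<longleftrightarrow> c \<in> (if W_prim w y \<in> star_set A then {0<..<1} else {})" for c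
    unfolding S_def mem_Collect_eq
    by (cases "0 < c"; simp only: lev) (simp_all add: star_set_def)
  then have "S = (if W_prim w y \<in> star_set A then {0<..<1} else {})"
    by (rule set_eqI)
  then have "S = {0<..<1} \<or> S = {}" by (simp split: if_splits)
  then show ?thesis
    unfolding T by auto
qed

text \<open>Every set has such a representative, so the predicate is never vacuous.\<close>

lemma is_w_rearrangement_exists:
  "is_w_rearrangement w \<alpha> \<alpha>\<^sub>1 \<Omega>' M
     {p \<in> \<Omega>' \<times> einterval 0 \<alpha>\<^sub>1. w_rearr_fun w \<alpha> \<alpha>\<^sub>1 (indicator M) p = 1}"
proof -
  have "indicator {p \<in> \<Omega>' \<times> einterval 0 \<alpha>\<^sub>1. w_rearr_fun w \<alpha> \<alpha>\<^sub>1 (indicator M) p = 1} p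
          = w_rearr_fun w \<alpha> \<alpha>\<^sub>1 (indicator M) p" if "p \<in> \<Omega>' \<times> einterval 0 \<alpha>\<^sub>1" for p
    using that w_rearr_fun_indicator_cases[of w \<alpha> \<alpha>\<^sub>1 M p]
    by (cases "w_rearr_fun w \<alpha> \<alpha>\<^sub>1 (indicator M) p = 1") simp_all
  then show ?thesis
    unfolding is_w_rearrangement_def by (intro conjI AE_I2 impI) blast+
qed

section \<open>Weighted perimeter\<close>

definition divergence :: "('a::euclidean_space \<Rightarrow> 'a) \<Rightarrow> 'a \<Rightarrow> real" where
  "divergence \<phi> x = (\<Sum>b\<in>Basis. frechet_derivative \<phi> (at x) b \<bullet> b)"

text \<open>
  Compactly supported fields on \<^term>\<open>U\<close> are identified with their extension by zero
  to the whole space.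
\<close>

definition C1_compact_support :: "'a::euclidean_space set \<Rightarrow> ('a \<Rightarrow> 'a) set" where
  "C1_compact_support U =
     {\<phi>. (\<exists>\<phi>' :: 'a \<Rightarrow> 'a \<Rightarrow>\<^sub>L 'a. continuous_on UNIV \<phi>' \<and>
            (\<forall>x. (\<phi> has_derivative blinfun_apply (\<phi>' x)) (at x))) \<and>
         compact (closure {x. \<phi> x \<noteq> 0}) \<and> closure {x. \<phi> x \<noteq> 0} \<subseteq> U}"

definition w_perimeter ::
  "(real \<Rightarrow> real) \<Rightarrow> ('a::euclidean_space \<times> real) set \<Rightarrow> ('a \<times> real) set \<Rightarrow> ereal" where
  "w_perimeter w M U =
     (SUP \<phi> \<in> {\<phi> \<in> C1_compact_support U. \<forall>x\<in>U. norm (\<phi> x) \<le> w (snd x)}.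
        ereal (LINT x:M|lebesgue. divergence \<phi> x))"

end

theory Submission
  imports Defs
begin

text \<open>
  Write \<open>M\<^sub>x\<close> for the slice of \<open>M\<close> over \<open>x \<in> \<Omega>'\<close> and \<open>m(x)\<close> for the integral of \<open>w\<close> over \<open>M\<^sub>x\<close>. In the variable
  \<open>z = W(y)\<close> the rearranged set is the region below the graph of \<open>m\<close>, that is \<open>W(y) < m(x)\<close>. The proof
  turns every test field for this region into a test field for \<open>M\<close> of (almost) the same value.

  \<^emph>\<open>The horizontal part.\<close> If \<open>m\<close> were smooth, the divergence of a field \<open>\<phi>\<close> over the region would
  integrate to a boundary term that sees only the vector \<open>V(x) = \<phi>/w\<close> at the point over \<open>x\<close> with \<open>W(y) = m(x)\<close>,
  and \<open>|V| \<le> 1\<close>. Its horizontal contribution is minus the integral of \<open>V\<^sub>1 \<bullet> \<nabla>m\<close>, and the field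
  \<open>w(y) V\<^sub>1(x)\<close>, whose direction does not depend on \<open>y\<close>, gives exactly this when it is tested on \<open>M\<close>. For
  \<open>m\<close> that is merely integrable, \<open>m\<close> is mollified in \<open>x\<close>, the vector field \<open>V\<close> is computed from the mollified
  height, and then \<open>V\<close> is mollified with the same even kernel: convolution with that kernel is self-adjoint,
  so the two horizontal terms still agree identically (\<open>product_field_inequality\<close>, \<open>estimate_mollified\<close>).

  \<^emph>\<open>The vertical part.\<close> Here a scalar field \<open>\<sigma>(x,y)\<close> with \<open>|\<sigma>| \<le> w(y)\<close> is needed whose \<open>y\<close>-derivative has
  integral \<open>f(m(x))\<close> over \<open>M\<^sub>x\<close>. This is the isoperimetric inequality on the line, and it has a calibration: with
  \<open>a\<close> the \<open>w\<close>-measure of \<open>M\<^sub>x\<close> below \<open>y\<close>, take \<open>\<sigma> = f(a) - f(W(y) - a)\<close>. The hypothesis on \<open>f\<close> says precisely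
  that \<open>|f(a) - f(b)| \<le> f(a + b)\<close>, hence \<open>|\<sigma>| \<le> f(W(y)) = w(y)\<close>; and inside \<open>M\<^sub>x\<close> only \<open>a\<close> moves, so \<open>\<sigma>\<close> gains
  \<open>f(m)\<close> there. Three adjustments make \<open>\<sigma>\<close> admissible. Near \<open>0\<close> the function \<open>f\<close> is replaced by a \<open>C\<^sup>1\<close> profile vanishing
  near \<open>0\<close> with the same inequality (\<open>calibration_profile\<close>). The slice is replaced by a smooth density
  (\<open>calibration_limit\<close>). Near the upper end \<open>\<sigma>\<close> is faded out; this costs nothing in the limit, for infinite
  \<open>\<alpha>\<close> because \<open>M\<^sub>x\<close> has finite measure, and for finite \<open>\<alpha>\<close> because \<open>\<sigma>\<close> tends to \<open>f(m) - f(\<alpha> - m) = 0\<close> by the symmetry of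
  \<open>f\<close> (\<open>calibration_value_tendsto\<close>).

  \<^emph>\<open>Assembly.\<close> The indicator of \<open>W(y) < m(x)\<close> is smoothed to \<open>\<tau>(m(x) - W(y))\<close>. All approximations then pass through
  one inequality, \<open>estimate\<close>, which is stable under bounded almost everywhere convergence of the height and
  of the vertical density (\<open>estimate_limit\<close>). Finally \<open>\<tau>\<close> is sharpened (\<open>rearranged_divergence_le\<close>).
\<close>

section \<open>Continuously differentiable maps and the divergence theorem\<close>

text \<open>
  Continuity is asked of each directional derivative instead of the operator-valued derivative. In
  finite dimension this is the same, and it makes the closure properties below immediate.
\<close>

definition C1_deriv :: "('a::euclidean_space \<Rightarrow> 'b::euclidean_space) \<Rightarrow> ('a \<Rightarrow> 'a \<Rightarrow> 'b) \<Rightarrow> bool" where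
  "C1_deriv f D \<longleftrightarrow>
     (\<forall>x. (f has_derivative D x) (at x)) \<and> (\<forall>h. continuous_on UNIV (\<lambda>x. D x h))"

lemma C1_derivI:
  assumes "\<And>x. (f has_derivative D x) (at x)" "\<And>h. continuous_on UNIV (\<lambda>x. D x h)"
  shows "C1_deriv f D"
  using assms by (simp add: C1_deriv_def)

lemma C1_deriv_has_derivative: "C1_deriv f D \<Longrightarrow> (f has_derivative D x) (at x)"
  by (simp add: C1_deriv_def)

lemma C1_deriv_continuous_derivative: "C1_deriv f D \<Longrightarrow> continuous_on UNIV (\<lambda>x. D x h)"
  by (simp add: C1_deriv_def)

lemma C1_deriv_continuous: "C1_deriv f D \<Longrightarrow> continuous_on S f"
  by (meson C1_deriv_has_derivative continuous_on_subset has_derivative_continuous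
      continuous_at_imp_continuous_on subset_UNIV)

lemma C1_deriv_const: "C1_deriv (\<lambda>x. c) (\<lambda>x h. 0)"
  by (intro C1_derivI) auto

lemma C1_deriv_bounded_linear: "bounded_linear f \<Longrightarrow> C1_deriv f (\<lambda>x. f)"
  by (intro C1_derivI) (auto intro: bounded_linear_imp_has_derivative)

lemma C1_deriv_add:
  assumes "C1_deriv f D" "C1_deriv g E"
  shows "C1_deriv (\<lambda>x. f x + g x) (\<lambda>x h. D x h + E x h)"
  using assms unfolding C1_deriv_def
  by (auto intro!: has_derivative_add continuous_intros)

lemma C1_deriv_diff:
  assumes "C1_deriv f D" "C1_deriv g E"
  shows "C1_deriv (\<lambda>x. f x - g x) (\<lambda>x h. D x h - E x h)"
  using assms unfolding C1_deriv_def
  by (auto intro!: has_derivative_diff continuous_intros)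

lemma C1_deriv_scaleR:
  assumes "C1_deriv f D" "C1_deriv g E"
  shows "C1_deriv (\<lambda>x. f x *\<^sub>R g x) (\<lambda>x h. f x *\<^sub>R E x h + D x h *\<^sub>R g x)"
proof (rule C1_derivI)
  show "((\<lambda>x. f x *\<^sub>R g x) has_derivative (\<lambda>h. f x *\<^sub>R E x h + D x h *\<^sub>R g x)) (at x)" for x
    using assms unfolding C1_deriv_def by (auto intro!: has_derivative_scaleR)
  show "continuous_on UNIV (\<lambda>x. f x *\<^sub>R E x h + D x h *\<^sub>R g x)" for h
    by (intro continuous_intros C1_deriv_continuous[OF assms(1)] C1_deriv_continuous[OF assms(2)]
        C1_deriv_continuous_derivative[OF assms(1)] C1_deriv_continuous_derivative[OF assms(2)])
qed

lemma C1_deriv_mult: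
  fixes f g :: "'a::euclidean_space \<Rightarrow> real"
  assumes "C1_deriv f D" "C1_deriv g E"
  shows "C1_deriv (\<lambda>x. f x * g x) (\<lambda>x h. f x * E x h + D x h * g x)"
  using C1_deriv_scaleR[OF assms] by simp

lemma C1_deriv_Pair:
  assumes "C1_deriv f D" "C1_deriv g E"
  shows "C1_deriv (\<lambda>x. (f x, g x)) (\<lambda>x h. (D x h, E x h))"
  using assms unfolding C1_deriv_def
  by (auto intro!: has_derivative_Pair continuous_intros)

lemma C1_deriv_compose_linear:
  assumes "C1_deriv f D" "bounded_linear L"
  shows "C1_deriv (\<lambda>x. f (L x)) (\<lambda>x h. D (L x) (L h))"
proof (rule C1_derivI)
  have L: "(L has_derivative L) (at x)" for x
    by (rule bounded_linear_imp_has_derivative[OF assms(2)])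
  show "((\<lambda>x. f (L x)) has_derivative (\<lambda>h. D (L x) (L h))) (at x)" for x
    using has_derivative_compose[OF L C1_deriv_has_derivative[OF assms(1)]] .
  show "continuous_on UNIV (\<lambda>x. D (L x) (L h))" for h
    by (rule continuous_on_compose2[OF C1_deriv_continuous_derivative[OF assms(1), of "L h"]])
      (auto intro: linear_continuous_on assms)
qed

lemma C1_deriv_linear_compose:
  assumes "C1_deriv f D" "bounded_linear L"
  shows "C1_deriv (\<lambda>x. L (f x)) (\<lambda>x h. L (D x h))"
proof (rule C1_derivI)
  show "((\<lambda>x. L (f x)) has_derivative (\<lambda>h. L (D x h))) (at x)" for x
    using bounded_linear.has_derivative[OF assms(2) C1_deriv_has_derivative[OF assms(1)]] .
  show "continuous_on UNIV (\<lambda>x. L (D x h))" for h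
    by (rule bounded_linear.continuous_on[OF assms(2) C1_deriv_continuous_derivative[OF assms(1)]])
qed

lemma C1_deriv_real_compose:
  fixes f :: "'a::euclidean_space \<Rightarrow> real" and g :: "real \<Rightarrow> real"
  assumes f: "C1_deriv f D" and g: "\<And>t. (g has_real_derivative g' t) (at t)"
    and g': "continuous_on UNIV g'"
  shows "C1_deriv (\<lambda>x. g (f x)) (\<lambda>x h. D x h * g' (f x))"
proof (rule C1_derivI)
  show "((\<lambda>x. g (f x)) has_derivative (\<lambda>h. D x h * g' (f x))) (at x)" for x
    using has_derivative_compose[OF C1_deriv_has_derivative[OF f]
        g[unfolded has_field_derivative_def]] by (simp add: mult.commute)
  show "continuous_on UNIV (\<lambda>x. D x h * g' (f x))" for h
    by (intro continuous_intros C1_deriv_continuous_derivative[OF f]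
        continuous_on_compose2[OF g' C1_deriv_continuous[OF f]]) auto
qed

lemma C1_compact_support_iff:
  "\<phi> \<in> C1_compact_support U \<longleftrightarrow>
     (\<exists>D. C1_deriv \<phi> D) \<and> compact (closure {x. \<phi> x \<noteq> 0}) \<and> closure {x. \<phi> x \<noteq> 0} \<subseteq> U"
proof -
  have "(\<exists>\<phi>' :: 'a \<Rightarrow> 'a \<Rightarrow>\<^sub>L 'a. continuous_on UNIV \<phi>' \<and>
            (\<forall>x. (\<phi> has_derivative blinfun_apply (\<phi>' x)) (at x))) \<longleftrightarrow> (\<exists>D. C1_deriv \<phi> D)"
  proof (intro iffI; elim exE)
    fix \<phi>' :: "'a \<Rightarrow> 'a \<Rightarrow>\<^sub>L 'a"
    assume a: "continuous_on UNIV \<phi>' \<and> (\<forall>x. (\<phi> has_derivative blinfun_apply (\<phi>' x)) (at x))"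
    have "C1_deriv \<phi> (\<lambda>x. blinfun_apply (\<phi>' x))"
      using a by (intro C1_derivI) (auto intro!: continuous_intros)
    then show "\<exists>D. C1_deriv \<phi> D" by (rule exI[of _ "\<lambda>x. blinfun_apply (\<phi>' x)"])
  next
    fix D assume D: "C1_deriv \<phi> D"
    have bl: "bounded_linear (D x)" for x
      using C1_deriv_has_derivative[OF D] by (rule has_derivative_bounded_linear)
    have "continuous_on UNIV (\<lambda>x. Blinfun (D x))"
      by (rule continuous_on_blinfun_componentwise)
        (simp add: bounded_linear_Blinfun_apply[OF bl] C1_deriv_continuous_derivative[OF D])
    moreover have "(\<phi> has_derivative blinfun_apply (Blinfun (D x))) (at x)" for x
      by (simp add: bounded_linear_Blinfun_apply[OF bl] C1_deriv_has_derivative[OF D])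
    ultimately show "\<exists>\<phi>' :: 'a \<Rightarrow> 'a \<Rightarrow>\<^sub>L 'a. continuous_on UNIV \<phi>' \<and>
            (\<forall>x. (\<phi> has_derivative blinfun_apply (\<phi>' x)) (at x))" by blast
  qed
  then show ?thesis
    unfolding C1_compact_support_def by blast
qed

lemma divergence_C1_deriv:
  assumes "C1_deriv \<phi> D"
  shows "divergence \<phi> x = (\<Sum>b\<in>Basis. D x b \<bullet> b)"
  unfolding divergence_def
  using frechet_derivative_at[OF C1_deriv_has_derivative[OF assms]] by simp

lemma C1_deriv_zero:
  assumes D: "C1_deriv f D" and S: "closed S" and z: "\<And>x. x \<notin> S \<Longrightarrow> f x = 0" and x: "x \<notin> S"
  shows "D x h = 0"
proof -
  have "(f has_derivative (\<lambda>h. 0)) (at x)"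
    by (rule has_derivative_transform_within_open[where s = "- S" and f = "\<lambda>x. 0"])
      (use S z x in auto)
  then show ?thesis
    using has_derivative_unique[OF C1_deriv_has_derivative[OF D]] by metis
qed

lemma continuous_bounded_support_bounded:
  fixes f :: "'a::euclidean_space \<Rightarrow> 'b::euclidean_space"
  assumes "continuous_on UNIV f" "\<And>x. norm x > R \<Longrightarrow> f x = 0"
  obtains B where "B \<ge> 0" "\<And>x. norm (f x) \<le> B"
proof -
  have "compact (f ` cball 0 R)"
    by (intro compact_continuous_image continuous_on_subset[OF assms(1)]) auto
  then have "bounded (f ` cball 0 R)" by (rule compact_imp_bounded)
  then obtain B where B: "\<And>x. x \<in> cball 0 R \<Longrightarrow> norm (f x) \<le> B"
    unfolding bounded_iff by (metis image_eqI)
  have "norm (f x) \<le> max B 0" for x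
    using B[of x] assms(2)[of x] by (cases "norm x \<le> R") auto
  then show ?thesis by (intro that[of "max B 0"]) auto
qed

lemma integrable_bounded_support:
  fixes f :: "'a::euclidean_space \<Rightarrow> 'b::euclidean_space"
  assumes [measurable]: "f \<in> borel_measurable borel"
    and "\<And>x. norm (f x) \<le> B" "\<And>x. norm x > R \<Longrightarrow> f x = 0"
  shows "integrable lborel f"
proof (rule Bochner_Integration.integrable_bound)
  show "integrable lborel (\<lambda>x::'a. B * indicator (cball 0 R) x :: real)"
    using emeasure_lborel_cball_finite[of "0::'a" R] by simp
  show "AE x in lborel. norm (f x) \<le> norm (B * indicator (cball 0 R) x :: real)"
    using assms(2,3) by (intro AE_I2) (auto simp: indicator_def dist_norm not_le
        intro: order_trans[OF _ abs_ge_self])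
qed simp

lemma integrable_continuous_bounded_support:
  fixes f :: "'a::euclidean_space \<Rightarrow> 'b::euclidean_space"
  assumes "continuous_on UNIV f" "\<And>x. norm x > R \<Longrightarrow> f x = 0"
  shows "integrable lborel f"
proof -
  obtain B where "\<And>x. norm (f x) \<le> B"
    using continuous_bounded_support_bounded[OF assms] by blast
  then show ?thesis
    using integrable_bounded_support[OF borel_measurable_continuous_onI[OF assms(1)] _ assms(2)]
    by blast
qed

text \<open>
  Difference quotients of \<open>f\<close> have integral zero by translation invariance, and they converge
  boundedly to the directional derivative.
\<close>

lemma integral_directional_derivative_zero:
  fixes f :: "'a::euclidean_space \<Rightarrow> real"
  assumes D: "C1_deriv f D" and z: "\<And>x. norm x > R \<Longrightarrow> f x = 0"
  shows "(LINT x|lborel. D x h) = 0"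
proof -
  have cont: "continuous_on UNIV f" by (rule C1_deriv_continuous[OF D])
  have contD: "continuous_on UNIV (\<lambda>x. D x h)" by (rule C1_deriv_continuous_derivative[OF D])
  have Dz: "D x h = 0" if "norm x > R" for x
    by (rule C1_deriv_zero[OF D, of "cball 0 R"]) (use z that in auto)
  obtain B where B: "B \<ge> 0" "\<And>x. norm (D x h) \<le> B"
    using continuous_bounded_support_bounded[OF contD Dz] by blast
  define q where "q n x = (f (x + (1 / Suc n) *\<^sub>R h) - f x) * Suc n" for n x
  have lin: "D x (t *\<^sub>R h) = t * D x h" for x t
    using linear_cmul[OF has_derivative_linear[OF C1_deriv_has_derivative[OF D]]] by simp
  have der: "((\<lambda>t. f (x + t *\<^sub>R h)) has_real_derivative D (x + t *\<^sub>R h) h) (at t)" for x t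
  proof -
    have "((\<lambda>t. f (x + t *\<^sub>R h)) has_derivative (\<lambda>s. D (x + t *\<^sub>R h) (s *\<^sub>R h))) (at t)"
      by (rule has_derivative_compose[OF _ C1_deriv_has_derivative[OF D],
            where f = "\<lambda>t. x + t *\<^sub>R h"]) (auto intro!: derivative_eq_intros)
    then show ?thesis
      unfolding has_field_derivative_def lin by (subst (asm) mult.commute)
  qed
  have q_eq: "\<exists>s. 0 < s \<and> s < 1 \<and> q n x = D (x + s *\<^sub>R h) h" for n x
  proof -
    have "\<exists>s. 0 < s \<and> s < 1 / Suc n \<and>
       f (x + (1 / Suc n) *\<^sub>R h) - f (x + 0 *\<^sub>R h) = (1 / Suc n - 0) * D (x + s *\<^sub>R h) h"
      by (rule MVT2[where f = "\<lambda>t. f (x + t *\<^sub>R h)"]) (auto simp: der)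
    then obtain s where s: "0 < s" "s < 1 / Suc n"
       "f (x + (1 / Suc n) *\<^sub>R h) - f x = (1 / Suc n) * D (x + s *\<^sub>R h) h" by auto
    have "1 / real (Suc n) \<le> 1" by simp
    then have "s < 1" using s(2) by linarith
    moreover have "q n x = D (x + s *\<^sub>R h) h" unfolding q_def s(3) by simp
    ultimately show ?thesis using s(1) by blast
  qed
  have "(\<lambda>n. LINT x|lborel. q n x) \<longlonglongrightarrow> (LINT x|lborel. D x h)"
  proof (rule integral_dominated_convergence[where
        w = "\<lambda>x. B * indicator (cball 0 (\<bar>R\<bar> + norm h)) x"])
    show "integrable lborel (\<lambda>x. B * indicator (cball (0::'a) (\<bar>R\<bar> + norm h)) x :: real)"
      using emeasure_lborel_cball_finite[of "0::'a" "\<bar>R\<bar> + norm h"] by simp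
    show "AE x in lborel. (\<lambda>n. q n x) \<longlonglongrightarrow> D x h"
    proof (rule AE_I2)
      fix x
      have "((\<lambda>t. f (x + t *\<^sub>R h)) has_real_derivative D x h) (at 0)"
        using der[of x 0] by simp
      then have l: "(\<lambda>t. (f (x + t *\<^sub>R h) - f x) / t) \<midarrow>0\<rightarrow> D x h"
        by (simp add: DERIV_def)
      have "filterlim (\<lambda>n. 1 / real (Suc n)) (at 0) sequentially"
        unfolding filterlim_at using LIMSEQ_inverse_real_of_nat
        by (simp add: inverse_eq_divide)
      from filterlim_compose[OF l this] show "(\<lambda>n. q n x) \<longlonglongrightarrow> D x h"
        by (simp add: q_def)
    qed
    show "AE x in lborel. norm (q n x) \<le> B * indicator (cball 0 (\<bar>R\<bar> + norm h)) x" for n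
    proof (rule AE_I2)
      fix x
      obtain s where s: "0 < s" "s < 1" "q n x = D (x + s *\<^sub>R h) h" using q_eq by blast
      show "norm (q n x) \<le> B * indicator (cball 0 (\<bar>R\<bar> + norm h)) x"
      proof (cases "norm x \<le> \<bar>R\<bar> + norm h")
        case True then show ?thesis using s B by (simp add: dist_norm)
      next
        case False
        have "norm (s *\<^sub>R h) \<le> norm h" using s by (simp add: mult_left_le_one_le)
        then have "norm (x + s *\<^sub>R h) > \<bar>R\<bar>"
          using False norm_diff_ineq[of x "s *\<^sub>R h"] by linarith
        then have "norm (x + s *\<^sub>R h) > R" by linarith
        then have "q n x = 0" using s Dz by simp
        then show ?thesis using B by simp
      qed
    qed
    show "(\<lambda>x. D x h) \<in> borel_measurable lborel"
      using borel_measurable_continuous_onI[OF contD] by simp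
    have [measurable]: "f \<in> borel_measurable borel"
      using borel_measurable_continuous_onI[OF cont] by simp
    show "q n \<in> borel_measurable lborel" for n unfolding q_def by measurable
  qed
  moreover have "(LINT x|lborel. q n x) = 0" for n
  proof -
    have i: "integrable lborel f"
      by (rule integrable_continuous_bounded_support[OF cont z])
    have i': "integrable lborel (\<lambda>x. f (c + x))" for c
    proof -
      have "integrable (distr lborel borel ((+) c)) f" using i by (simp add: lborel_distr_plus)
      then show ?thesis by (rule integrable_distr[rotated]) simp
    qed
    have t: "(LINT x|lborel. f (c + x)) = (LINT x|lborel. f x)" for c
    proof -
      have "(LINT x|lborel. f x) = (LINT x|distr lborel borel ((+) c). f x)"
        by (simp add: lborel_distr_plus)
      also have "\<dots> = (LINT x|lborel. f (c + x))"
        by (rule integral_distr) (use i in auto)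
      finally show ?thesis ..
    qed
    show ?thesis
      unfolding q_def add.commute[of _ "(1 / real (Suc n)) *\<^sub>R h"]
      by (subst Bochner_Integration.integral_mult_left_zero,
          subst Bochner_Integration.integral_diff[OF i' i], subst t, simp)
  qed
  ultimately have "(\<lambda>n. 0) \<longlonglongrightarrow> (LINT x|lborel. D x h)" by simp
  then show ?thesis using LIMSEQ_unique tendsto_const by blast
qed

lemma integral_divergence_zero:
  fixes \<phi> :: "'a::euclidean_space \<Rightarrow> 'a"
  assumes D: "C1_deriv \<phi> D" and z: "\<And>x. norm x > R \<Longrightarrow> \<phi> x = 0"
  shows "(LINT x|lborel. divergence \<phi> x) = 0"
proof -
  have c: "C1_deriv (\<lambda>x. \<phi> x \<bullet> b) (\<lambda>x h. D x h \<bullet> b)" for b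
    by (rule C1_deriv_linear_compose[OF D bounded_linear_inner_left])
  have "integrable lborel (\<lambda>x. D x b \<bullet> b)" for b
    by (rule integrable_continuous_bounded_support[OF C1_deriv_continuous_derivative[OF c], where R = R])
      (rule C1_deriv_zero[OF c, of "cball 0 R"]; use z in \<open>auto simp: not_le\<close>)
  moreover have "(LINT x|lborel. D x b \<bullet> b) = 0" for b
    by (rule integral_directional_derivative_zero[OF c, where R = R]) (simp add: z)
  ultimately show ?thesis
    by (simp add: divergence_C1_deriv[OF D])
qed

section \<open>Mollification\<close>

text \<open>
  A \<open>C\<^sup>1\<close> function vanishing exactly on a half-line; the mollifiers and the cut-offs are made from it.
\<close>

definition sqpos :: "real \<Rightarrow> real" where
  "sqpos t = (max 0 t)\<^sup>2"

lemma sqpos_has_derivative: "(sqpos has_real_derivative 2 * max 0 t) (at t)"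
proof -
  consider "t < 0" | "t = 0" | "t > 0" by linarith
  then show ?thesis
  proof cases
    case 1
    have "((\<lambda>t::real. 0) has_real_derivative 2 * max 0 t) (at t)" using 1 by simp
    then show ?thesis
      by (rule has_field_derivative_transform_within_open[of _ _ _ "{..<0}"])
        (use 1 in \<open>auto simp: sqpos_def\<close>)
  next
    case 2
    have l: "((\<lambda>h::real. \<bar>h\<bar>) \<longlongrightarrow> 0) (at 0)" by (intro tendsto_rabs_zero tendsto_ident_at)
    have "((\<lambda>h. sqpos h / h) \<longlongrightarrow> 0) (at 0)"
    proof (rule Lim_null_comparison[OF _ l], rule always_eventually, rule allI)
      fix h :: real
      have "0 \<le> sqpos h" "sqpos h \<le> \<bar>h\<bar> * \<bar>h\<bar>"
        by (auto simp: sqpos_def max_def power2_eq_square)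
      then show "norm (sqpos h / h) \<le> \<bar>h\<bar>"
        by (cases "h = 0") (simp_all add: divide_le_eq)
    qed
    then show ?thesis using 2 by (simp add: DERIV_def sqpos_def)
  next
    case 3
    have "((\<lambda>t::real. t\<^sup>2) has_real_derivative 2 * max 0 t) (at t)"
      using 3 by (auto intro!: derivative_eq_intros)
    then show ?thesis
      by (rule has_field_derivative_transform_within_open[of _ _ _ "{0<..}"])
        (use 3 in \<open>auto simp: sqpos_def\<close>)
  qed
qed

text \<open>
  The gradient \<open>G\<close> is part of the data because the parities matter: \<open>\<eta>\<close> is even and \<open>G\<close> is odd, so
  convolution with \<open>\<eta>\<close> is symmetric and convolution with \<open>G\<close> antisymmetric under the integral.
\<close>

definition mollifier :: "real \<Rightarrow> ('a::euclidean_space \<Rightarrow> real) \<Rightarrow> ('a \<Rightarrow> 'a) \<Rightarrow> bool" where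
  "mollifier e \<eta> G \<longleftrightarrow> C1_deriv \<eta> (\<lambda>x h. G x \<bullet> h) \<and> (\<forall>x. 0 \<le> \<eta> x) \<and> (\<forall>x. \<eta> (-x) = \<eta> x) \<and>
     (\<forall>x. G (-x) = - G x) \<and> (\<forall>x. e < norm x \<longrightarrow> \<eta> x = 0 \<and> G x = 0) \<and>
     (LINT x|lborel. \<eta> x) = 1"

text \<open>
  The positive part of \<open>1 - |x|\<^sup>2/e\<^sup>2\<close>, squared and normalized.
\<close>

lemma mollifier_exists:
  assumes e: "e > 0"
  shows "\<exists>(\<eta> :: 'a::euclidean_space \<Rightarrow> real) G. mollifier e \<eta> G"
proof -
  define b where "b x = sqpos (1 - (x \<bullet> x) / e\<^sup>2)" for x :: 'a
  define g where "g x = (- 4 * max 0 (1 - (x \<bullet> x) / e\<^sup>2) / e\<^sup>2) *\<^sub>R x" for x :: 'a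
  have q: "C1_deriv (\<lambda>x::'a. 1 - (x \<bullet> x) / e\<^sup>2) (\<lambda>x h. - (2 * (x \<bullet> h)) / e\<^sup>2)"
  proof (rule C1_derivI)
    show "((\<lambda>x::'a. 1 - (x \<bullet> x) / e\<^sup>2) has_derivative (\<lambda>h. - (2 * (x \<bullet> h)) / e\<^sup>2)) (at x)" for x
      unfolding divide_inverse
      by (auto intro!: derivative_eq_intros simp: inner_commute algebra_simps)
  qed (use e in \<open>auto intro!: continuous_intros\<close>)
  have b: "C1_deriv b (\<lambda>x h. g x \<bullet> h)"
    using C1_deriv_real_compose[OF q sqpos_has_derivative]
    unfolding b_def g_def by (simp add: continuous_intros mult_ac)
  have z: "b x = 0" "g x = 0" if "e < norm x" for x
  proof -
    have "e\<^sup>2 < x \<bullet> x" using power_strict_mono[OF that, of 2] e by (simp add: power2_norm_eq_inner)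
    then have "1 - (x \<bullet> x) / e\<^sup>2 \<le> 0" using e by simp
    then show "b x = 0" "g x = 0" by (simp_all add: b_def g_def sqpos_def)
  qed
  have i: "integrable lborel b"
    by (rule integrable_continuous_bounded_support[OF C1_deriv_continuous[OF b]]) (rule z)
  define Z where "Z = (LINT x|lborel. b x)"
  have "0 < (LINT x|lborel. (9/16) * indicator (cball (0::'a) (e/2)) x :: real)"
    using content_cball_pos[of "e/2" "0::'a"] e by (simp add: content_cball_pos)
  also have "\<dots> \<le> Z"
    unfolding Z_def
  proof (rule integral_mono[OF _ i])
    show "integrable lborel (\<lambda>x::'a. 9 / 16 * indicator (cball 0 (e / 2)) x :: real)"
      using emeasure_lborel_cball_finite[of "0::'a" "e/2"] by simp
    fix x :: 'a
    show "9 / 16 * indicator (cball 0 (e / 2)) x \<le> b x"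
    proof (cases "norm x \<le> e / 2")
      case True
      then have "x \<bullet> x \<le> (e/2)\<^sup>2"
        using power_mono[OF True, of 2] by (simp add: power2_norm_eq_inner)
      then have "3/4 \<le> 1 - (x \<bullet> x) / e\<^sup>2" using e by (simp add: field_simps power2_eq_square)
      then have "(3/4)\<^sup>2 \<le> b x" unfolding b_def sqpos_def by (intro power_mono max.coboundedI2) auto
      then show ?thesis using True by (simp add: dist_norm power2_eq_square)
    next
      case False then show ?thesis by (simp add: b_def sqpos_def dist_norm)
    qed
  qed
  finally have Z: "Z > 0" .
  have C: "C1_deriv (\<lambda>x. (1/Z) * b x) (\<lambda>x h. ((1/Z) *\<^sub>R g x) \<bullet> h)"
    using C1_deriv_linear_compose[OF b bounded_linear_mult_right[of "1/Z"]] by simp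
  moreover have pos: "0 \<le> b x" "b (- x) = b x" "g (- x) = - g x" for x
    by (simp_all add: b_def g_def sqpos_def)
  moreover have "(LINT x|lborel. (1/Z) * b x) = 1"
    using Z by (simp add: Z_def)
  ultimately have "mollifier e (\<lambda>x. (1/Z) * b x) (\<lambda>x. (1/Z) *\<^sub>R g x)"
    unfolding mollifier_def by (intro conjI C) (use z Z in \<open>simp_all add: pos\<close>)
  then show ?thesis by blast
qed

definition conv :: "('a::euclidean_space \<Rightarrow> real) \<Rightarrow> ('a \<Rightarrow> 'b::euclidean_space) \<Rightarrow> 'a \<Rightarrow> 'b" where
  "conv k u x = (LINT t|lborel. k (x - t) *\<^sub>R u t)"

lemma integrable_kernel:
  fixes k :: "'a::euclidean_space \<Rightarrow> real" and u :: "'a \<Rightarrow> 'b::euclidean_space"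
  assumes k: "continuous_on UNIV k" "\<And>x. \<bar>k x\<bar> \<le> B" and u: "integrable lborel u"
  shows "integrable lborel (\<lambda>t. k (x - t) *\<^sub>R u t)"
proof (rule Bochner_Integration.integrable_bound)
  show "integrable lborel (\<lambda>t. B *\<^sub>R u t)" using u by simp
  have [measurable]: "k \<in> borel_measurable borel" by (rule borel_measurable_continuous_onI[OF k(1)])
  have [measurable]: "u \<in> borel_measurable borel" using u by auto
  show "(\<lambda>t. k (x - t) *\<^sub>R u t) \<in> borel_measurable lborel" by measurable
  show "AE t in lborel. norm (k (x - t) *\<^sub>R u t) \<le> norm (B *\<^sub>R u t)"
    using k(2) by (intro AE_I2) (auto intro!: mult_right_mono order_trans[OF _ abs_ge_self])
qed

lemma continuous_on_conv:
  fixes k :: "'a::euclidean_space \<Rightarrow> real" and u :: "'a \<Rightarrow> 'b::euclidean_space"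
  assumes k: "continuous_on UNIV k" "\<And>x. \<bar>k x\<bar> \<le> B" and u: "integrable lborel u"
  shows "continuous_on UNIV (conv k u)"
proof (rule continuous_at_imp_continuous_on, rule ballI)
  fix x :: 'a
  have [measurable]: "k \<in> borel_measurable borel" by (rule borel_measurable_continuous_onI[OF k(1)])
  have [measurable]: "u \<in> borel_measurable borel" using u by auto
  show "isCont (conv k u) x"
    unfolding continuous_at_sequentially comp_def
  proof (intro allI impI)
    fix f :: "nat \<Rightarrow> 'a" assume f: "f \<longlonglongrightarrow> x"
    show "(\<lambda>n. conv k u (f n)) \<longlonglongrightarrow> conv k u x"
      unfolding conv_def
    proof (rule integral_dominated_convergence[where w = "\<lambda>t. norm (B *\<^sub>R u t)"])
      show "integrable lborel (\<lambda>t. norm (B *\<^sub>R u t))" using u by simp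
      show "AE t in lborel. norm (k (f n - t) *\<^sub>R u t) \<le> norm (B *\<^sub>R u t)" for n
        using k(2) by (intro AE_I2) (auto intro!: mult_right_mono order_trans[OF _ abs_ge_self])
      show "AE t in lborel. (\<lambda>n. k (f n - t) *\<^sub>R u t) \<longlonglongrightarrow> k (x - t) *\<^sub>R u t"
      proof (rule AE_I2)
        fix t
        have "(\<lambda>n. k (f n - t)) \<longlonglongrightarrow> k (x - t)"
          by (rule continuous_on_tendsto_compose[OF k(1)]) (auto intro!: tendsto_intros f)
        then show "(\<lambda>n. k (f n - t) *\<^sub>R u t) \<longlonglongrightarrow> k (x - t) *\<^sub>R u t"
          by (intro tendsto_intros)
      qed
    qed measurable
  qed
qed

lemma uniformly_continuous_bounded_support:
  fixes f :: "'a::euclidean_space \<Rightarrow> 'b::euclidean_space"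
  assumes c: "continuous_on UNIV f" and z: "\<And>x. norm x > R \<Longrightarrow> f x = 0" and e: "e > 0"
  obtains d where "d > 0" "\<And>x y. norm (y - x) < d \<Longrightarrow> norm (f y - f x) < e"
proof -
  have "uniformly_continuous_on (cball 0 (R + 1)) f"
    by (intro compact_uniformly_continuous continuous_on_subset[OF c]) auto
  then obtain d where d: "d > 0"
    "\<And>x y. x \<in> cball 0 (R + 1) \<Longrightarrow> y \<in> cball 0 (R + 1) \<Longrightarrow> dist y x < d \<Longrightarrow> dist (f y) (f x) < e"
    using e unfolding uniformly_continuous_on_def by metis
  show thesis
  proof (rule that[of "min d 1"])
    fix x y :: 'a assume xy: "norm (y - x) < min d 1"
    show "norm (f y - f x) < e"
    proof (cases "norm x \<le> R + 1 \<and> norm y \<le> R + 1")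
      case True
      then show ?thesis using d(2)[of x y] xy by (auto simp: dist_norm)
    next
      case False
      have "norm x > R" "norm y > R"
        using False xy norm_triangle_ineq2[of x y] norm_triangle_ineq2[of y x]
        by (auto simp: norm_minus_commute)
      then show ?thesis using z e by simp
    qed
  qed (use d in auto)
qed

text \<open>
  The gradient of the kernel is uniformly continuous, so its linearization error is uniformly small
  and can be integrated against \<open>u\<close>.
\<close>

lemma conv_C1_deriv:
  fixes u :: "'a::euclidean_space \<Rightarrow> 'b::euclidean_space"
  assumes m: "mollifier e \<eta> G" and u: "integrable lborel u"
  shows "C1_deriv (conv \<eta> u) (\<lambda>x h. conv (\<lambda>y. G y \<bullet> h) u x)"
proof (rule C1_derivI)
  have C: "C1_deriv \<eta> (\<lambda>x h. G x \<bullet> h)" and z: "\<And>x. e < norm x \<Longrightarrow> \<eta> x = 0"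
    "\<And>x. e < norm x \<Longrightarrow> G x = 0"
    using m unfolding mollifier_def by auto
  have c\<eta>: "continuous_on UNIV \<eta>" by (rule C1_deriv_continuous[OF C])
  have cG: "continuous_on UNIV G"
    by (subst continuous_on_componentwise) (auto intro: C1_deriv_continuous_derivative[OF C])
  obtain B where B: "\<And>x. \<bar>\<eta> x\<bar> \<le> B" 
    using continuous_bounded_support_bounded[OF c\<eta> z(1)] by (metis real_norm_def)
  obtain B' where B': "\<And>x. norm (G x) \<le> B'" 
    using continuous_bounded_support_bounded[OF cG z(2)] by metis
  have cGh: "continuous_on UNIV (\<lambda>y. G y \<bullet> h)" for h by (intro continuous_intros cG)
  have bGh: "\<bar>G y \<bullet> h\<bar> \<le> B' * norm h" for y h
    using Cauchy_Schwarz_ineq2[of "G y" h] mult_right_mono[OF B'[of y] norm_ge_zero[of h]] by linarith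
  show "continuous_on UNIV (conv (\<lambda>y. G y \<bullet> h) u)" for h
    by (rule continuous_on_conv[OF cGh bGh u])
  have i1: "integrable lborel (\<lambda>t. \<eta> (x - t) *\<^sub>R u t)" for x
    by (rule integrable_kernel[OF c\<eta> B u])
  have i2: "integrable lborel (\<lambda>t. (G (x - t) \<bullet> h) *\<^sub>R u t)" for x h
    by (rule integrable_kernel[OF cGh bGh u])
  fix x
  define N where "N = (LINT t|lborel. norm (u t))"
  have N: "N \<ge> 0" by (simp add: N_def)
  have lin: "bounded_linear (\<lambda>h. conv (\<lambda>y. G y \<bullet> h) u x)"
  proof (rule bounded_linear_intro)
    show "conv (\<lambda>y. G y \<bullet> (h + h')) u x = conv (\<lambda>y. G y \<bullet> h) u x + conv (\<lambda>y. G y \<bullet> h') u x" for h h'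
      unfolding conv_def by (simp add: inner_add_right scaleR_add_left Bochner_Integration.integral_add[OF i2 i2])
    show "conv (\<lambda>y. G y \<bullet> (r *\<^sub>R h)) u x = r *\<^sub>R conv (\<lambda>y. G y \<bullet> h) u x" for r h
      unfolding conv_def by (simp flip: scaleR_scaleR)
    show "norm (conv (\<lambda>y. G y \<bullet> h) u x) \<le> norm h * (B' * N)" for h
    proof -
      have "norm (conv (\<lambda>y. G y \<bullet> h) u x) \<le> (LINT t|lborel. norm ((G (x - t) \<bullet> h) *\<^sub>R u t))"
        unfolding conv_def by (rule integral_norm_bound)
      also have "\<dots> \<le> (LINT t|lborel. (B' * norm h) * norm (u t))"
        using i2 u bGh by (intro integral_mono integrable_norm) (auto intro!: mult_right_mono)
      finally show ?thesis by (simp add: N_def mult_ac)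
    qed
  qed
  show "(conv \<eta> u has_derivative (\<lambda>h. conv (\<lambda>y. G y \<bullet> h) u x)) (at x)"
    unfolding has_derivative_at_alt
  proof (intro conjI lin allI impI)
    fix \<delta> :: real assume "\<delta> > 0"
    define \<delta>' where "\<delta>' = \<delta> / (N + 1)"
    have \<delta>': "\<delta>' > 0" using \<open>\<delta> > 0\<close> N by (simp add: \<delta>'_def)
    obtain d where d: "d > 0" "\<And>x y. norm (y - x) < d \<Longrightarrow> norm (G y - G x) < \<delta>'"
      using uniformly_continuous_bounded_support[OF cG z(2) \<delta>'] by blast
    have est: "\<bar>\<eta> (p + h) - \<eta> p - G p \<bullet> h\<bar> \<le> \<delta>' * norm h" if h: "norm h < d" for p h
    proof -
      have "norm (\<eta> (p + h) - \<eta> p - G p \<bullet> (p + h - p)) \<le> norm (p + h - p) * \<delta>'"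
      proof (rule differentiable_bound_linearization[where f' = "\<lambda>x h. G x \<bullet> h"
            and S = "(\<lambda>t. p + t *\<^sub>R h) ` {0..1}"])
        show "(\<eta> has_derivative (\<bullet>) (G x)) (at x within (\<lambda>t. p + t *\<^sub>R h) ` {0..1})" for x
          using C1_deriv_has_derivative[OF C] by (rule has_derivative_at_withinI)
        fix x assume "x \<in> (\<lambda>t. p + t *\<^sub>R h) ` {0..1}"
        then obtain t where t: "x = p + t *\<^sub>R h" "0 \<le> t" "t \<le> 1"
          by (metis (no_types, lifting) imageE atLeastAtMost_iff)
        show "onorm ((\<bullet>) (G x) - (\<bullet>) (G p)) \<le> \<delta>'"
        proof (rule onorm_bound)
          have "norm (t *\<^sub>R h) \<le> norm h" using t by (simp add: mult_left_le_one_le)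
          then have "norm (G x - G p) < \<delta>'" using h t by (intro d) auto
          then show "norm (((\<bullet>) (G x) - (\<bullet>) (G p)) i) \<le> \<delta>' * norm i" for i
            using Cauchy_Schwarz_ineq2[of "G x - G p" i]
              mult_right_mono[of "norm (G x - G p)" \<delta>' "norm i"]
            by (simp add: inner_diff_left)
        qed (use \<delta>' in simp)
      next
        show "p \<in> (\<lambda>t. p + t *\<^sub>R h) ` {0..1}" by (auto intro!: image_eqI[of _ _ 0])
      qed auto
      then show ?thesis by (simp add: mult.commute)
    qed
    show "\<exists>d>0. \<forall>y. norm (y - x) < d \<longrightarrow>
       norm (conv \<eta> u y - conv \<eta> u x - conv (\<lambda>ya. G ya \<bullet> (y - x)) u x) \<le> \<delta> * norm (y - x)"
    proof (intro exI[of _ d] conjI d(1) allI impI)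
      fix y assume y: "norm (y - x) < d"
      have eq: "conv \<eta> u y - conv \<eta> u x - conv (\<lambda>ya. G ya \<bullet> (y - x)) u x =
        (LINT t|lborel. (\<eta> (y - t) - \<eta> (x - t) - G (x - t) \<bullet> (y - x)) *\<^sub>R u t)"
        unfolding conv_def scaleR_diff_left
        by (simp add: Bochner_Integration.integral_diff i1 i2)
      have "norm (conv \<eta> u y - conv \<eta> u x - conv (\<lambda>ya. G ya \<bullet> (y - x)) u x)
        \<le> (LINT t|lborel. norm ((\<eta> (y - t) - \<eta> (x - t) - G (x - t) \<bullet> (y - x)) *\<^sub>R u t))"
        unfolding eq by (rule integral_norm_bound)
      also have "\<dots> \<le> (LINT t|lborel. (\<delta>' * norm (y - x)) * norm (u t))"
      proof (rule integral_mono)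
        show "integrable lborel (\<lambda>t. norm ((\<eta> (y - t) - \<eta> (x - t) - G (x - t) \<bullet> (y - x)) *\<^sub>R u t))"
          unfolding scaleR_diff_left
          by (intro integrable_norm Bochner_Integration.integrable_diff i1 i2)
        show "norm ((\<eta> (y - t) - \<eta> (x - t) - G (x - t) \<bullet> (y - x)) *\<^sub>R u t)
           \<le> \<delta>' * norm (y - x) * norm (u t)" for t
          using est[OF y, of "x - t"] by (auto intro!: mult_right_mono)
      qed (use u in auto)
      also have "\<dots> = \<delta> * (N / (N + 1)) * norm (y - x)"
        by (simp add: N_def \<delta>'_def)
      also have "\<dots> \<le> \<delta> * norm (y - x)"
        using N \<open>\<delta> > 0\<close> by (intro mult_right_mono) (auto simp: field_simps)
      finally show "norm (conv \<eta> u y - conv \<eta> u x - conv (\<lambda>ya. G ya \<bullet> (y - x)) u x)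
        \<le> \<delta> * norm (y - x)" .
    qed
  qed
qed

lemma mollifierD:
  assumes "mollifier e \<eta> G"
  shows "C1_deriv \<eta> (\<lambda>x h. G x \<bullet> h)" "0 \<le> \<eta> x" "\<eta> (-x) = \<eta> x" "G (-x) = - G x"
    "e < norm x \<Longrightarrow> \<eta> x = 0" "e < norm x \<Longrightarrow> G x = 0" "(LINT x|lborel. \<eta> x) = 1"
    "continuous_on UNIV \<eta>" "continuous_on UNIV G" "\<eta> \<in> borel_measurable borel"
    "integrable lborel \<eta>"
proof -
  show C: "C1_deriv \<eta> (\<lambda>x h. G x \<bullet> h)" and "0 \<le> \<eta> x" "\<eta> (-x) = \<eta> x" "G (-x) = - G x"
    "e < norm x \<Longrightarrow> G x = 0" "(LINT x|lborel. \<eta> x) = 1" and z: "e < norm x \<Longrightarrow> \<eta> x = 0" for x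
    using assms unfolding mollifier_def by auto
  show "continuous_on UNIV \<eta>" by (rule C1_deriv_continuous[OF C])
  then show "\<eta> \<in> borel_measurable borel" by (rule borel_measurable_continuous_onI)
  show "continuous_on UNIV G"
    by (subst continuous_on_componentwise) (auto intro: C1_deriv_continuous_derivative[OF C])
  show "integrable lborel \<eta>"
    by (rule integrable_continuous_bounded_support[OF C1_deriv_continuous[OF C] z])
qed

lemma mollifier_bounded:
  assumes "mollifier e \<eta> G"
  obtains B where "\<And>x. \<bar>\<eta> x\<bar> \<le> B" "\<And>x. norm (G x) \<le> B"
proof -
  obtain B where B: "B \<ge> 0" "\<And>x. \<bar>\<eta> x\<bar> \<le> B"
    using continuous_bounded_support_bounded[OF mollifierD(8)[OF assms] mollifierD(5)[OF assms]]
    by (metis real_norm_def)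
  obtain B' where B': "B' \<ge> 0" "\<And>x. norm (G x) \<le> B'"
    using continuous_bounded_support_bounded[OF mollifierD(9)[OF assms] mollifierD(6)[OF assms]]
    by metis
  show thesis
  proof (rule that[of "max B B'"])
    show "\<bar>\<eta> x\<bar> \<le> max B B'" "norm (G x) \<le> max B B'" for x
      using B(2)[of x] B'(2)[of x] by linarith+
  qed
qed

lemma integral_lborel_reflect:
  fixes f :: "'a::euclidean_space \<Rightarrow> 'b::euclidean_space"
  assumes [measurable]: "f \<in> borel_measurable borel"
  shows "(LINT t|lborel. f (x - t)) = (LINT t|lborel. f t)"
    and "integrable lborel (\<lambda>t. f (x - t)) \<longleftrightarrow> integrable lborel f"
proof -
  have d: "distr lborel borel (\<lambda>t. x - t) = (lborel :: 'a measure)"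
    using lborel_affine_euclidean[of "\<lambda>_. -1" x] 
    by (simp add: density_1 sum_negf euclidean_representation)
  show "(LINT t|lborel. f (x - t)) = (LINT t|lborel. f t)"
    by (subst (2) d[symmetric], subst integral_distr) auto
  show "integrable lborel (\<lambda>t. f (x - t)) \<longleftrightarrow> integrable lborel f"
    by (subst (2) d[symmetric], subst integrable_distr_eq) auto
qed

lemma integral_mollifier_reflect:
  assumes "mollifier e \<eta> G"
  shows "(LINT t|lborel. \<eta> (x - t)) = 1" "integrable lborel (\<lambda>t. \<eta> (x - t))"
  using integral_lborel_reflect[OF mollifierD(10)[OF assms], of x] mollifierD(7,11)[OF assms] by auto

lemma conv_eq_0:
  assumes m: "\<And>x. e < norm x \<Longrightarrow> k x = 0" and u: "\<And>t. t \<notin> K \<Longrightarrow> u t = 0"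
    and x: "\<And>t. t \<in> K \<Longrightarrow> e < norm (x - t)"
  shows "conv k u x = 0"
proof -
  have "k (x - t) *\<^sub>R u t = 0" for t
    using assms by (cases "t \<in> K") auto
  then show ?thesis unfolding conv_def by (metis (no_types, lifting) integral_zero Bochner_Integration.integral_cong)
qed

lemma norm_conv_le:
  fixes u :: "'a::euclidean_space \<Rightarrow> 'b::euclidean_space"
  assumes m: "mollifier e \<eta> G" and u: "integrable lborel u" "\<And>t. norm (u t) \<le> B"
  shows "norm (conv \<eta> u x) \<le> B"
proof -
  obtain C where C: "\<And>x. \<bar>\<eta> x\<bar> \<le> C" using mollifier_bounded[OF m] by metis
  have i: "integrable lborel (\<lambda>t. \<eta> (x - t) *\<^sub>R u t)"
    by (rule integrable_kernel[OF mollifierD(8)[OF m] C u(1)])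
  have "norm (conv \<eta> u x) \<le> (LINT t|lborel. norm (\<eta> (x - t) *\<^sub>R u t))"
    unfolding conv_def by (rule integral_norm_bound)
  also have "\<dots> \<le> (LINT t|lborel. \<eta> (x - t) * B)"
    using i u(2) mollifierD(2)[OF m] integral_mollifier_reflect(2)[OF m]
    by (intro integral_mono integrable_norm) (auto intro!: mult_left_mono)
  also have "\<dots> = B" using integral_mollifier_reflect(1)[OF m] by simp
  finally show ?thesis .
qed

lemma conv_Pair:
  fixes u :: "'a::euclidean_space \<Rightarrow> 'b::euclidean_space" and v :: "'a \<Rightarrow> 'c::euclidean_space"
  assumes k: "continuous_on UNIV k" "\<And>x. \<bar>k x\<bar> \<le> B" and u: "integrable lborel (\<lambda>x. (u x, v x))"
  shows "conv k (\<lambda>x. (u x, v x)) x = (conv k u x, conv k v x)"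
proof -
  have i: "integrable lborel (\<lambda>t. k (x - t) *\<^sub>R (u t, v t))"
    by (rule integrable_kernel[OF k u])
  show ?thesis
    unfolding conv_def
    using integral_bounded_linear[OF bounded_linear_fst i] integral_bounded_linear[OF bounded_linear_snd i]
    by (intro prod_eqI) simp_all
qed

lemma integrable_product_kernel:
  fixes a b :: "'a::euclidean_space \<Rightarrow> real" and k :: "'a \<Rightarrow> real"
  assumes a: "integrable lborel a" and b: "integrable lborel b"
    and k: "continuous_on UNIV k" "\<And>x. \<bar>k x\<bar> \<le> B"
  shows "integrable (lborel \<Otimes>\<^sub>M lborel) (\<lambda>(x, t). a x * k (x - t) * b t)"
proof -
  have [measurable]: "k \<in> borel_measurable borel" "a \<in> borel_measurable borel" "b \<in> borel_measurable borel"
    using borel_measurable_continuous_onI[OF k(1)] a b by auto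
  have ab: "integrable (lborel \<Otimes>\<^sub>M lborel) (\<lambda>(x, t). a x * b t)"
  proof (rule lborel_pair.Fubini_integrable)
    show "AE x in lborel. integrable lborel (\<lambda>y. case (x, y) of (x, t) \<Rightarrow> a x * b t)"
      using b by simp
    show "integrable lborel (\<lambda>x. \<integral>y. norm (case (x, y) of (x, t) \<Rightarrow> a x * b t) \<partial>lborel)"
      using a by (simp add: abs_mult)
  qed measurable
  show ?thesis
  proof (rule Bochner_Integration.integrable_bound)
    show "integrable (lborel \<Otimes>\<^sub>M lborel) (\<lambda>z. B * (case z of (x, t) \<Rightarrow> a x * b t))"
      using ab by simp
    have "\<bar>k x\<bar> \<le> \<bar>B\<bar>" for x using k(2)[of x] by linarith
    then have "\<bar>k (x - t)\<bar> * \<bar>a x * b t\<bar> \<le> \<bar>B\<bar> * \<bar>a x * b t\<bar>" for x t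
      by (intro mult_right_mono) auto
    then show "AE z in lborel \<Otimes>\<^sub>M lborel. norm (case z of (x, t) \<Rightarrow> a x * k (x - t) * b t)
        \<le> norm (B * (case z of (x, t) \<Rightarrow> a x * b t))"
      by (intro AE_I2) (auto simp: abs_mult mult_ac)
  qed measurable
qed

text \<open>
  Fubini: moving a convolution from one factor to the other reflects the kernel.
\<close>

lemma integral_conv_swap:
  fixes a b :: "'a::euclidean_space \<Rightarrow> real" and k :: "'a \<Rightarrow> real"
  assumes a: "integrable lborel a" and b: "integrable lborel b"
    and k: "continuous_on UNIV k" "\<And>x. \<bar>k x\<bar> \<le> B"
  shows "(LINT x|lborel. a x * conv k b x) = (LINT t|lborel. b t * conv (\<lambda>x. k (- x)) a t)"
proof -
  have i: "integrable (lborel \<Otimes>\<^sub>M lborel) (\<lambda>(x, t). a x * k (x - t) * b t)"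
    by (rule integrable_product_kernel[OF assms])
  have "(LINT x|lborel. a x * conv k b x) = (LINT x|lborel. LINT t|lborel. a x * k (x - t) * b t)"
    unfolding conv_def by (simp add: mult.assoc)
  also have "\<dots> = (LINT t|lborel. LINT x|lborel. a x * k (x - t) * b t)"
    using lborel_pair.Fubini_integral[OF i] by simp
  also have "\<dots> = (LINT t|lborel. b t * conv (\<lambda>x. k (- x)) a t)"
    unfolding conv_def by (simp add: mult_ac flip: integral_mult_right_zero)
  finally show ?thesis .
qed

lemma integrable_conv:
  fixes u :: "'a::euclidean_space \<Rightarrow> real"
  assumes m: "mollifier e \<eta> G" and u: "integrable lborel u"
  shows "integrable lborel (conv \<eta> u)" "(LINT x|lborel. \<bar>conv \<eta> u x\<bar>) \<le> (LINT x|lborel. \<bar>u x\<bar>)"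
proof -
  note [measurable] = mollifierD(10)[OF m]
  have [measurable]: "u \<in> borel_measurable borel" using u by auto
  obtain C where C: "\<And>x. \<bar>\<eta> x\<bar> \<le> C" using mollifier_bounded[OF m] by metis
  have nn: "0 \<le> \<eta> x" for x by (rule mollifierD(2)[OF m])
  have r: "(LINT x|lborel. \<eta> (x - t)) = 1" "integrable lborel (\<lambda>x. \<eta> (x - t))" for t
  proof -
    have "(\<lambda>x. \<eta> (x - t)) = (\<lambda>x. \<eta> (t - x))" using mollifierD(3)[OF m, of "t - x" for x] by simp
    then show "(LINT x|lborel. \<eta> (x - t)) = 1" "integrable lborel (\<lambda>x. \<eta> (x - t))"
      using integral_mollifier_reflect[OF m] by auto
  qed
  have i: "integrable (lborel \<Otimes>\<^sub>M lborel) (\<lambda>(t, x). \<eta> (x - t) * u t)"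
  proof (rule lborel_pair.Fubini_integrable)
    show "AE t in lborel. integrable lborel (\<lambda>x. case (t, x) of (t, x) \<Rightarrow> \<eta> (x - t) * u t)"
      using r by simp
    show "integrable lborel (\<lambda>t. \<integral>x. norm (case (t, x) of (t, x) \<Rightarrow> \<eta> (x - t) * u t) \<partial>lborel)"
      using r u nn by (simp add: abs_mult)
  qed measurable
  then have ia: "integrable (lborel \<Otimes>\<^sub>M lborel) (\<lambda>(t, x). \<eta> (x - t) * \<bar>u t\<bar>)"
    using integrable_abs[OF i] nn by (simp add: abs_mult case_prod_beta')
  show ic: "integrable lborel (conv \<eta> u)"
    using lborel_pair.integrable_snd[OF i] unfolding conv_def[abs_def] by simp
  have "(LINT x|lborel. \<bar>conv \<eta> u x\<bar>) \<le> (LINT x|lborel. LINT t|lborel. \<eta> (x - t) * \<bar>u t\<bar>)"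
  proof (rule integral_mono)
    show "integrable lborel (\<lambda>x. LINT t|lborel. \<eta> (x - t) * \<bar>u t\<bar>)"
      using lborel_pair.integrable_snd[OF ia] by simp
    show "\<bar>conv \<eta> u x\<bar> \<le> (LINT t|lborel. \<eta> (x - t) * \<bar>u t\<bar>)" for x
      using integral_norm_bound[of lborel "\<lambda>t. \<eta> (x - t) *\<^sub>R u t"] nn
      unfolding conv_def by (simp add: abs_mult)
  qed (use ic in auto)
  also have "\<dots> = (LINT t|lborel. LINT x|lborel. \<eta> (x - t) * \<bar>u t\<bar>)"
    using lborel_pair.Fubini_integral[OF ia] by simp
  also have "\<dots> = (LINT t|lborel. \<bar>u t\<bar>)" using r by simp
  finally show "(LINT x|lborel. \<bar>conv \<eta> u x\<bar>) \<le> (LINT x|lborel. \<bar>u x\<bar>)" .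
qed

text \<open>
  Continuous functions converging almost everywhere exist by Lusin's theorem; clamping them keeps the
  bounds.
\<close>

lemma borel_AE_limit_of_continuous:
  fixes u :: "'a::euclidean_space \<Rightarrow> real"
  assumes u: "u \<in> borel_measurable borel" and B: "\<And>x. a \<le> u x" "\<And>x. u x \<le> b"
  obtains g :: "nat \<Rightarrow> 'a \<Rightarrow> real"
  where "\<And>n. continuous_on UNIV (g n)" "\<And>n x. a \<le> g n x" "\<And>n x. g n x \<le> b"
    "AE x in lborel. (\<lambda>n. g n x) \<longlonglongrightarrow> u x"
proof -
  have "u \<in> borel_measurable lebesgue" using u by (simp add: measurable_completion)
  then have "u measurable_on UNIV"
    by (simp add: lebesgue_measurable_imp_measurable_on)
  then obtain N g where N: "negligible N" and g: "\<And>n. continuous_on UNIV (g n)"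
    and lim: "\<And>x. x \<notin> N \<Longrightarrow> (\<lambda>n. g n x) \<longlonglongrightarrow> u x"
    unfolding measurable_on_def by auto
  have ab: "a \<le> b" using B order_trans by blast
  show thesis
  proof (rule that[of "\<lambda>n x. max a (min b (g n x))"])
    show "continuous_on UNIV (\<lambda>x. max a (min b (g n x)))" for n by (intro continuous_intros g)
    have "AE x in lebesgue. x \<notin> N" using N by (intro AE_not_in) (simp add: negligible_iff_null_sets)
    then have "AE x in lborel. x \<notin> N" by (simp add: AE_completion_iff)
    then show "AE x in lborel. (\<lambda>n. max a (min b (g n x))) \<longlonglongrightarrow> u x"
    proof eventually_elim
      case (elim x)
      have "(\<lambda>n. max a (min b (g n x))) \<longlonglongrightarrow> max a (min b (u x))"
        by (intro tendsto_intros lim elim)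
      then show ?case using B[of x] by (simp add: max_def min_def split: if_splits)
    qed
  qed (use ab in auto)
qed

text \<open>
  For a continuous function of bounded support this is uniform continuity. The general case follows
  because such functions are dense and convolution does not increase the \<open>L\<^sup>1\<close> norm.
\<close>

lemma conv_L1_tendsto:
  fixes u :: "'a::euclidean_space \<Rightarrow> real"
  assumes m: "\<And>n. mollifier (e n) (\<eta> n) (G n)" and e: "e \<longlonglongrightarrow> 0"
    and u: "u \<in> borel_measurable borel" "\<And>x. \<bar>u x\<bar> \<le> B" "\<And>x. norm x > R \<Longrightarrow> u x = 0"
  shows "(\<lambda>n. LINT x|lborel. \<bar>conv (\<eta> n) u x - u x\<bar>) \<longlonglongrightarrow> 0"
proof (rule LIMSEQ_I)
  fix \<delta> :: real assume \<delta>: "\<delta> > 0"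
  have iu: "integrable lborel u"
    by (rule integrable_bounded_support[OF u(1)]) (use u in auto)
  have B: "-B \<le> u x" "u x \<le> B" for x using u(2)[of x] by auto
  obtain g where g: "\<And>n. continuous_on UNIV (g n)" "\<And>n x. -B \<le> g n x" "\<And>n x. g n x \<le> B"
    "AE x in lborel. (\<lambda>n. g n x) \<longlonglongrightarrow> u x"
    using borel_AE_limit_of_continuous[OF u(1) B] by blast
  \<comment> \<open>A cut-off equal to \<open>1\<close> on the support of \<open>u\<close>, giving the approximating functions a common bounded support.\<close>
  define c where "c x = max 0 (min 1 (R + 1 - norm x))" for x :: 'a
  have c: "0 \<le> c x" "c x \<le> 1" "norm x \<le> R \<Longrightarrow> c x = 1" "norm x > R + 1 \<Longrightarrow> c x = 0" for x
    by (auto simp: c_def)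
  define h where "h n x = c x * g n x" for n x
  have ch: "continuous_on UNIV (h n)" for n
    unfolding h_def c_def by (intro continuous_intros g)
  have hz: "h n x = 0" if "norm x > R + 1" for n x using that c by (simp add: h_def)
  have hB: "\<bar>h n x\<bar> \<le> B" for n x
  proof -
    have "\<bar>g n x\<bar> \<le> B" using g(2,3)[of n x] by (simp add: abs_le_iff)
    then show ?thesis
      using c[of x] mult_mono[of "c x" 1 "\<bar>g n x\<bar>" B] by (simp add: h_def abs_mult)
  qed
  have ih: "integrable lborel (h n)" for n
    by (rule integrable_continuous_bounded_support[OF ch hz])
  have [measurable]: "h n \<in> borel_measurable borel" for n by (rule borel_measurable_continuous_onI[OF ch])
  have [measurable]: "u \<in> borel_measurable borel" by fact
  have "(\<lambda>n. LINT x|lborel. \<bar>h n x - u x\<bar>) \<longlonglongrightarrow> (LINT x::'a|lborel. 0::real)"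
  proof (rule integral_dominated_convergence[where w = "\<lambda>x. 2 * B * indicator (cball 0 (R + 1)) x"])
    show "integrable lborel (\<lambda>x::'a. 2 * B * indicator (cball 0 (R + 1)) x :: real)"
      using emeasure_lborel_cball_finite[of "0::'a" "R + 1"] by simp
    show "AE x in lborel. (\<lambda>n. \<bar>h n x - u x\<bar>) \<longlonglongrightarrow> 0"
      using g(4)
    proof eventually_elim
      case (elim x)
      have "(\<lambda>n. \<bar>h n x - u x\<bar>) \<longlonglongrightarrow> \<bar>c x * u x - u x\<bar>"
        unfolding h_def by (intro tendsto_intros elim)
      moreover have "c x * u x = u x" using c[of x] u(3)[of x] by (cases "norm x \<le> R") auto
      ultimately show ?case by simp
    qed
    show "AE x in lborel. norm \<bar>h n x - u x\<bar> \<le> 2 * B * indicator (cball 0 (R + 1)) x" for n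
    proof (rule AE_I2)
      fix x
      have "\<bar>h n x - u x\<bar> \<le> 2 * B" using hB[of n x] u(2)[of x] by linarith
      moreover have "h n x - u x = 0" if "norm x > R + 1" using hz[OF that] u(3)[of x] that by simp
      ultimately show "norm \<bar>h n x - u x\<bar> \<le> 2 * B * indicator (cball 0 (R + 1)) x"
        by (auto simp: indicator_def dist_norm not_le)
    qed
  qed measurable
  then have "(\<lambda>n. LINT x|lborel. \<bar>h n x - u x\<bar>) \<longlonglongrightarrow> 0" by simp
  then obtain i where i: "(LINT x|lborel. \<bar>h i x - u x\<bar>) < \<delta> / 4"
    using \<delta> order_tendstoD(2)[of _ 0 sequentially "\<delta> / 4"] eventually_sequentially
    by (metis (no_types, lifting) divide_pos_pos order_refl zero_less_numeral)
  define V where "V = measure lborel (cball (0::'a) (R + 2))"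
  define \<delta>' where "\<delta>' = \<delta> / (4 * (V + 1))"
  have V: "V \<ge> 0" by (simp add: V_def)
  have \<delta>': "\<delta>' > 0" using V \<delta> by (simp add: \<delta>'_def)
  obtain d where d: "d > 0" "\<And>x y. norm (y - x) < d \<Longrightarrow> norm (h i y - h i x) < \<delta>'"
    using uniformly_continuous_bounded_support[OF ch hz \<delta>'] by blast
  have close: "(LINT x|lborel. \<bar>conv (\<eta> n) (h i) x - h i x\<bar>) \<le> \<delta>' * V"
    if n: "e n < d" "e n < 1" for n
  proof -
    note M = m[of n]
    obtain C where C: "\<And>x. \<bar>\<eta> n x\<bar> \<le> C" using mollifier_bounded[OF M] by metis
    have ik: "integrable lborel (\<lambda>t. \<eta> n (x - t) *\<^sub>R h i t)" for x
      by (rule integrable_kernel[OF mollifierD(8)[OF M] C ih])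
    note rf = integral_mollifier_reflect[OF M]
    have eq: "conv (\<eta> n) (h i) x - h i x = (LINT t|lborel. \<eta> n (x - t) * (h i t - h i x))" for x
      using ik[of x] rf[of x] by (simp add: conv_def right_diff_distrib Bochner_Integration.integral_diff)
    have 1: "\<bar>conv (\<eta> n) (h i) x - h i x\<bar> \<le> \<delta>'" for x
    proof -
      have "\<bar>conv (\<eta> n) (h i) x - h i x\<bar> \<le> (LINT t|lborel. \<bar>\<eta> n (x - t) * (h i t - h i x)\<bar>)"
        unfolding eq using integral_norm_bound by (metis (no_types, lifting) real_norm_def Bochner_Integration.integral_cong)
      also have "\<dots> \<le> (LINT t|lborel. \<eta> n (x - t) * \<delta>')"
      proof (rule integral_mono)
        show "integrable lborel (\<lambda>t. \<bar>\<eta> n (x - t) * (h i t - h i x)\<bar>)"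
          using ik[of x] rf[of x] by (intro integrable_abs) (simp add: right_diff_distrib)
        show "\<bar>\<eta> n (x - t) * (h i t - h i x)\<bar> \<le> \<eta> n (x - t) * \<delta>'" for t
        proof (cases "e n < norm (x - t)")
          case True then show ?thesis using mollifierD(5)[OF M] by simp
        next
          case False
          then have "norm (t - x) < d" using n by (simp add: norm_minus_commute)
          then show ?thesis using d(2)[of t x] mollifierD(2)[OF M, of "x - t"]
            by (auto simp: abs_mult intro!: mult_left_mono)
        qed
      qed (use rf[of x] in simp)
      also have "\<dots> = \<delta>'" using rf[of x] by simp
      finally show ?thesis .
    qed
    have 2: "conv (\<eta> n) (h i) x - h i x = 0" if x: "norm x > R + 2" for x
    proof -
      have "conv (\<eta> n) (h i) x = 0"
      proof (rule conv_eq_0[where K = "cball 0 (R + 1)" and e = "e n"])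
        show "\<eta> n x = 0" if "e n < norm x" for x using mollifierD(5)[OF M that] .
        show "h i t = 0" if "t \<notin> cball 0 (R + 1)" for t using that hz by (auto simp: dist_norm)
        show "e n < norm (x - t)" if "t \<in> cball 0 (R + 1)" for t
          using that x n norm_triangle_ineq2[of x t] by (auto simp: dist_norm)
      qed
      then show ?thesis using hz[of x i] x by simp
    qed
    have "(LINT x|lborel. \<bar>conv (\<eta> n) (h i) x - h i x\<bar>)
        \<le> (LINT x|lborel. \<delta>' * indicator (cball (0::'a) (R + 2)) x)"
    proof (rule integral_mono)
      show "integrable lborel (\<lambda>x. \<bar>conv (\<eta> n) (h i) x - h i x\<bar>)"
        using integrable_conv(1)[OF M ih] ih by auto
      show "integrable lborel (\<lambda>x::'a. \<delta>' * indicator (cball 0 (R + 2)) x :: real)"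
        using emeasure_lborel_cball_finite[of "0::'a" "R + 2"] by simp
      show "\<bar>conv (\<eta> n) (h i) x - h i x\<bar> \<le> \<delta>' * indicator (cball 0 (R + 2)) x" for x
        using 1[of x] 2[of x] by (auto simp: indicator_def dist_norm not_le)
    qed
    then show ?thesis using emeasure_lborel_cball_finite[of "0::'a" "R + 2"] by (simp add: V_def)
  qed
  have "eventually (\<lambda>n. e n < d \<and> e n < 1) sequentially"
    using order_tendstoD(2)[OF e d(1)] order_tendstoD(2)[OF e, of 1] by (auto intro: eventually_conj)
  then obtain n0 where n0: "\<And>n. n \<ge> n0 \<Longrightarrow> e n < d \<and> e n < 1"
    unfolding eventually_sequentially by blast
  show "\<exists>n0. \<forall>n\<ge>n0. norm ((LINT x|lborel. \<bar>conv (\<eta> n) u x - u x\<bar>) - 0) < \<delta>"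
  proof (intro exI allI impI)
    fix n assume "n \<ge> n0"
    then have n: "e n < d" "e n < 1" using n0 by auto
    note M = m[of n]
    obtain C where C: "\<And>x. \<bar>\<eta> n x\<bar> \<le> C" using mollifier_bounded[OF M] by metis
    have ihu: "integrable lborel (\<lambda>x. u x - h i x)" using iu ih by simp
    have lin: "conv (\<eta> n) u x = conv (\<eta> n) (\<lambda>x. u x - h i x) x + conv (\<eta> n) (h i) x" for x
      using integrable_kernel[OF mollifierD(8)[OF M] C ihu, of x]
        integrable_kernel[OF mollifierD(8)[OF M] C ih, of x i]
        integrable_kernel[OF mollifierD(8)[OF M] C iu, of x]
      by (simp add: conv_def right_diff_distrib)
    note ints = integrable_conv(1)[OF M ihu] integrable_conv(1)[OF M ih, of i]
      integrable_conv(1)[OF M iu]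
    have "(LINT x|lborel. \<bar>conv (\<eta> n) u x - u x\<bar>) \<le>
       (LINT x|lborel. \<bar>conv (\<eta> n) (\<lambda>x. u x - h i x) x\<bar> + \<bar>conv (\<eta> n) (h i) x - h i x\<bar> + \<bar>h i x - u x\<bar>)"
      using ints iu ih[of i] by (intro integral_mono) (auto simp: lin)
    also have "\<dots> = (LINT x|lborel. \<bar>conv (\<eta> n) (\<lambda>x. u x - h i x) x\<bar>) +
       (LINT x|lborel. \<bar>conv (\<eta> n) (h i) x - h i x\<bar>) + (LINT x|lborel. \<bar>h i x - u x\<bar>)"
      using ints iu ih[of i] by simp
    also have "\<dots> \<le> \<delta> / 4 + \<delta>' * V + \<delta> / 4"
      using integrable_conv(2)[OF M ihu] close[OF n] i
      by (simp add: abs_minus_commute)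
    also have "\<dots> < \<delta>"
    proof -
      have "\<delta>' * V = (\<delta> / 4) * (V / (V + 1))" by (simp add: \<delta>'_def)
      also have "\<dots> \<le> (\<delta> / 4) * 1" using V \<delta> by (intro mult_left_mono) auto
      finally show ?thesis using \<delta> by linarith
    qed
    finally have "(LINT x|lborel. \<bar>conv (\<eta> n) u x - u x\<bar>) < \<delta>" .
    moreover have "0 \<le> (LINT x|lborel. \<bar>conv (\<eta> n) u x - u x\<bar>)" by simp
    ultimately show "norm ((LINT x|lborel. \<bar>conv (\<eta> n) u x - u x\<bar>) - 0) < \<delta>"
      by (metis diff_zero real_norm_def abs_of_nonneg)
  qed
qed

section \<open>Smooth steps and approximation by separable functions\<close>

text \<open>
  A second difference of \<^term>\<open>sqpos\<close>: it rises from \<open>0\<close> at \<open>0\<close> to \<open>1\<close> at \<open>1\<close>.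
\<close>

definition smooth_step :: "real \<Rightarrow> real" where
  "smooth_step t = 2 * sqpos t - 4 * sqpos (t - 1/2) + 2 * sqpos (t - 1)"

definition smooth_step' :: "real \<Rightarrow> real" where
  "smooth_step' t = 4 * max 0 t - 8 * max 0 (t - 1/2) + 4 * max 0 (t - 1)"

lemma sqpos_has_derivative_comp [derivative_intros]:
  "(f has_field_derivative D) (at x within S) \<Longrightarrow>
    ((\<lambda>x. sqpos (f x)) has_real_derivative (2 * max 0 (f x) * D)) (at x within S)"
  using DERIV_chain2[OF sqpos_has_derivative] by simp

lemma smooth_step_has_derivative: "(smooth_step has_real_derivative smooth_step' t) (at t)"
  unfolding smooth_step_def[abs_def] smooth_step'_def
  by (auto intro!: derivative_eq_intros)

lemma smooth_step_has_derivative_comp [derivative_intros]: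
  "(f has_field_derivative D) (at x within S) \<Longrightarrow>
    ((\<lambda>x. smooth_step (f x)) has_real_derivative (smooth_step' (f x) * D)) (at x within S)"
  using DERIV_chain2[OF smooth_step_has_derivative] by simp

lemma continuous_on_smooth_step' [continuous_intros]:
  "continuous_on S f \<Longrightarrow> continuous_on S (\<lambda>x. smooth_step' (f x))"
  unfolding smooth_step'_def by (intro continuous_intros)

lemma continuous_on_smooth_step [continuous_intros]:
  "continuous_on S f \<Longrightarrow> continuous_on S (\<lambda>x. smooth_step (f x))"
  unfolding smooth_step_def sqpos_def by (intro continuous_intros)

lemma smooth_step_eq: "t \<le> 0 \<Longrightarrow> smooth_step t = 0" "1 \<le> t \<Longrightarrow> smooth_step t = 1"
  by (simp_all add: smooth_step_def sqpos_def max_def power2_eq_square) (simp add: algebra_simps)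

lemma smooth_step'_eq: "t \<le> 0 \<Longrightarrow> smooth_step' t = 0" "1 \<le> t \<Longrightarrow> smooth_step' t = 0"
  by (simp_all add: smooth_step'_def)

lemma smooth_step'_bounds: "0 \<le> smooth_step' t" "smooth_step' t \<le> 2"
  by (auto simp: smooth_step'_def max_def)

lemma smooth_step_mono: "s \<le> t \<Longrightarrow> smooth_step s \<le> smooth_step t"
  by (rule DERIV_nonneg_imp_nondecreasing[of s t smooth_step])
    (use smooth_step_has_derivative smooth_step'_bounds in blast)+

lemma smooth_step_bounds: "0 \<le> smooth_step t" "smooth_step t \<le> 1"
  using smooth_step_mono[of "min 0 t" t] smooth_step_mono[of t "max 1 t"]
    smooth_step_eq(1)[of "min 0 t"] smooth_step_eq(2)[of "max 1 t"] by auto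

lemma real_polynomial_C1:
  fixes p :: "real \<Rightarrow> real"
  assumes "real_polynomial_function p"
  shows "\<exists>p'. (\<forall>t. (p has_real_derivative p' t) (at t)) \<and> continuous_on UNIV p'"
  using assms
proof induction
  case (linear f)
  have "f x = f 1 * x" for x
    using linear_cmul[OF bounded_linear.linear[OF linear], of x 1] by (simp only: real_scaleR_def) simp
  then have f: "f = (*) (f 1)" by blast
  have "(f has_real_derivative f 1) (at t)" for t
    by (subst f) (rule DERIV_cmult_Id)
  then show ?case
    by (intro exI[of _ "\<lambda>_. f 1"]) simp
next
  case (const c)
  then show ?case by (intro exI[of _ "\<lambda>_. 0"]) auto
next
  case (add f g)
  then obtain f' g' where "\<And>t. (f has_real_derivative f' t) (at t)" "continuous_on UNIV f'"
    "\<And>t. (g has_real_derivative g' t) (at t)" "continuous_on UNIV g'" by auto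
  then show ?case
    by (intro exI[of _ "\<lambda>t. f' t + g' t"]) (auto intro!: derivative_intros continuous_intros)
next
  case (mult f g)
  then obtain f' g' where *: "\<And>t. (f has_real_derivative f' t) (at t)" "continuous_on UNIV f'"
    "\<And>t. (g has_real_derivative g' t) (at t)" "continuous_on UNIV g'" by auto
  have "continuous_on UNIV f" "continuous_on UNIV g"
    using * by (auto intro!: DERIV_isCont continuous_at_imp_continuous_on)
  then show ?case using *
    by (intro exI[of _ "\<lambda>t. f' t * g t + g' t * f t"])
      (auto intro!: derivative_eq_intros continuous_intros)
qed

lemma C1_approximation:
  fixes g :: "real \<Rightarrow> real"
  assumes "continuous_on {a..b} g" "e > 0"
  obtains p p' where "\<And>t. (p has_real_derivative p' t) (at t)" "continuous_on UNIV p'"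
    "\<And>t. t \<in> {a..b} \<Longrightarrow> \<bar>p t - g t\<bar> < e"
proof -
  have "\<exists>p. real_polynomial_function p \<and> (\<forall>x\<in>{a..b}. \<bar>g x - p x\<bar> < e)"
    by (rule Stone_Weierstrass_real_polynomial_function[OF compact_Icc assms]) auto
  then obtain p where p: "real_polynomial_function p" "\<And>x. x \<in> {a..b} \<Longrightarrow> \<bar>g x - p x\<bar> < e"
    by blast
  from real_polynomial_C1[OF p(1)] obtain p' where
    p': "\<forall>t. (p has_real_derivative p' t) (at t)" "continuous_on UNIV p'" by blast
  show thesis
  proof (rule that[OF p'(1)[rule_format] p'(2)])
    show "\<bar>p t - g t\<bar> < e" if "t \<in> {a..b}" for t
      using p(2)[OF that] by linarith
  qed
qed

text \<open>
  Finite sums of products of a function of \<open>x\<close> and a function of \<open>t\<close>. A primitive in \<open>t\<close> of such a function is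
  jointly \<open>C\<^sup>1\<close> for trivial reasons, even after multiplication by a merely continuous weight.
\<close>

inductive separable :: "('a::euclidean_space \<times> real \<Rightarrow> real) \<Rightarrow> bool" where
  base: "C1_deriv a D \<Longrightarrow> continuous_on UNIV b \<Longrightarrow> separable (\<lambda>(x, t). a x * b t)"
| add: "separable f \<Longrightarrow> separable g \<Longrightarrow> separable (\<lambda>p. f p + g p)"

lemma separable_mult:
  assumes "separable f" "separable g"
  shows "separable (\<lambda>p. f p * g p)"
  using assms
proof (induction f)
  case (base a D b)
  from base(3) show ?case
  proof (induction g)
    case (base a' D' b')
    have "separable (\<lambda>(x, t). (a x * a' x) * (b t * b' t))"
      by (rule separable.base[OF C1_deriv_mult]) 
        (use base \<open>C1_deriv a D\<close> \<open>continuous_on UNIV b\<close> in \<open>auto intro: continuous_intros\<close>)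
    then show ?case by (simp add: case_prod_beta' mult_ac)
  next
    case (add f g)
    show ?case using separable.add[OF add.IH] by (simp add: distrib_left)
  qed
next
  case (add f g')
  show ?case using separable.add[OF add.IH(1)[OF add.prems] add.IH(2)[OF add.prems]]
    by (simp add: distrib_right)
qed

lemma separable_fst: "C1_deriv a D \<Longrightarrow> separable (\<lambda>p. a (fst p))"
  using separable.base[of a D "\<lambda>_. 1"] by (simp add: case_prod_beta')

lemma separable_snd: "continuous_on UNIV b \<Longrightarrow> separable (\<lambda>p :: 'a::euclidean_space \<times> real. b (snd p))"
  using separable.base[OF C1_deriv_const[of 1], of b] by (simp add: case_prod_beta')

text \<open>
  A linear form on the product splits as the sum of its restrictions to the two factors, and
  separable functions form an algebra.
\<close>

lemma separable_polynomial:
  fixes p :: "'a::euclidean_space \<times> real \<Rightarrow> real"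
  assumes "real_polynomial_function p"
  shows "separable p"
  using assms
proof induction
  case (linear f)
  interpret f: bounded_linear f by fact
  have l1: "bounded_linear (\<lambda>x. f (x, 0))" and l2: "bounded_linear (\<lambda>t. f (0, t))"
    by (auto intro!: bounded_linear_compose[OF linear] bounded_linear_Pair bounded_linear_ident
        bounded_linear_zero)
  have "separable (\<lambda>p. f (fst p, 0) + f (0, snd p))"
    by (intro separable.add separable_fst[OF C1_deriv_bounded_linear[OF l1]]
        separable_snd linear_continuous_on l2)
  moreover have "f (fst p, 0) + f (0, snd p) = f p" for p
    using f.add[of "(fst p, 0)" "(0, snd p)"] by simp
  ultimately show ?case by simp
next
  case (const c)
  show ?case using separable_snd[of "\<lambda>_. c"] by simp
qed (auto intro: separable.add separable_mult)

lemma separable_continuous: "separable f \<Longrightarrow> continuous_on UNIV f"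
proof (induction rule: separable.induct)
  case (base a D b)
  have "continuous_on UNIV (\<lambda>p. a (fst p) * b (snd p))"
    by (intro continuous_intros continuous_on_compose2[OF C1_deriv_continuous[OF base(1)]]
        continuous_on_compose2[OF base(2)]) auto
  then show ?case by (simp add: case_prod_beta')
qed (intro continuous_intros)

lemma continuous_antiderivative:
  fixes g :: "real \<Rightarrow> real"
  assumes "continuous_on UNIV g"
  obtains G where "\<And>t. (G has_real_derivative g t) (at t)" "G 0 = 0"
proof -
  have "isCont g x" for x using assms by (simp add: continuous_on_eq_continuous_at)
  then obtain F where F: "\<And>t. (F has_vector_derivative g t) (at t)"
    using einterval_antiderivative[of "-\<infinity>" \<infinity> g] by auto
  show thesis
  proof (rule that[of "\<lambda>t. F t - F 0"])
    show "((\<lambda>t. F t - F 0) has_real_derivative g t) (at t)" for t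
      using F[of t] by (auto intro!: derivative_eq_intros simp: has_real_derivative_iff_has_vector_derivative)
  qed simp
qed

lemma separable_primitive:
  assumes "separable \<rho>" and w: "continuous_on UNIV w"
  shows "\<exists>A D. C1_deriv A D \<and> (\<forall>x. A (x, 0) = 0) \<and>
    (\<forall>x y. ((\<lambda>y. A (x, y)) has_real_derivative \<rho> (x, y) * w y) (at y))"
  using assms(1)
proof induction
  case (base a D b)
  have "continuous_on UNIV (\<lambda>t. b t * w t)" by (intro continuous_intros base w)
  then obtain G where G: "\<And>t. (G has_real_derivative b t * w t) (at t)" "G 0 = 0"
    using continuous_antiderivative[of "\<lambda>t. b t * w t"] by blast
  have a: "C1_deriv (\<lambda>p. a (fst p)) (\<lambda>p h. D (fst p) (fst h))"
    by (rule C1_deriv_compose_linear[OF base(1) bounded_linear_fst])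
  have g: "C1_deriv (\<lambda>p :: 'a \<times> real. G (snd p)) (\<lambda>p h. snd h * (b (snd p) * w (snd p)))"
    by (rule C1_deriv_real_compose[OF C1_deriv_bounded_linear[OF bounded_linear_snd] G(1)])
      (intro continuous_intros base w)
  show ?case
  proof (intro exI conjI allI)
    show "C1_deriv (\<lambda>p. a (fst p) * G (snd p))
       (\<lambda>x h. a (fst x) * (snd h * (b (snd x) * w (snd x))) + D (fst x) (fst h) * G (snd x))"
      by (rule C1_deriv_mult[OF a g])
    show "a (fst (x, 0)) * G (snd (x, 0)) = 0" for x by (simp add: G)
    show "((\<lambda>y. a (fst (x, y)) * G (snd (x, y))) has_real_derivative
         (case (x, y) of (x, t) \<Rightarrow> a x * b t) * w y) (at y)" for x y
      using DERIV_cmult[OF G(1), of "a x" y] by (simp add: mult.assoc)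
  qed
next
  case (add f g)
  then obtain A D A' D' where "C1_deriv A D" "\<And>x. A (x, 0) = 0"
    "\<And>x y. ((\<lambda>y. A (x, y)) has_real_derivative f (x, y) * w y) (at y)"
    "C1_deriv A' D'" "\<And>x. A' (x, 0) = 0"
    "\<And>x y. ((\<lambda>y. A' (x, y)) has_real_derivative g (x, y) * w y) (at y)" by blast
  then show ?case
    by (intro exI[of _ "\<lambda>p. A p + A' p"] exI[of _ "\<lambda>x h. D x h + D' x h"])
      (auto intro!: C1_deriv_add derivative_eq_intros simp: distrib_right)
qed

text \<open>
  The indicator is first approximated by continuous functions with values in the unit interval, and
  these by polynomials, which are squeezed back into the unit interval on the ball.
\<close>

lemma indicator_AE_limit_of_separable:
  fixes M :: "('a::euclidean_space \<times> real) set"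
  assumes M: "M \<in> sets borel"
  obtains \<rho> :: "nat \<Rightarrow> 'a \<times> real \<Rightarrow> real"
  where "\<And>n. separable (\<rho> n)" "\<And>n p. norm p \<le> R \<Longrightarrow> 0 \<le> \<rho> n p \<and> \<rho> n p \<le> 1"
    "AE p in lborel. norm p \<le> R \<longrightarrow> (\<lambda>n. \<rho> n p) \<longlonglongrightarrow> indicator M p"
proof -
  obtain g :: "nat \<Rightarrow> 'a \<times> real \<Rightarrow> real" where g: "\<And>n. continuous_on UNIV (g n)"
    "\<And>n x. 0 \<le> g n x" "\<And>n x. g n x \<le> 1" "AE p in lborel. (\<lambda>n. g n p) \<longlonglongrightarrow> indicator M p"
    using borel_AE_limit_of_continuous[of "indicator M :: _ \<Rightarrow> real" 0 1] M by auto
  have "\<exists>q. real_polynomial_function q \<and> (\<forall>p\<in>cball 0 R. \<bar>g n p - q p\<bar> < 1 / Suc n)" for n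
    by (rule Stone_Weierstrass_real_polynomial_function[of "cball 0 R" "g n" "1 / Suc n"])
      (auto intro: continuous_on_subset[OF g(1)])
  then obtain q where q0: "\<forall>n. real_polynomial_function (q n) \<and> (\<forall>p\<in>cball 0 R. \<bar>g n p - q n p\<bar> < 1 / Suc n)"
    using choice[of "\<lambda>n q. real_polynomial_function q \<and> (\<forall>p\<in>cball 0 R. \<bar>g n p - q p\<bar> < 1 / Suc n)"]
    by blast
  have q: "real_polynomial_function (q n)" for n using q0 by blast
  have q2: "\<bar>g n p - q n p\<bar> < 1 / Suc n" if "norm p \<le> R" for n p
    using q0 that by (simp add: dist_norm)
  define \<rho> where "\<rho> n p = (q n p + 1 / Suc n) * (1 / (1 + 2 / Suc n))" for n p
  show thesis
  proof (rule that[of \<rho>])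
    show "separable (\<rho> n)" for n
      unfolding \<rho>_def 
      by (rule separable_polynomial[OF real_polynomial_function.intros(4)[OF
            real_polynomial_function.intros(3)[OF q real_polynomial_function.intros(2)]
            real_polynomial_function.intros(2)]])
    show "0 \<le> \<rho> n p \<and> \<rho> n p \<le> 1" if "norm p \<le> R" for n p
    proof -
      have s: "0 < 1 + 2 / real (Suc n)" by (intro add_pos_nonneg) auto
      have "0 \<le> q n p + 1 / Suc n" "q n p + 1 / Suc n \<le> 1 + 2 / Suc n"
        using q2[OF that, of n] g(2,3)[of n p] unfolding abs_less_iff by linarith+
      then show ?thesis using s unfolding \<rho>_def by (simp add: divide_simps)
    qed
    show "AE p in lborel. norm p \<le> R \<longrightarrow> (\<lambda>n. \<rho> n p) \<longlonglongrightarrow> indicator M p"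
      using g(4)
    proof eventually_elim
      case (elim p)
      show ?case
      proof
        assume p: "norm p \<le> R"
        have n0: "(\<lambda>n. 1 / real (Suc n)) \<longlonglongrightarrow> 0"
          using LIMSEQ_inverse_real_of_nat by (simp add: inverse_eq_divide)
        have "(\<lambda>n. q n p - g n p) \<longlonglongrightarrow> 0"
        proof (rule Lim_null_comparison[OF _ n0], rule always_eventually, rule allI)
          show "norm (q n p - g n p) \<le> 1 / real (Suc n)" for n
            using q2[OF p, of n] unfolding real_norm_def by linarith
        qed
        from tendsto_add[OF this elim] have qn: "(\<lambda>n. q n p) \<longlonglongrightarrow> indicator M p" by simp
        have "(\<lambda>n. (q n p + 1 / real (Suc n)) * (1 / (1 + 2 * (1 / real (Suc n))))) \<longlonglongrightarrow>
          (indicator M p + 0) * (1 / (1 + 2 * 0))"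
          by (intro tendsto_mult[OF tendsto_add[OF qn n0]] tendsto_divide[OF tendsto_const]
              tendsto_add[OF tendsto_const tendsto_mult[OF tendsto_const n0]]) simp
        then show "(\<lambda>n. \<rho> n p) \<longlonglongrightarrow> indicator M p" by (simp add: \<rho>_def)
      qed
    qed
  qed
qed

section \<open>The weight on the line\<close>

text \<open>
  The weight on an interval \<open>J = (0, \<alpha>\<^sub>1)\<close> in the form in which it is used: \<open>w\<close> is extended to a continuous
  nonnegative function on the line, so that \<open>W\<close> is a \<open>C\<^sup>1\<close> function on the whole line, and \<open>f\<close> is \<open>w\<close> in the
  variable \<open>z = W(y)\<close>. The triangle inequality for \<open>f\<close> is stated for the lengths \<open>a\<close>, \<open>b\<close> of two adjacent
  intervals.
\<close>

locale calibrated_weight =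
  fixes w W f :: "real \<Rightarrow> real" and J :: "real set" and \<alpha> :: ereal
  assumes w_cont: "continuous_on UNIV w" and w_nonneg: "\<And>y. 0 \<le> w y"
    and J_open: "open J" and J_pos: "\<And>y. y \<in> J \<Longrightarrow> 0 < y"
    and J_down: "\<And>x y. y \<in> J \<Longrightarrow> 0 < x \<Longrightarrow> x \<le> y \<Longrightarrow> x \<in> J"
    and w_pos: "\<And>y. y \<in> J \<Longrightarrow> 0 < w y"
    and W_deriv: "\<And>y. (W has_real_derivative w y) (at y)" and W_0: "W 0 = 0"
    and \<alpha>_pos: "0 < \<alpha>"
    and W_less: "\<And>y. y \<in> J \<Longrightarrow> ereal (W y) < \<alpha>"
    and W_reach: "\<And>z. ereal z < \<alpha> \<Longrightarrow> \<exists>y\<in>J. z < W y"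
    and f_cont: "continuous_on {z. 0 \<le> z \<and> ereal z \<le> \<alpha>} f"
    and f_W: "\<And>y. y \<in> J \<Longrightarrow> f (W y) = w y"
    and f_triangle: "\<And>a b. 0 \<le> a \<Longrightarrow> 0 \<le> b \<Longrightarrow> ereal (a + b) \<le> \<alpha> \<Longrightarrow> f a \<le> f b + f (a + b)"
    and f_symmetric: "\<And>z. \<alpha> < \<infinity> \<Longrightarrow> 0 \<le> z \<Longrightarrow> ereal z \<le> \<alpha> \<Longrightarrow> f z = f (real_of_ereal \<alpha> - z)"
begin

lemma W_cont: "continuous_on S W"
  using W_deriv by (auto intro!: continuous_at_imp_continuous_on DERIV_isCont)

lemma W_mono: "x \<le> y \<Longrightarrow> W x \<le> W y"
  by (rule DERIV_nonneg_imp_nondecreasing[of x y W]) (use W_deriv w_nonneg in blast)+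

lemma W_strict_mono:
  assumes "y \<in> J" "0 \<le> x" "x < y"
  shows "W x < W y"
proof -
  obtain z where z: "x < z" "z < y" "W y - W x = (y - x) * w z"
    using MVT2[of x y W w] assms W_deriv by auto
  have "0 < w z" using z assms J_down[of y z] w_pos by auto
  then have "0 < (y - x) * w z" using assms by (intro mult_pos_pos) auto
  then show ?thesis using z by linarith
qed

lemma W_pos: "y \<in> J \<Longrightarrow> 0 < W y"
  using W_strict_mono[of y 0] J_pos W_0 by force

lemma W_surj:
  assumes "0 < z" "ereal z < \<alpha>"
  shows "\<exists>y\<in>J. W y = z"
proof -
  obtain u where u: "u \<in> J" "z < W u" using W_reach assms by blast
  then have "\<exists>y\<ge>0. y \<le> u \<and> W y = z"
    using assms W_0 J_pos[of u] by (intro IVT') (auto intro: W_cont)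
  then obtain y where y: "0 \<le> y" "y \<le> u" "W y = z" by blast
  then have "0 < y" using assms W_0 by (cases "y = 0") auto
  then show ?thesis using y J_down[OF u(1)] by blast
qed

text \<open>
  The triangle inequality with \<open>a = b = z/2\<close>.
\<close>

lemma f_nonneg:
  assumes "0 \<le> z" "ereal z \<le> \<alpha>"
  shows "0 \<le> f z"
  using f_triangle[of "z / 2" "z / 2"] assms by simp

lemma f_pos:
  assumes "0 < z" "ereal z < \<alpha>"
  shows "0 < f z"
  using W_surj[OF assms] f_W w_pos by auto

text \<open>
  Levels between which the vertical fields are faded out. For infinite \<open>\<alpha>\<close> the gap must grow, because
  there the error of fading out is bounded by the slope times the measure of the slice.
\<close>

lemma levels_exist:
  obtains b B :: "nat \<Rightarrow> real"
  where "\<And>i. 0 < b i" "\<And>i. b i < B i" "\<And>i. ereal (B i) < \<alpha>"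
    "\<And>z. ereal z < \<alpha> \<Longrightarrow> eventually (\<lambda>i. z < b i) sequentially"
    "\<And>i. \<alpha> = \<infinity> \<Longrightarrow> B i - b i = Suc i"
proof (cases \<alpha>)
  case PInf
  show thesis
  proof (rule that[of "\<lambda>i. Suc i" "\<lambda>i. 2 * Suc i"])
    show "eventually (\<lambda>i. z < real (Suc i)) sequentially" for z
    proof -
      obtain n where "z < real n" using reals_Archimedean2 by blast
      then have "z < real (Suc i)" if "n \<le> i" for i using that by linarith
      then show ?thesis unfolding eventually_sequentially by blast
    qed
  qed (use PInf in auto)
next
  case (real a)
  then have a: "a > 0" using \<alpha>_pos by simp
  have n0: "(\<lambda>n. 1 / real (Suc n)) \<longlonglongrightarrow> 0"
    using LIMSEQ_inverse_real_of_nat by (simp add: inverse_eq_divide)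
  show thesis
  proof (rule that[of "\<lambda>i. a * (1 - 1 / Suc (Suc i))" "\<lambda>i. a * (1 - 1 / (2 * Suc (Suc i)))"])
    show "eventually (\<lambda>i. z < a * (1 - 1 / real (Suc (Suc i)))) sequentially" if "ereal z < \<alpha>" for z
    proof -
      have "(\<lambda>i. a * (1 - 1 / real (Suc (Suc i)))) \<longlonglongrightarrow> a * (1 - 0)"
        by (intro tendsto_mult tendsto_diff tendsto_const LIMSEQ_Suc[OF n0])
      then show ?thesis using order_tendstoD(1)[of _ "a * (1 - 0)" sequentially z] that real by simp
    qed
  qed (use real a in \<open>auto simp: field_simps intro: add_pos_nonneg add_nonneg_pos\<close>)
qed (use \<alpha>_pos in auto)

lemma endpoints_exist:
  obtains \<beta> :: "nat \<Rightarrow> real" where "\<And>i. \<beta> i \<in> J" 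
    "\<And>y. y \<in> J \<Longrightarrow> eventually (\<lambda>i. y < \<beta> i) sequentially"
proof -
  obtain b B :: "nat \<Rightarrow> real" where b: "\<And>i. 0 < b i" "\<And>i. b i < B i" "\<And>i. ereal (B i) < \<alpha>"
    "\<And>z. ereal z < \<alpha> \<Longrightarrow> eventually (\<lambda>i. z < b i) sequentially"
    using levels_exist by metis
  have "\<exists>y\<in>J. W y = b i" for i
    using b(1,2,3)[of i] by (intro W_surj) (auto intro: less_trans[of _ "ereal (B i)"])
  then obtain \<beta> where \<beta>: "\<And>i. \<beta> i \<in> J" "\<And>i. W (\<beta> i) = b i" by metis
  show thesis
  proof (rule that[of \<beta>, OF \<beta>(1)])
    fix y assume y: "y \<in> J"
    show "eventually (\<lambda>i. y < \<beta> i) sequentially"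
      using b(4)[OF W_less[OF y]]
    proof eventually_elim
      case (elim i)
      then show ?case using W_mono[of "\<beta> i" y] \<beta>(2)[of i] by (cases "y < \<beta> i") auto
    qed
  qed
qed

lemma horizontal_profile:
  assumes u: "u \<in> J" and l: "0 < l" and d: "0 < d"
  obtains \<zeta> \<zeta>' where "\<And>t. (\<zeta> has_real_derivative \<zeta>' t) (at t)" "continuous_on UNIV \<zeta>'"
    "\<And>t. 0 \<le> \<zeta> t" "\<And>t. \<zeta> t \<le> w t" "\<And>t. t \<notin> {l..u} \<Longrightarrow> \<zeta> t = 0"
    "\<And>t. 2 * l \<le> t \<Longrightarrow> t \<le> u - l \<Longrightarrow> \<bar>\<zeta> t - w t\<bar> \<le> d"
proof -
  have sub: "{l..u} \<subseteq> J" using J_down[OF u] l by auto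
  have "\<exists>c>0. \<forall>t\<in>{l..u}. c \<le> w t"
  proof (cases "{l..u} = {}")
    case False
    then obtain s where "s \<in> {l..u}" "\<forall>t\<in>{l..u}. w s \<le> w t"
      using continuous_attains_inf[of "{l..u}" w] continuous_on_subset[OF w_cont] by auto
    then show ?thesis using sub w_pos by blast
  qed (auto intro: exI[of _ 1])
  then obtain c where c: "c > 0" "\<And>t. t \<in> {l..u} \<Longrightarrow> c \<le> w t" by auto
  \<comment> \<open>Approximating \<open>w - e\<close> within \<open>e\<close> stays between \<open>w - 2 e\<close> and \<open>w\<close>, and \<open>2 e\<close> is below the minimum of \<open>w\<close>.\<close>
  define e where "e = min c d / 2"
  have e: "e > 0" "2 * e \<le> c" "2 * e \<le> d" using c d by (auto simp: e_def)
  obtain p p' where p: "\<And>t. (p has_real_derivative p' t) (at t)" "continuous_on UNIV p'"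
    "\<And>t. t \<in> {l..u} \<Longrightarrow> \<bar>p t - (w t - e)\<bar> < e"
  proof (rule C1_approximation[of l u "\<lambda>t. w t - e" e])
    show "continuous_on {l..u} (\<lambda>t. w t - e)"
      by (intro continuous_intros continuous_on_subset[OF w_cont]) auto
  qed (use e in auto)
  define s where "s t = smooth_step (t / l - 1) * smooth_step ((u - t) / l)" for t
  define s' where "s' t = smooth_step' (t / l - 1) * (1 / l) * smooth_step ((u - t) / l) +
     smooth_step' ((u - t) / l) * (- 1 / l) * smooth_step (t / l - 1)" for t
  have ds: "(s has_real_derivative s' t) (at t)" for t
    unfolding s_def[abs_def] s'_def using l by (auto intro!: derivative_eq_intros)
  have cs': "continuous_on UNIV s'"
    unfolding s'_def[abs_def] using l by (intro continuous_intros) auto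
  have s: "0 \<le> s t" "s t \<le> 1" for t
    using smooth_step_bounds by (auto simp: s_def mult_le_one)
  have s0: "s t = 0" if "t \<notin> {l..u}" for t
  proof -
    have "t / l - 1 \<le> 0 \<or> (u - t) / l \<le> 0" using that l by (auto simp: field_simps)
    then show ?thesis by (auto simp: s_def smooth_step_eq)
  qed
  have s1: "s t = 1" if "2 * l \<le> t" "t \<le> u - l" for t
  proof -
    have "1 \<le> t / l - 1" "1 \<le> (u - t) / l" using that l by (auto simp: field_simps)
    then show ?thesis by (auto simp: s_def smooth_step_eq)
  qed
  have pb: "0 \<le> p t" "p t \<le> w t" "\<bar>p t - w t\<bar> \<le> d" if "t \<in> {l..u}" for t
    using p(3)[OF that] c(2)[OF that] e by auto
  have cp: "continuous_on UNIV p"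
    using p(1) by (auto intro!: DERIV_isCont continuous_at_imp_continuous_on)
  have cs: "continuous_on UNIV s"
    using ds by (auto intro!: DERIV_isCont continuous_at_imp_continuous_on)
  show thesis
  proof (rule that[of "\<lambda>t. s t * p t" "\<lambda>t. s' t * p t + p' t * s t"])
    show "((\<lambda>t. s t * p t) has_real_derivative s' t * p t + p' t * s t) (at t)" for t
      by (rule DERIV_mult[OF ds p(1)])
    show "continuous_on UNIV (\<lambda>t. s' t * p t + p' t * s t)"
      by (intro continuous_intros cs' cp cs p(2))
    show "0 \<le> s t * p t" for t using s[of t] s0[of t] pb(1)[of t] by (cases "t \<in> {l..u}") auto
    show "s t * p t \<le> w t" for t
      using s[of t] s0[of t] pb(1,2)[of t] w_nonneg[of t] mult_left_le_one_le[of "p t" "s t"]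
      by (cases "t \<in> {l..u}") auto
    show "s t * p t = 0" if "t \<notin> {l..u}" for t using s0[OF that] by simp
    show "\<bar>s t * p t - w t\<bar> \<le> d" if "2 * l \<le> t" "t \<le> u - l" for t
      using s1[OF that] pb(3)[of t] that l by auto
  qed
qed

text \<open>
  The horizontal component of a test field has to be \<open>C\<^sup>1\<close> with compact support in \<open>y\<close>, so it cannot
  carry the factor \<open>w\<close> itself; these functions approach \<open>w\<close> from below.
\<close>

lemma horizontal_profiles:
  obtains \<zeta> \<zeta>' :: "nat \<Rightarrow> real \<Rightarrow> real" and l u :: "nat \<Rightarrow> real"
  where "\<And>i t. (\<zeta> i has_real_derivative \<zeta>' i t) (at t)" "\<And>i. continuous_on UNIV (\<zeta>' i)"
    "\<And>i t. 0 \<le> \<zeta> i t" "\<And>i t. \<zeta> i t \<le> w t" "\<And>i. 0 < l i" "\<And>i. u i \<in> J"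
    "\<And>i t. t \<notin> {l i..u i} \<Longrightarrow> \<zeta> i t = 0" "\<And>t. t \<in> J \<Longrightarrow> (\<lambda>i. \<zeta> i t) \<longlonglongrightarrow> w t"
proof -
  obtain \<beta> :: "nat \<Rightarrow> real" where \<beta>: "\<And>i. \<beta> i \<in> J"
    "\<And>y. y \<in> J \<Longrightarrow> eventually (\<lambda>i. y < \<beta> i) sequentially"
    using endpoints_exist by metis
  define l where "l i = 1 / real (Suc i)" for i
  have l: "l i > 0" for i by (simp add: l_def)
  have l0: "l \<longlonglongrightarrow> 0" unfolding l_def[abs_def]
    using LIMSEQ_inverse_real_of_nat by (simp add: inverse_eq_divide)
  have "\<exists>\<zeta> \<zeta>'. (\<forall>t. (\<zeta> has_real_derivative \<zeta>' t) (at t)) \<and> continuous_on UNIV \<zeta>' \<and>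
    (\<forall>t. 0 \<le> \<zeta> t) \<and> (\<forall>t. \<zeta> t \<le> w t) \<and> (\<forall>t. t \<notin> {l i..\<beta> i} \<longrightarrow> \<zeta> t = 0) \<and>
    (\<forall>t. 2 * l i \<le> t \<longrightarrow> t \<le> \<beta> i - l i \<longrightarrow> \<bar>\<zeta> t - w t\<bar> \<le> l i)" for i
    by (rule horizontal_profile[OF \<beta>(1)[of i] l[of i] l[of i]]) blast
  then obtain \<zeta> \<zeta>' where X: "\<forall>i. (\<forall>t. (\<zeta> i has_real_derivative \<zeta>' i t) (at t)) \<and> continuous_on UNIV (\<zeta>' i) \<and>
    (\<forall>t. 0 \<le> \<zeta> i t) \<and> (\<forall>t. \<zeta> i t \<le> w t) \<and> (\<forall>t. t \<notin> {l i..\<beta> i} \<longrightarrow> \<zeta> i t = 0) \<and>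
    (\<forall>t. 2 * l i \<le> t \<longrightarrow> t \<le> \<beta> i - l i \<longrightarrow> \<bar>\<zeta> i t - w t\<bar> \<le> l i)" by metis
  show thesis
  proof (rule that[of \<zeta> \<zeta>' l \<beta>])
    fix t assume t: "t \<in> J"
    obtain t' where t': "t' \<in> J" "t < t'"
    proof -
      obtain e where "e > 0" "ball t e \<subseteq> J" using J_open t open_contains_ball by blast
      then show thesis by (intro that[of "t + e / 2"]) (auto simp: dist_norm)
    qed
    have e1: "eventually (\<lambda>i. l i < t' - t) sequentially"
      using order_tendstoD(2)[OF l0] t' by simp
    have e2: "eventually (\<lambda>i. l i < t / 2) sequentially"
      by (rule order_tendstoD(2)[OF l0]) (use J_pos[OF t] in simp)
    have "(\<lambda>i. \<zeta> i t - w t) \<longlonglongrightarrow> 0"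
    proof (rule Lim_null_comparison[OF _ l0])
      show "eventually (\<lambda>i. norm (\<zeta> i t - w t) \<le> l i) sequentially"
        using e1 e2 \<beta>(2)[OF t'(1)]
      proof eventually_elim
        case (elim i)
        then have "2 * l i \<le> t" "t \<le> \<beta> i - l i" by linarith+
        then show ?case using X unfolding real_norm_def by blast
      qed
    qed
    then show "(\<lambda>i. \<zeta> i t) \<longlonglongrightarrow> w t" by (rule LIM_zero_cancel)
  qed (use X l \<beta>(1) in blast)+
qed

end

section \<open>A profile calibrating the isoperimetric inequality on the line\<close>

context calibrated_weight begin

text \<open>
  The function \<open>f\<close> has to be lowered so that it vanishes near \<open>0\<close>, even if \<open>f(0) > 0\<close>, without losing the
  inequality \<open>|f(x) - f(y)| \<le> f(x + y)\<close>. Subtracting a nonincreasing \<open>\<theta>\<close> and taking the positive part works: if \<open>y\<close> is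
  large enough for \<open>\<theta>\<close> to be constant beyond it, then the positive part is a contraction; if \<open>y\<close> is small, then \<open>f(x)\<close> and \<open>f(x + y)\<close>
  differ by less than the constant that has been subtracted. Truncating \<open>f\<close> at height \<open>C\<close> keeps the inequality too,
  and makes the profiles bounded.
\<close>

lemma truncated_profile:
  assumes B: "0 < B" "ereal B < \<alpha>" and d: "0 < d" and e: "0 < e" and C: "0 < C"
  defines "g \<equiv> \<lambda>z. min (f z) C"
  obtains h r where "continuous_on {0..B} h" "0 < r" "\<And>z. 0 \<le> z \<Longrightarrow> z \<le> r \<Longrightarrow> h z = 0"
    "\<And>z. 0 \<le> z \<Longrightarrow> z \<le> B \<Longrightarrow> 0 \<le> h z \<and> h z \<le> g z"
    "\<And>z. e \<le> z \<Longrightarrow> z \<le> B \<Longrightarrow> g z - d \<le> h z"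
    "\<And>x y. 0 \<le> x \<Longrightarrow> 0 \<le> y \<Longrightarrow> x + y \<le> B \<Longrightarrow> \<bar>h x - h y\<bar> \<le> g (x + y)"
proof -
  have B\<alpha>: "ereal z \<le> \<alpha>" if "z \<le> B" for z
    using that B(2) by (meson ereal_less_eq(3) less_imp_le order_trans)
  have cg: "continuous_on {0..B} g"
    unfolding g_def by (intro continuous_intros continuous_on_subset[OF f_cont]) (auto intro: B\<alpha>)
  have g0: "0 \<le> g z" if "0 \<le> z" "z \<le> B" for z
    using f_nonneg[of z] B\<alpha> that C by (simp add: g_def)
  have tri: "g x \<le> g y + g (x + y)" if "0 \<le> x" "0 \<le> y" "x + y \<le> B" for x y
    using f_triangle[of x y] f_nonneg[of y] f_nonneg[of "x + y"] B\<alpha>[of "x + y"] B\<alpha>[of y] that C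
    unfolding g_def min_def by (auto split: if_splits)
  have "uniformly_continuous_on {0..B} g" by (intro compact_uniformly_continuous cg) auto
  then obtain m where m: "m > 0" "\<And>x y. x \<in> {0..B} \<Longrightarrow> y \<in> {0..B} \<Longrightarrow> dist y x < m \<Longrightarrow> dist (g y) (g x) < d / 2"
    using d unfolding uniformly_continuous_on_def by (metis half_gt_zero)
  define r where "r = min (m / 2) e"
  have r: "r > 0" "r < m" "r \<le> e" using m e by (auto simp: r_def)
  have mod: "\<bar>g x - g y\<bar> \<le> d / 2" if "0 \<le> x" "x \<le> B" "0 \<le> y" "y \<le> B" "\<bar>x - y\<bar> \<le> r" for x y
    using m(2)[of y x] that r by (auto simp: dist_real_def)
  \<comment> \<open>The excess over \<open>d\<close> starts at \<open>g 0\<close>, which makes \<open>g - \<theta>\<close> negative at \<open>0\<close>, and is used up at \<open>r\<close>.\<close>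
  define \<theta> where "\<theta> z = d + g 0 * max 0 (1 - z / r)" for z
  define h where "h z = max 0 (g z - \<theta> z)" for z
  have g00: "0 \<le> g 0" using g0 B by simp
  have \<theta>: "d \<le> \<theta> z" for z using g00 by (simp add: \<theta>_def)
  have \<theta>r: "\<theta> z = d" if "r \<le> z" for z using that r by (simp add: \<theta>_def)
  have hle: "h z \<le> max 0 (g z - d)" for z using \<theta>[of z] by (auto simp: h_def)
  have h0: "0 \<le> h z" for z by (simp add: h_def)
  have key: "h x - h y \<le> g (x + y)" if xy: "0 \<le> x" "0 \<le> y" "x + y \<le> B" for x y
  proof (cases "y < r")
    case True
    have "\<bar>g x - g (x + y)\<bar> \<le> d / 2" by (rule mod) (use xy True in auto)
    then have "g x \<le> g (x + y) + d / 2" by linarith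
    then show ?thesis using hle[of x] h0[of y] g0[of "x + y"] xy d by auto
  next
    case False
    then have "h y = max 0 (g y - d)" by (simp add: h_def \<theta>r)
    then show ?thesis using hle[of x] tri[OF xy] g0[of "x + y"] xy by auto
  qed
  define r' where "r' = min B (min r (d * r / (2 * (g 0 + 1))))"
  have r': "r' > 0" "r' \<le> r" "r' \<le> B" "r' \<le> d * r / (2 * (g 0 + 1))"
    using r d B g00 by (auto simp: r'_def intro!: divide_pos_pos)
  show thesis
  proof (rule that[of h r'])
    show "continuous_on {0..B} h"
      unfolding h_def \<theta>_def using r by (intro continuous_intros cg) auto
    show "h z = 0" if z: "0 \<le> z" "z \<le> r'" for z
    proof -
      have "\<bar>g z - g 0\<bar> \<le> d / 2" by (rule mod) (use z r' in auto)
      then have "g z \<le> g 0 + d / 2" by linarith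
      moreover have "g 0 * (1 - z / r) \<le> g 0 * max 0 (1 - z / r)" using g00 by (intro mult_left_mono) auto
      moreover have "g 0 * (z / r) \<le> d / 2"
      proof -
        have "z * (2 * (g 0 + 1)) \<le> d * r"
          using z r' g00 by (simp add: pos_le_divide_eq[symmetric] order_trans[OF z(2) r'(4)])
        moreover have "0 \<le> z" by fact
        ultimately have "2 * (g 0 * z) \<le> d * r" by (simp add: algebra_simps)
        then show ?thesis using r by (simp add: field_simps)
      qed
      ultimately have "g z - \<theta> z \<le> 0" by (simp add: \<theta>_def right_diff_distrib)
      then show ?thesis by (simp add: h_def)
    qed
    show "0 \<le> h z \<and> h z \<le> g z" if "0 \<le> z" "z \<le> B" for z
      using h0[of z] hle[of z] g0[OF that] d by auto
    show "g z - d \<le> h z" if "e \<le> z" "z \<le> B" for z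
      using \<theta>r[of z] that r by (simp add: h_def)
    show "\<bar>h x - h y\<bar> \<le> g (x + y)" if "0 \<le> x" "0 \<le> y" "x + y \<le> B" for x y
      using key[OF that] key[of y x] that by (simp add: add.commute abs_le_iff)
  qed (use r' in auto)
qed

text \<open>
  A \<open>C\<^sup>1\<close> approximation of the truncated profile satisfies the inequality up to a small error. That error
  is absorbed by scaling, because \<open>f\<close> is bounded below on the range where the profile does not vanish.
\<close>

lemma calibration_profile:
  assumes B: "0 < B" "ereal B < \<alpha>" and e: "0 < e" and C: "0 < C"
  obtains F F' r where "\<And>t. (F has_real_derivative F' t) (at t)" "continuous_on UNIV F'"
    "0 < r" "\<And>z. z \<le> r \<Longrightarrow> F z = 0"
    "\<And>z. 0 \<le> z \<Longrightarrow> z \<le> B \<Longrightarrow> \<bar>F z\<bar> \<le> C + 1"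
    "\<And>z. e \<le> z \<Longrightarrow> z \<le> B \<Longrightarrow> \<bar>F z - min (f z) C\<bar> \<le> e"
    "\<And>x y. 0 \<le> x \<Longrightarrow> 0 \<le> y \<Longrightarrow> x + y \<le> B \<Longrightarrow> \<bar>F x - F y\<bar> \<le> f (x + y)"
proof -
  define g where "g z = min (f z) C" for z
  define d where "d = e / 3"
  have d: "d > 0" using e by (simp add: d_def)
  obtain h r where h: "continuous_on {0..B} h" "0 < r" "\<And>z. 0 \<le> z \<Longrightarrow> z \<le> r \<Longrightarrow> h z = 0"
    "\<And>z. 0 \<le> z \<Longrightarrow> z \<le> B \<Longrightarrow> 0 \<le> h z \<and> h z \<le> g z"
    "\<And>z. e \<le> z \<Longrightarrow> z \<le> B \<Longrightarrow> g z - d \<le> h z"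
    "\<And>x y. 0 \<le> x \<Longrightarrow> 0 \<le> y \<Longrightarrow> x + y \<le> B \<Longrightarrow> \<bar>h x - h y\<bar> \<le> g (x + y)"
    using truncated_profile[OF B d e C] unfolding g_def by blast
  have B\<alpha>: "ereal z < \<alpha>" if "z \<le> B" for z
    using that B(2) by (meson ereal_less_eq(3) le_less_trans)
  have cg: "continuous_on {r/2..B} g"
    unfolding g_def by (intro continuous_intros continuous_on_subset[OF f_cont])
      (use h(2) B\<alpha> in \<open>auto intro: less_imp_le\<close>)
  have "\<exists>c>0. \<forall>z\<in>{r/2..B}. c \<le> g z"
  proof (cases "{r/2..B} = {}")
    case False
    then obtain s where s: "s \<in> {r/2..B}" "\<forall>z\<in>{r/2..B}. g s \<le> g z"
      using continuous_attains_inf[OF compact_Icc _ cg] by auto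
    have "0 < g s" using s(1) h(2) B\<alpha>[of s] f_pos[of s] C by (simp add: g_def)
    then show ?thesis using s by blast
  qed (auto intro: exI[of _ 1])
  then obtain c where c: "c > 0" "\<And>z. r / 2 \<le> z \<Longrightarrow> z \<le> B \<Longrightarrow> c \<le> g z" by auto
  \<comment> \<open>The scaling factor below is \<open>c / (c + 2 q)\<close>; these bounds keep its effect below \<open>d\<close>.\<close>
  define q where "q = min 1 (min d (c * d / (2 * (C + 1))))"
  have q: "q > 0" "q \<le> 1" "q \<le> d" "q \<le> c * d / (2 * (C + 1))"
    using c d C by (auto simp: q_def intro!: divide_pos_pos)
  obtain p p' where p: "\<And>t. (p has_real_derivative p' t) (at t)" "continuous_on UNIV p'"
    "\<And>t. t \<in> {0..B} \<Longrightarrow> \<bar>p t - h t\<bar> < q"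
    using C1_approximation[OF h(1) q(1)] by blast
  define s where "s = c / (c + 2 * q)"
  have s: "0 < s" "s \<le> 1" using c q by (auto simp: s_def)
  define G where "G t = smooth_step (2 * t / r - 1) * p t" for t
  have G0: "G t = 0" if "t \<le> r / 2" for t
  proof -
    have "2 * t / r - 1 \<le> 0" using that h(2) by (simp add: field_simps)
    then show ?thesis by (simp add: G_def smooth_step_eq)
  qed
  have Gh: "\<bar>G t - h t\<bar> \<le> q" if t: "0 \<le> t" "t \<le> B" for t
  proof (cases "t \<le> r")
    case True
    then have "\<bar>p t\<bar> \<le> q" using p(3)[of t] h(3)[of t] t by auto
    then have "\<bar>G t\<bar> \<le> 1 * q" unfolding G_def abs_mult using smooth_step_bounds
      by (intro mult_mono) auto
    then show ?thesis using h(3)[of t] True t by simp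
  next
    case False
    then have "1 \<le> 2 * t / r - 1" using h(2) by (simp add: field_simps)
    then show ?thesis using p(3)[of t] t by (simp add: G_def smooth_step_eq)
  qed
  have GC: "\<bar>G t\<bar> \<le> C + 1" if t: "0 \<le> t" "t \<le> B" for t
    using Gh[OF t] h(4)[OF t] q(2) by (auto simp: g_def abs_le_iff min_def split: if_splits)
  have cp: "continuous_on UNIV p"
    using p(1) by (auto intro!: DERIV_isCont continuous_at_imp_continuous_on)
  show thesis
  proof (rule that[of "\<lambda>t. s * G t"
        "\<lambda>t. s * (smooth_step' (2 * t / r - 1) * (2 / r) * p t + p' t * smooth_step (2 * t / r - 1))" "r / 2"])
    show "((\<lambda>t. s * G t) has_real_derivative
        s * (smooth_step' (2 * t / r - 1) * (2 / r) * p t + p' t * smooth_step (2 * t / r - 1))) (at t)" for t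
      unfolding G_def using p(1)[of t] h(2) by (auto intro!: derivative_eq_intros)
    show "continuous_on UNIV (\<lambda>t. s * (smooth_step' (2 * t / r - 1) * (2 / r) * p t + p' t * smooth_step (2 * t / r - 1)))"
      using h(2) by (intro continuous_intros cp p(2)) auto
    show "0 < r / 2" using h(2) by simp
    show "s * G z = 0" if "z \<le> r / 2" for z using G0[OF that] by simp
    show "\<bar>s * G z\<bar> \<le> C + 1" if z: "0 \<le> z" "z \<le> B" for z
    proof -
      have "s * \<bar>G z\<bar> \<le> 1 * (C + 1)" using s GC[OF z] C by (intro mult_mono) auto
      then show ?thesis using s by (simp add: abs_mult)
    qed
    show "\<bar>s * G z - min (f z) C\<bar> \<le> e" if z: "e \<le> z" "z \<le> B" for z
    proof -
      have z0: "0 \<le> z" using z e by simp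
      have "1 - s = 2 * q / (c + 2 * q)" using c q by (simp add: s_def field_simps)
      also have "\<dots> \<le> 2 * q / c" using c q by (intro divide_left_mono) auto
      also have "\<dots> \<le> d / (C + 1)" using q(4) c C by (simp add: field_simps)
      finally have "(1 - s) * \<bar>G z\<bar> \<le> d / (C + 1) * (C + 1)"
        using GC[OF z0 z(2)] s d C by (intro mult_mono) auto
      then have "(1 - s) * \<bar>G z\<bar> \<le> d" using C by simp
      then have "\<bar>G z - s * G z\<bar> \<le> d"
        using s by (metis abs_mult abs_of_nonneg diff_ge_0_iff_ge left_diff_distrib mult_1)
      moreover have "\<bar>h z - min (f z) C\<bar> \<le> d"
        using h(4)[OF z0 z(2)] h(5)[OF z] unfolding g_def[symmetric] by simp
      moreover have "3 * d = e" by (simp add: d_def)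
      ultimately show ?thesis
        using Gh[OF z0 z(2)] q(3) by linarith
    qed
    show "\<bar>s * G x - s * G y\<bar> \<le> f (x + y)" if xy: "0 \<le> x" "0 \<le> y" "x + y \<le> B" for x y
    proof (cases "x + y \<le> r / 2")
      case True
      then show ?thesis using xy G0[of x] G0[of y] f_nonneg[of "x + y"] B\<alpha>[OF xy(3)] by simp
    next
      case False
      then have cg: "c \<le> g (x + y)" using c(2) xy by simp
      have "\<bar>G x - G y\<bar> \<le> g (x + y) + 2 * q"
        using Gh[of x] Gh[of y] h(6)[OF xy] xy by auto
      then have "s * \<bar>G x - G y\<bar> \<le> s * (g (x + y) + 2 * q)" using s by simp
      also have "\<dots> \<le> g (x + y)"
      proof -
        have "c * (g (x + y) + 2 * q) \<le> g (x + y) * (c + 2 * q)"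
          using cg q mult_right_mono[OF cg, of "2 * q"] by (simp add: algebra_simps)
        then show ?thesis using c q by (simp add: s_def field_simps)
      qed
      finally have "\<bar>s * (G x - G y)\<bar> \<le> g (x + y)" using s by (simp add: abs_mult)
      then show ?thesis by (simp add: right_diff_distrib g_def)
    qed
  qed
qed

end

section \<open>Testing with horizontally mollified fields\<close>

lemma sum_Basis_times_real:
  fixes f :: "'a::euclidean_space \<times> real \<Rightarrow> real"
  shows "(\<Sum>b\<in>Basis. f b) = (\<Sum>b\<in>Basis. f (b, 0)) + f (0, 1)"
proof -
  have "inj_on (\<lambda>u. (u, 0::real)) (Basis :: 'a set)" by (auto intro!: inj_onI)
  then show ?thesis
    unfolding Basis_prod_def
    by (subst sum.union_disjoint) (auto simp: sum.reindex)
qed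

lemma C1_deriv_vertical_support:
  fixes \<sigma> :: "'a::euclidean_space \<times> real \<Rightarrow> 'b::euclidean_space"
  assumes \<sigma>: "C1_deriv \<sigma> D" "\<And>x y. y \<notin> {l..u} \<Longrightarrow> \<sigma> (x, y) = 0" and y: "y \<notin> {l..u}"
  shows "D (x, y) h = 0"
proof (rule C1_deriv_zero[OF \<sigma>(1), of "UNIV \<times> {l..u}"])
  show "closed (UNIV \<times> {l..u} :: ('a \<times> real) set)"
    by (intro closed_Times closed_UNIV closed_atLeastAtMost)
  fix p :: "'a \<times> real" assume "p \<notin> UNIV \<times> {l..u}"
  then have "snd p \<notin> {l..u}" by (cases p) auto
  then show "\<sigma> p = 0" using \<sigma>(2)[of "snd p" "fst p"] by simp
qed (use y in auto)

definition slice_integral ::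
  "('a::euclidean_space \<times> real) set \<Rightarrow> ('a \<times> real \<Rightarrow> real) \<Rightarrow> 'a \<Rightarrow> real" where
  "slice_integral M k x = (LINT y|lborel. indicator M (x, y) * k (x, y))"

lemma slice_integral_measurable:
  fixes M :: "('a::euclidean_space \<times> real) set"
  assumes [measurable]: "M \<in> sets borel" "k \<in> borel_measurable borel"
  shows "slice_integral M k \<in> borel_measurable borel"
proof -
  have "(\<lambda>p. indicator M p * k p :: real) \<in> borel_measurable (borel \<Otimes>\<^sub>M borel)"
    unfolding borel_prod by measurable
  then have "(\<lambda>p. indicator M p * k p :: real) \<in> borel_measurable (borel \<Otimes>\<^sub>M lborel)"
    by (simp add: measurable_cong_sets[OF sets_pair_measure_cong[OF refl sets_lborel] refl])
  then show ?thesis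
    unfolding slice_integral_def[abs_def]
    by (intro lborel.borel_measurable_lebesgue_integral) (simp add: case_prod_beta')
qed

lemma integrable_lborel_prodI:
  fixes f :: "'a::euclidean_space \<times> real \<Rightarrow> 'b::euclidean_space"
  assumes "f \<in> borel_measurable borel" "\<And>p. norm (f p) \<le> B"
    "\<And>x y. norm x > R \<Longrightarrow> f (x, y) = 0" "\<And>x y. y \<notin> {l..u} \<Longrightarrow> f (x, y) = 0"
  shows "integrable lborel f" "integrable lborel (\<lambda>y. f (x, y))"
    "(LINT p|lborel. f p) = (LINT x|lborel. LINT y|lborel. f (x, y))"
    "integrable lborel (\<lambda>x. LINT y|lborel. f (x, y))"
proof -
  define T where "T = \<bar>l\<bar> + \<bar>u\<bar>"
  have T: "y \<notin> {l..u}" if "T < \<bar>y\<bar>" for y using that by (auto simp: T_def)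
  show i: "integrable lborel f"
  proof (rule integrable_bounded_support[OF assms(1,2)])
    fix p :: "'a \<times> real" assume p: "norm p > R + T"
    obtain x y where xy: "p = (x, y)" by (cases p)
    have "norm p \<le> norm x + \<bar>y\<bar>" using norm_Pair_le[of x y] xy by simp
    then have "norm x > R \<or> \<bar>y\<bar> > T" using p by linarith
    then show "f p = 0" using assms(3,4) T xy by blast
  qed
  have m: "(\<lambda>y. f (x, y)) \<in> borel_measurable borel"
    using measurable_compose[OF _ assms(1), of "\<lambda>y. (x, y)"] by simp
  show "integrable lborel (\<lambda>y. f (x, y))"
    by (rule integrable_bounded_support[OF m, of B T]) (use assms T in auto)
  have i': "integrable (lborel \<Otimes>\<^sub>M lborel) f" using i by (simp add: lborel_prod)
  show "(LINT p|lborel. f p) = (LINT x|lborel. LINT y|lborel. f (x, y))"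
    using lborel_pair.integral_fst'[OF i'] by (simp add: lborel_prod)
  show "integrable lborel (\<lambda>x. LINT y|lborel. f (x, y))"
    using lborel_pair.integrable_fst'[OF i'] .
qed

lemma slice_integral_bounded:
  fixes M :: "('a::euclidean_space \<times> real) set"
  assumes M: "M \<in> sets borel" and MR: "\<And>x y. (x, y) \<in> M \<Longrightarrow> norm x \<le> R"
    and k: "continuous_on UNIV k" and z: "\<And>x y. y \<notin> {l..u} \<Longrightarrow> k (x, y) = 0"
  obtains B where "0 \<le> B" "\<And>x. \<bar>slice_integral M k x\<bar> \<le> B" "\<And>p. \<bar>indicator M p * k p\<bar> \<le> B"
proof -
  have "compact (k ` (cball 0 R \<times> {l..u}))"
    by (intro compact_continuous_image continuous_on_subset[OF k] compact_Times) auto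
  then have "bounded (k ` (cball 0 R \<times> {l..u}))" by (rule compact_imp_bounded)
  then obtain C where C: "\<And>p. p \<in> cball 0 R \<times> {l..u} \<Longrightarrow> \<bar>k p\<bar> \<le> C"
    unfolding bounded_iff by (metis image_eqI real_norm_def)
  have b: "\<bar>indicator M p * k p\<bar> \<le> max C 0" for p
  proof (cases "p \<in> cball 0 R \<times> {l..u}")
    case True
    then show ?thesis using C[OF True] by (auto simp: indicator_def)
  next
    case False
    then show ?thesis using MR z by (cases p) (auto simp: indicator_def)
  qed
  have [measurable]: "M \<in> sets borel" "k \<in> borel_measurable borel"
    using M borel_measurable_continuous_onI[OF k] by auto
  have b2: "\<bar>slice_integral M k x\<bar> \<le> max C 0 * (\<bar>u - l\<bar>)" for x
  proof -
    have "\<bar>slice_integral M k x\<bar> \<le> (LINT y|lborel. \<bar>indicator M (x, y) * k (x, y)\<bar>)"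
      unfolding slice_integral_def
      using integral_norm_bound[of lborel "\<lambda>y. indicator M (x, y) * k (x, y)"] by simp
    also have "\<dots> \<le> (LINT y|lborel. max C 0 * indicator {l..u} y)"
    proof (rule integral_mono)
      show "integrable lborel (\<lambda>y. \<bar>indicator M (x, y) * k (x, y)\<bar>)"
        by (intro integrable_abs integrable_lborel_prodI(2)[where f = "\<lambda>p. indicator M p * k p" and R = R and l = l and u = u and B = "max C 0"])
          (use b MR z in \<open>force simp: indicator_def\<close>)+
      show "\<bar>indicator M (x, y) * k (x, y)\<bar> \<le> max C 0 * indicator {l..u} y" for y
        using b[of "(x, y)"] z[of y x] by (cases "y \<in> {l..u}") auto
    qed (simp add: emeasure_lborel_Icc_eq)
    also have "\<dots> \<le> max C 0 * \<bar>u - l\<bar>" by (simp add: mult_left_mono)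
    finally show ?thesis .
  qed
  show thesis
  proof (rule that[of "max (max C 0) (max C 0 * \<bar>u - l\<bar>)"])
    show "\<bar>slice_integral M k x\<bar> \<le> max (max C 0) (max C 0 * \<bar>u - l\<bar>)" for x using b2[of x] by linarith
    show "\<bar>indicator M p * k p\<bar> \<le> max (max C 0) (max C 0 * \<bar>u - l\<bar>)" for p using b[of p] by linarith
  qed auto
qed

text \<open>
  Instead of the perimeter, an extended real supremum, the estimates use a real bound \<open>P\<close> for the
  divergence integrals of all admissible fields.
\<close>

locale finite_perimeter_set = calibrated_weight +
  fixes \<Omega> :: "'a::euclidean_space set" and M :: "('a \<times> real) set" and P R :: real
  assumes \<Omega>_open: "open \<Omega>" and \<Omega>_bounded: "\<And>x. x \<in> \<Omega> \<Longrightarrow> norm x \<le> R"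
    and M_borel: "M \<in> sets borel" and M_sub: "M \<subseteq> \<Omega> \<times> J"
    and perimeter_le: "\<And>\<psi>. \<psi> \<in> C1_compact_support (\<Omega> \<times> J) \<Longrightarrow>
       (\<And>p. p \<in> \<Omega> \<times> J \<Longrightarrow> norm (\<psi> p) \<le> w (snd p)) \<Longrightarrow>
       (LINT p|lborel. indicator M p * divergence \<psi> p) \<le> P"
begin

lemma M_R: "(x, y) \<in> M \<Longrightarrow> norm x \<le> R"
  using M_sub \<Omega>_bounded by auto

lemma slice_integral_0: "norm x > R \<Longrightarrow> slice_integral M k x = 0"
proof -
  assume "norm x > R"
  then have "indicator M (x, y) = (0::real)" for y using M_R[of x y] by (auto simp: indicator_def)
  then show ?thesis by (simp add: slice_integral_def)
qed

lemma slice_bounded: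
  assumes "continuous_on UNIV k" "\<And>x y. y \<notin> {l..u} \<Longrightarrow> k (x, y) = 0"
  shows "\<exists>B\<ge>0. (\<forall>x. \<bar>slice_integral M k x\<bar> \<le> B) \<and> (\<forall>p. \<bar>indicator M p * k p\<bar> \<le> B)"
  by (rule slice_integral_bounded[of M R k l u]) (use assms M_borel M_R in blast)+

text \<open>
  The set \<open>M\<close> is tested with the field \<open>(\<zeta>(y) (\<eta> * V\<^sub>1)(x), (\<eta> * V\<^sub>2)(x) \<sigma>(x, y))\<close>. It is admissible because
  \<open>\<zeta>\<close> and \<open>\<sigma>\<close> are bounded by \<open>w\<close> and a convolution of vectors in the unit ball stays in the unit ball. Its
  divergence involves only horizontal derivatives of \<open>\<eta> * V\<^sub>1\<close> and the vertical derivative of \<open>\<sigma>\<close>, so integrating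
  over the slices leaves \<open>m\<close> and \<open>S\<close>; the convolutions are then moved onto \<open>m\<close> and \<open>S\<close>.
\<close>

lemma product_field_inequality:
  fixes V :: "'a \<Rightarrow> 'a \<times> real"
  assumes moll: "mollifier e \<eta> G" and K: "compact K" "\<And>x. x \<in> K \<Longrightarrow> cball x e \<subseteq> \<Omega>"
    and V: "integrable lborel V" "\<And>x. norm (V x) \<le> 1" "\<And>x. x \<notin> K \<Longrightarrow> V x = 0"
    and lu: "{l..u} \<subseteq> J"
    and \<zeta>: "\<And>t. (\<zeta> has_real_derivative \<zeta>' t) (at t)" "continuous_on UNIV \<zeta>'"
      "\<And>t. 0 \<le> \<zeta> t" "\<And>t. \<zeta> t \<le> w t" "\<And>t. t \<notin> {l..u} \<Longrightarrow> \<zeta> t = 0"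
    and \<sigma>: "C1_deriv \<sigma> D" "\<And>x y. y \<notin> {l..u} \<Longrightarrow> \<sigma> (x, y) = 0"
      "\<And>x y. norm x \<le> R \<Longrightarrow> y \<in> J \<Longrightarrow> \<bar>\<sigma> (x, y)\<bar> \<le> w y"
  defines "m \<equiv> slice_integral M (\<lambda>p. \<zeta> (snd p))"
    and "S \<equiv> slice_integral M (\<lambda>p. D p (0, 1))"
  shows "(LINT x|lborel. snd (V x) * conv \<eta> S x)
     - (\<Sum>b\<in>Basis. LINT x|lborel. (fst (V x) \<bullet> b) * conv (\<lambda>y. G y \<bullet> b) m x) \<le> P"
proof -
  define V1 where "V1 x = fst (V x)" for x
  define V2 where "V2 x = snd (V x)" for x
  have V12: "V = (\<lambda>x. (V1 x, V2 x))" by (simp add: V1_def V2_def)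
  have iV1: "integrable lborel V1" unfolding V1_def[abs_def]
    by (rule integrable_bounded_linear[OF bounded_linear_fst V(1)])
  have iV2: "integrable lborel V2" unfolding V2_def[abs_def]
    by (rule integrable_bounded_linear[OF bounded_linear_snd V(1)])
  note C\<eta> = mollifierD(8)[OF moll] and CG = mollifierD(9)[OF moll]
  obtain B where B: "\<And>x. \<bar>\<eta> x\<bar> \<le> B" "\<And>x. norm (G x) \<le> B" using mollifier_bounded[OF moll] by blast
  have CGb: "continuous_on UNIV (\<lambda>y. G y \<bullet> b)" for b by (intro continuous_intros CG)
  have BGb: "\<bar>G y \<bullet> b\<bar> \<le> B * norm b" for y b
    using Cauchy_Schwarz_ineq2[of "G y" b] mult_right_mono[OF B(2)[of y] norm_ge_zero[of b]] by linarith
  define A1 where "A1 = conv \<eta> V1"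
  define A2 where "A2 = conv \<eta> V2"
  have cV: "conv \<eta> V x = (A1 x, A2 x)" for x
    unfolding A1_def A2_def V12
    by (rule conv_Pair[OF C\<eta> B(1)]) (use V(1) V12 in simp)
  have nA: "norm (A1 x, A2 x) \<le> 1" for x
    unfolding cV[symmetric] by (rule norm_conv_le[OF moll V(1,2)])
  define dA1 where "dA1 x h = conv (\<lambda>y. G y \<bullet> h) V1 x" for x h
  define dA2 where "dA2 x h = conv (\<lambda>y. G y \<bullet> h) V2 x" for x h
  have CA1: "C1_deriv A1 dA1" unfolding A1_def dA1_def by (rule conv_C1_deriv[OF moll iV1])
  have CA2: "C1_deriv A2 dA2" unfolding A2_def dA2_def by (rule conv_C1_deriv[OF moll iV2])
  define K' where "K' = {x + y | x y. x \<in> K \<and> y \<in> cball 0 e}"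
  have K': "compact K'" unfolding K'_def by (rule compact_sums[OF K(1) compact_cball])
  have K'\<Omega>: "K' \<subseteq> \<Omega>"
  proof
    fix z assume "z \<in> K'"
    then obtain x y where "z = x + y" "x \<in> K" "norm y \<le> e" by (auto simp: K'_def)
    then show "z \<in> \<Omega>" using K(2)[of x] by (auto simp: dist_norm)
  qed
  have A0: "A1 x = 0 \<and> A2 x = 0" if x: "x \<notin> K'" for x
  proof -
    have "conv \<eta> V x = 0"
    proof (rule conv_eq_0[where K = K and e = e])
      show "\<eta> y = 0" if "e < norm y" for y using mollifierD(5)[OF moll that] .
      show "e < norm (x - t)" if "t \<in> K" for t
      proof (rule ccontr)
        assume "\<not> e < norm (x - t)"
        then have "x \<in> K'" unfolding K'_def mem_Collect_eq using that
          by (intro exI[of _ t] exI[of _ "x - t"]) auto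
        then show False using x by simp
      qed
    qed (use V(3) in auto)
    then show ?thesis using cV[of x] by (simp add: zero_prod_def)
  qed
  define \<Phi> where "\<Phi> p = (\<zeta> (snd p) *\<^sub>R A1 (fst p), A2 (fst p) * \<sigma> p)" for p
  define D\<Phi> where "D\<Phi> p h = (\<zeta> (snd p) *\<^sub>R dA1 (fst p) (fst h) + (snd h * \<zeta>' (snd p)) *\<^sub>R A1 (fst p),
     A2 (fst p) * D p h + dA2 (fst p) (fst h) * \<sigma> p)" for p h
  have C\<zeta>: "C1_deriv (\<lambda>p::'a \<times> real. \<zeta> (snd p)) (\<lambda>p h. snd h * \<zeta>' (snd p))"
    by (rule C1_deriv_real_compose[OF C1_deriv_bounded_linear[OF bounded_linear_snd] \<zeta>(1,2)])
  have C\<Phi>: "C1_deriv \<Phi> D\<Phi>"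
    unfolding \<Phi>_def[abs_def] D\<Phi>_def[abs_def]
    by (intro C1_deriv_Pair C1_deriv_scaleR C1_deriv_mult C\<zeta> \<sigma>(1)
        C1_deriv_compose_linear[OF CA1 bounded_linear_fst] C1_deriv_compose_linear[OF CA2 bounded_linear_fst])
  have \<Phi>0: "\<Phi> p = 0" if "p \<notin> K' \<times> {l..u}" for p
    using that A0[of "fst p"] \<zeta>(5)[of "snd p"] \<sigma>(2)[of "snd p" "fst p"]
    by (cases p) (auto simp: \<Phi>_def zero_prod_def)
  have sub: "closure {p. \<Phi> p \<noteq> 0} \<subseteq> K' \<times> {l..u}"
    using \<Phi>0 by (intro closure_minimal closed_Times compact_imp_closed K') auto
  have \<Phi>C: "\<Phi> \<in> C1_compact_support (\<Omega> \<times> J)"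
    unfolding C1_compact_support_iff
  proof (intro conjI)
    have "compact (closure {p. \<Phi> p \<noteq> 0} \<inter> (K' \<times> {l..u}))"
      by (intro closed_Int_compact compact_Times K') auto
    then show "compact (closure {p. \<Phi> p \<noteq> 0})" using sub by (simp add: Int_absorb2)
    show "closure {p. \<Phi> p \<noteq> 0} \<subseteq> \<Omega> \<times> J" using sub K'\<Omega> lu by blast
  qed (use C\<Phi> in blast)
  have \<Phi>w: "norm (\<Phi> p) \<le> w (snd p)" if pJ: "p \<in> \<Omega> \<times> J" for p
  proof -
    obtain x y where p: "p = (x, y)" "x \<in> \<Omega>" "y \<in> J" using pJ by auto
    have s: "\<bar>\<sigma> (x, y)\<bar> \<le> w y" using \<sigma>(3) \<Omega>_bounded p by blast
    have "norm (\<Phi> p) = sqrt ((\<zeta> y * norm (A1 x))\<^sup>2 + (\<bar>A2 x\<bar> * \<bar>\<sigma> (x, y)\<bar>)\<^sup>2)"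
      using \<zeta>(3)[of y] by (simp add: \<Phi>_def p norm_Pair abs_mult power_mult_distrib)
    also have "\<dots> \<le> sqrt ((w y * norm (A1 x))\<^sup>2 + (\<bar>A2 x\<bar> * w y)\<^sup>2)"
      using \<zeta>(3,4)[of y] s w_nonneg[of y]
      by (intro real_sqrt_le_mono add_mono power_mono mult_right_mono mult_left_mono mult_nonneg_nonneg) auto
    also have "\<dots> = sqrt ((w y)\<^sup>2 * ((norm (A1 x))\<^sup>2 + (A2 x)\<^sup>2))"
      by (simp add: power_mult_distrib algebra_simps)
    also have "\<dots> = w y * norm (A1 x, A2 x)"
      using w_nonneg[of y] by (simp add: norm_Pair real_sqrt_mult)
    also have "\<dots> \<le> w y" using mult_left_mono[OF nA[of x] w_nonneg[of y]] by simp
    finally show ?thesis using p by simp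
  qed
  define dv where "dv x = (\<Sum>b\<in>Basis. conv (\<lambda>y. G y \<bullet> b) (\<lambda>t. V1 t \<bullet> b) x)" for x
  have iV1b: "integrable lborel (\<lambda>t. V1 t \<bullet> b)" for b
    by (rule integrable_bounded_linear[OF bounded_linear_inner_left iV1])
  have dvb: "dA1 x b \<bullet> b = conv (\<lambda>y. G y \<bullet> b) (\<lambda>t. V1 t \<bullet> b) x" for x b
    unfolding dA1_def conv_def
    using integral_bounded_linear[OF bounded_linear_inner_left[of b] integrable_kernel[OF CGb BGb iV1, of x b]]
    by (simp add: mult.commute)
  have div: "divergence \<Phi> (x, y) = \<zeta> y * dv x + A2 x * D (x, y) (0, 1)" for x y
  proof -
    have z: "dA1 x 0 = 0" "dA2 x 0 = 0" "D (x, y) 0 = 0"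
      by (simp_all add: dA1_def dA2_def conv_def linear_0[OF has_derivative_linear[OF C1_deriv_has_derivative[OF \<sigma>(1)]]])
    show ?thesis
      unfolding divergence_C1_deriv[OF C\<Phi>] sum_Basis_times_real D\<Phi>_def
      by (simp add: z dvb dv_def sum_distrib_left)
  qed
  have cm: "continuous_on UNIV (\<lambda>p::'a\<times>real. \<zeta> (snd p))" by (rule C1_deriv_continuous[OF C\<zeta>])
  have cS: "continuous_on UNIV (\<lambda>p. D p (0, 1))" by (rule C1_deriv_continuous_derivative[OF \<sigma>(1)])
  have S0: "D (x, y) (0, 1) = 0" if "y \<notin> {l..u}" for x y
    by (rule C1_deriv_vertical_support[OF \<sigma>(1,2) that])
  have m0: "\<zeta> (snd (x, y)) = 0" if "y \<notin> {l..u}" for x :: 'a and y using \<zeta>(5)[OF that] by simp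
  obtain Bm where Bm: "0 \<le> Bm" "\<And>x. \<bar>m x\<bar> \<le> Bm" "\<And>p. \<bar>indicator M p * \<zeta> (snd p)\<bar> \<le> Bm"
    using slice_bounded[OF cm m0] unfolding m_def by blast
  obtain BS where BS: "0 \<le> BS" "\<And>x. \<bar>S x\<bar> \<le> BS" "\<And>p. \<bar>indicator M p * D p (0, 1)\<bar> \<le> BS"
    using slice_bounded[OF cS S0] unfolding S_def by blast
  have mm: "m \<in> borel_measurable borel" unfolding m_def
    by (rule slice_integral_measurable[OF M_borel borel_measurable_continuous_onI[OF cm]])
  have mS: "S \<in> borel_measurable borel" unfolding S_def
    by (rule slice_integral_measurable[OF M_borel borel_measurable_continuous_onI[OF cS]])
  have im: "integrable lborel m"
    by (rule integrable_bounded_support[OF mm Bm(2)[folded real_norm_def], of R])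
      (simp add: m_def slice_integral_0)
  have iS: "integrable lborel S"
    by (rule integrable_bounded_support[OF mS BS(2)[folded real_norm_def], of R])
      (simp add: S_def slice_integral_0)
  have cA2: "continuous_on UNIV A2" by (rule C1_deriv_continuous[OF CA2])
  have cdv: "continuous_on UNIV dv" unfolding dv_def[abs_def]
    by (intro continuous_intros continuous_on_conv[OF CGb BGb iV1b])
  have dv0: "dv x = 0" if "x \<notin> K'" for x
  proof -
    have "dA1 x b = 0" for b
      by (rule C1_deriv_zero[OF CA1 compact_imp_closed[OF K']]) (use A0 that in auto)
    then show ?thesis by (simp add: dv_def flip: dvb)
  qed
  have K'R: "x \<notin> K'" if "norm x > R" for x using K'\<Omega> \<Omega>_bounded that by force
  have idv: "integrable lborel dv"
    by (rule integrable_continuous_bounded_support[OF cdv]) (use dv0 K'R in auto)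
  have iA2: "integrable lborel A2"
    by (rule integrable_continuous_bounded_support[OF cA2]) (use A0 K'R in auto)
  obtain Bdv where Bdv: "Bdv \<ge> 0" "\<And>x. \<bar>dv x\<bar> \<le> Bdv"
    using continuous_bounded_support_bounded[OF cdv, of R] dv0 K'R by (metis real_norm_def)
  have [measurable]: "M \<in> sets borel" "(\<lambda>p. D p (0, 1)) \<in> borel_measurable borel"
    "(\<lambda>p::'a\<times>real. \<zeta> (snd p)) \<in> borel_measurable borel" "dv \<in> borel_measurable borel"
    "A2 \<in> borel_measurable borel"
    using M_borel cS cm cdv cA2 by (auto intro!: borel_measurable_continuous_onI)
  have A2b: "\<bar>A2 x\<bar> \<le> 1" for x using nA[of x] norm_snd_le[of "A2 x" "A1 x"] by simp
  define F where "F p = indicator M p * divergence \<Phi> p" for p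
  have Feq: "F (x, y) = (indicator M (x, y) * \<zeta> y) * dv x + A2 x * (indicator M (x, y) * D (x, y) (0, 1))" for x y
    by (simp add: F_def div algebra_simps)
  have FB: "\<bar>F p\<bar> \<le> Bm * Bdv + 1 * BS" for p
  proof (cases p)
    case (Pair x y)
    have "\<bar>(indicator M (x, y) * \<zeta> y) * dv x\<bar> \<le> Bm * Bdv"
      unfolding abs_mult[of _ "dv x"] using Bm(3)[of "(x, y)"] Bdv Bm(1) by (intro mult_mono) auto
    moreover have "\<bar>A2 x * (indicator M (x, y) * D (x, y) (0, 1))\<bar> \<le> 1 * BS"
      unfolding abs_mult[of "A2 x"] using BS(3)[of "(x, y)"] A2b[of x] BS(1) by (intro mult_mono) auto
    ultimately show ?thesis unfolding Pair Feq by linarith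
  qed
  have Fm: "F \<in> borel_measurable borel"
  proof -
    have "F = (\<lambda>p. (indicator M p * \<zeta> (snd p)) * dv (fst p) + A2 (fst p) * (indicator M p * D p (0, 1)))"
      using Feq by auto
    moreover have [measurable]: "(\<lambda>p::'a\<times>real. dv (fst p)) \<in> borel_measurable borel"
      "(\<lambda>p::'a\<times>real. A2 (fst p)) \<in> borel_measurable borel"
      by (auto intro!: borel_measurable_continuous_onI continuous_on_compose2[OF cdv]
          continuous_on_compose2[OF cA2] continuous_intros)
    ultimately show ?thesis by (simp only:) measurable
  qed
  have F0: "F (x, y) = 0" if "R < norm x" for x y
    using M_R[of x y] that by (auto simp: F_def indicator_def)
  have F0': "F (x, y) = 0" if "y \<notin> {l..u}" for x y
    using \<zeta>(5)[OF that] S0[OF that] by (simp add: Feq)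
  note FI = integrable_lborel_prodI[OF Fm FB[folded real_norm_def] F0 F0']
  have inner: "(LINT y|lborel. F (x, y)) = m x * dv x + A2 x * S x" for x
  proof -
    have i1: "integrable lborel (\<lambda>y. indicator M (x, y) * \<zeta> y)"
      using integrable_lborel_prodI(2)[of "\<lambda>p. indicator M p * \<zeta> (snd p)" Bm R l u x] Bm(3) M_R \<zeta>(5)
      by (force simp: indicator_def)
    have i2: "integrable lborel (\<lambda>y. indicator M (x, y) * D (x, y) (0, 1))"
      using integrable_lborel_prodI(2)[of "\<lambda>p. indicator M p * D p (0, 1)" BS R l u x] BS(3) M_R S0
      by (force simp: indicator_def)
    show ?thesis
      unfolding Feq m_def S_def slice_integral_def using i1 i2 by simp
  qed
  have imdv: "integrable lborel (\<lambda>x. m x * dv x)"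
  proof (rule Bochner_Integration.integrable_bound[of _ "\<lambda>x. Bm * dv x"])
    show "AE x in lborel. norm (m x * dv x) \<le> norm (Bm * dv x)"
      using Bm by (intro AE_I2) (auto simp: abs_mult intro!: mult_right_mono)
  qed (use idv im in auto)
  have iAS: "integrable lborel (\<lambda>x. A2 x * S x)"
  proof (rule Bochner_Integration.integrable_bound[of _ S])
    show "AE x in lborel. norm (A2 x * S x) \<le> norm (S x)"
      using A2b by (intro AE_I2) (auto simp: abs_mult intro!: mult_left_le_one_le)
  qed (use iS in auto)
  have "(LINT p|lborel. F p) \<le> P"
    unfolding F_def by (rule perimeter_le[OF \<Phi>C \<Phi>w])
  then have "(LINT x|lborel. m x * dv x) + (LINT x|lborel. A2 x * S x) \<le> P"
    using FI(3) imdv iAS by (simp add: inner)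
  moreover have "(LINT x|lborel. m x * dv x) =
      - (\<Sum>b\<in>Basis. LINT x|lborel. (V1 x \<bullet> b) * conv (\<lambda>y. G y \<bullet> b) m x)"
  proof -
    have ib: "integrable lborel (\<lambda>x. m x * conv (\<lambda>y. G y \<bullet> b) (\<lambda>t. V1 t \<bullet> b) x)" for b
    proof (rule Bochner_Integration.integrable_bound[of _ "\<lambda>x. (B * norm b * (LINT t|lborel. \<bar>V1 t \<bullet> b\<bar>)) * m x"])
      have "\<bar>conv (\<lambda>y. G y \<bullet> b) (\<lambda>t. V1 t \<bullet> b) x\<bar> \<le> B * norm b * (LINT t|lborel. \<bar>V1 t \<bullet> b\<bar>)" for x
      proof -
        have "\<bar>conv (\<lambda>y. G y \<bullet> b) (\<lambda>t. V1 t \<bullet> b) x\<bar> \<le> (LINT t|lborel. \<bar>(G (x - t) \<bullet> b) * (V1 t \<bullet> b)\<bar>)"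
          unfolding conv_def using integral_norm_bound[of lborel "\<lambda>t. (G (x - t) \<bullet> b) *\<^sub>R (V1 t \<bullet> b)"] by simp
        also have "\<dots> \<le> (LINT t|lborel. B * norm b * \<bar>V1 t \<bullet> b\<bar>)"
        proof (rule integral_mono)
          show "integrable lborel (\<lambda>t. \<bar>G (x - t) \<bullet> b * (V1 t \<bullet> b)\<bar>)"
            using integrable_kernel[OF CGb BGb iV1b, of x b b] by (intro integrable_abs) simp
          show "\<bar>G (x - t) \<bullet> b * (V1 t \<bullet> b)\<bar> \<le> B * norm b * \<bar>V1 t \<bullet> b\<bar>" for t
            unfolding abs_mult by (intro mult_right_mono BGb) simp
        qed (use iV1b in simp)
        finally show ?thesis by simp
      qed
      then have cb: "\<bar>conv (\<lambda>y. G y \<bullet> b) (\<lambda>t. V1 t \<bullet> b) x\<bar> \<le> \<bar>B * norm b * (LINT t|lborel. \<bar>V1 t \<bullet> b\<bar>)\<bar>" for x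
        by (meson abs_ge_self order_trans)
      show "AE x in lborel. norm (m x * conv (\<lambda>y. G y \<bullet> b) (\<lambda>t. V1 t \<bullet> b) x)
         \<le> norm (B * norm b * (LINT t|lborel. \<bar>V1 t \<bullet> b\<bar>) * m x)"
        using mult_right_mono[OF cb abs_ge_zero]
        by (intro AE_I2) (simp only: real_norm_def abs_mult[of "m _"] abs_mult[of _ "m _"] mult.commute[of "\<bar>m _\<bar>"])
      have "conv (\<lambda>y. G y \<bullet> b) (\<lambda>t. V1 t \<bullet> b) \<in> borel_measurable borel"
        by (rule borel_measurable_continuous_onI[OF continuous_on_conv[OF CGb BGb iV1b]])
      then show "(\<lambda>x. m x * conv (\<lambda>y. G y \<bullet> b) (\<lambda>t. V1 t \<bullet> b) x) \<in> borel_measurable lborel"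
        using im by auto
    qed (use im in simp)
    have "(LINT x|lborel. m x * dv x) = (\<Sum>b\<in>Basis. LINT x|lborel. m x * conv (\<lambda>y. G y \<bullet> b) (\<lambda>t. V1 t \<bullet> b) x)"
      unfolding dv_def sum_distrib_left using ib by simp
    also have "\<dots> = (\<Sum>b\<in>Basis. LINT x|lborel. (V1 x \<bullet> b) * conv (\<lambda>y. G (- y) \<bullet> b) m x)"
      using integral_conv_swap[OF im iV1b CGb BGb] by simp
    also have "\<dots> = (\<Sum>b\<in>Basis. - (LINT x|lborel. (V1 x \<bullet> b) * conv (\<lambda>y. G y \<bullet> b) m x))"
      unfolding mollifierD(4)[OF moll] by (simp add: conv_def)
    finally show ?thesis by (simp add: sum_negf)
  qed
  moreover have "(LINT x|lborel. A2 x * S x) = (LINT x|lborel. V2 x * conv \<eta> S x)"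
    using integral_conv_swap[OF iS iV2 C\<eta> B(1)] mollifierD(3)[OF moll]
    unfolding A2_def by (simp add: mult.commute)
  ultimately show ?thesis unfolding V1_def V2_def by simp
qed

end

section \<open>Comparison with the region below a height function\<close>

text \<open>
  A null set of base points has a null cylinder over it.
\<close>

lemma AE_lborel_fst:
  assumes "AE x in (lborel :: 'a::euclidean_space measure). Q x"
  shows "AE p in (lborel :: ('a \<times> real) measure). Q (fst p)"
proof -
  obtain N where N: "N \<in> sets lborel" "emeasure lborel N = 0" "{x. \<not> Q x} \<subseteq> N"
    using AE_E[OF assms] by auto
  have "emeasure (lborel \<Otimes>\<^sub>M lborel) (N \<times> (UNIV :: real set)) = 0"
    using N by (subst lborel.emeasure_pair_measure_Times) auto
  moreover have "N \<times> (UNIV :: real set) \<in> sets (lborel \<Otimes>\<^sub>M lborel)"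
    using N by (intro pair_measureI) auto
  ultimately have "N \<times> (UNIV :: real set) \<in> null_sets lborel"
    unfolding lborel_prod by (intro null_setsI)
  then show ?thesis
    by (rule AE_I') (use N(3) in auto)
qed

text \<open>
  A test field \<open>\<phi>\<close> for the rearranged set, supported in the box \<open>K \<times> {l..u}\<close>, and a smooth increasing
  substitute \<open>\<tau>\<close> for the indicator of the positive half-line.
\<close>

locale comparison_field = finite_perimeter_set w W f J \<alpha> \<Omega> M P R
  for w W f J \<alpha> and \<Omega> :: "'a::euclidean_space set" and M P R +
  fixes \<phi> :: "'a \<times> real \<Rightarrow> 'a \<times> real" and D :: "'a \<times> real \<Rightarrow> 'a \<times> real \<Rightarrow> 'a \<times> real"
    and K :: "'a set" and l u :: real and \<tau> \<tau>' :: "real \<Rightarrow> real" and T :: real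
  assumes \<phi>_C1: "C1_deriv \<phi> D"
    and K_compact: "compact K" and K_sub: "K \<subseteq> \<Omega>" and lu_sub: "{l..u} \<subseteq> J"
    and \<phi>_support: "\<And>x y. \<not> (x \<in> K \<and> y \<in> {l..u}) \<Longrightarrow> \<phi> (x, y) = 0"
    and \<phi>_bound: "\<And>p. norm (\<phi> p) \<le> w (snd p)"
    and \<tau>_deriv: "\<And>t. (\<tau> has_real_derivative \<tau>' t) (at t)" and \<tau>'_cont: "continuous_on UNIV \<tau>'"
    and \<tau>_bounds: "\<And>t. 0 \<le> \<tau> t" "\<And>t. \<tau> t \<le> 1" and \<tau>'_bounds: "\<And>t. 0 \<le> \<tau>' t" "\<And>t. \<tau>' t \<le> T"
begin

text \<open>
  The first term is the divergence of \<open>\<phi>\<close> over the smoothed region below the height \<open>m\<close>. In the second term \<open>\<tau>'\<close>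
  charges only points with \<open>W(y)\<close> near \<open>m(x)\<close>; it becomes negligible once \<open>S(x)\<close> is the value of \<open>w\<close> at
  that place. The whole argument consists in establishing this inequality for better and better \<open>m\<close> and \<open>S\<close>.
\<close>

definition estimate :: "('a \<Rightarrow> real) \<Rightarrow> ('a \<Rightarrow> real) \<Rightarrow> bool" where
  "estimate m S \<longleftrightarrow>
     (LINT p|lborel. \<tau> (m (fst p) - W (snd p)) * divergence \<phi> p
        - \<tau>' (m (fst p) - W (snd p)) * snd (\<phi> p) * (w (snd p) - S (fst p))) \<le> P"

lemma K_R: "R < norm x \<Longrightarrow> x \<notin> K"
  using K_sub \<Omega>_bounded by force

lemma \<tau>_cont: "continuous_on UNIV \<tau>"
  using \<tau>_deriv by (auto intro!: DERIV_isCont continuous_at_imp_continuous_on)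

lemma \<phi>_cont: "continuous_on UNIV \<phi>"
  by (rule C1_deriv_continuous[OF \<phi>_C1])

lemma D_support: "D (x, y) h = 0" if "\<not> (x \<in> K \<and> y \<in> {l..u})"
proof (rule C1_deriv_zero[OF \<phi>_C1, of "K \<times> {l..u}"])
  show "closed (K \<times> {l..u})" by (intro closed_Times compact_imp_closed K_compact closed_atLeastAtMost)
  fix p :: "'a \<times> real" assume "p \<notin> K \<times> {l..u}"
  then show "\<phi> p = 0" using \<phi>_support[of "fst p" "snd p"] by (cases p) auto
qed (use that in auto)

lemma divergence_cont: "continuous_on UNIV (divergence \<phi>)"
  unfolding divergence_C1_deriv[OF \<phi>_C1, abs_def]
  by (intro continuous_intros C1_deriv_continuous_derivative[OF \<phi>_C1])

lemma divergence_support: "divergence \<phi> (x, y) = 0" if "\<not> (x \<in> K \<and> y \<in> {l..u})"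
  using that by (simp add: divergence_C1_deriv[OF \<phi>_C1] D_support)

lemma supported_integral:
  fixes k :: "'a \<times> real \<Rightarrow> 'c::euclidean_space"
  assumes k: "continuous_on UNIV k" "\<And>x y. \<not> (x \<in> K \<and> y \<in> {l..u}) \<Longrightarrow> k (x, y) = 0"
  shows "\<exists>B\<ge>0. \<forall>p. norm (k p) \<le> B"
    "integrable lborel k" "integrable lborel (\<lambda>y. k (x, y))"
    "(LINT p|lborel. k p) = (LINT x|lborel. LINT y|lborel. k (x, y))"
    "integrable lborel (\<lambda>x. LINT y|lborel. k (x, y))"
proof -
  have "compact (k ` (K \<times> {l..u}))"
    by (intro compact_continuous_image continuous_on_subset[OF k(1)] compact_Times K_compact) auto
  then have "bounded (k ` (K \<times> {l..u}))" by (rule compact_imp_bounded)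
  then obtain C where C: "\<And>p. p \<in> K \<times> {l..u} \<Longrightarrow> norm (k p) \<le> C"
    unfolding bounded_iff by (metis image_eqI)
  have b: "norm (k p) \<le> max C 0" for p
  proof (cases "p \<in> K \<times> {l..u}")
    case True then show ?thesis using C[OF True] by simp
  next
    case False then show ?thesis using k(2) by (cases p) auto
  qed
  then show "\<exists>B\<ge>0. \<forall>p. norm (k p) \<le> B" by (intro exI[of _ "max C 0"]) auto
  have m: "k \<in> borel_measurable borel" by (rule borel_measurable_continuous_onI[OF k(1)])
  have z1: "k (x, y) = 0" if "R < norm x" for x y using k(2) K_R[OF that] by blast
  have z2: "k (x, y) = 0" if "y \<notin> {l..u}" for x y using k(2) that by blast
  note I = integrable_lborel_prodI[OF m b z1 z2]
  show "integrable lborel k" by (rule I(1))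
  show "integrable lborel (\<lambda>y. k (x, y))" by (rule I(2))
  show "(LINT p|lborel. k p) = (LINT x|lborel. LINT y|lborel. k (x, y))" by (rule I(3))
  show "integrable lborel (\<lambda>x. LINT y|lborel. k (x, y))" by (rule I(4))
qed

text \<open>
  Let \<open>\<mu> = \<eta> * m\<close>. The divergence theorem for \<open>\<tau>(\<mu>(x) - W(y)) \<phi>\<close> expresses the first term through the vector
  field \<open>V(x)\<close>, the integral of \<open>\<tau>'(\<mu>(x) - W(y)) \<phi>(x, y)\<close> over \<open>y\<close>. It lies in the unit ball since \<open>|\<phi>| \<le> w\<close> and
  \<open>\<tau>'(\<mu>(x) - W(y)) w(y)\<close> is the derivative of a function increasing by at most \<open>1\<close>. Testing \<open>M\<close> with the product field
  built from this \<open>V\<close> produces the same horizontal term.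
\<close>

lemma estimate_mollified:
  assumes moll: "mollifier e \<eta> G" and e: "\<And>x. x \<in> K \<Longrightarrow> cball x e \<subseteq> \<Omega>"
    and ab: "{a..b} \<subseteq> J"
    and \<zeta>: "\<And>t. (\<zeta> has_real_derivative \<zeta>' t) (at t)" "continuous_on UNIV \<zeta>'"
      "\<And>t. 0 \<le> \<zeta> t" "\<And>t. \<zeta> t \<le> w t" "\<And>t. t \<notin> {a..b} \<Longrightarrow> \<zeta> t = 0"
    and \<sigma>: "C1_deriv \<sigma> D'" "\<And>x y. y \<notin> {a..b} \<Longrightarrow> \<sigma> (x, y) = 0"
      "\<And>x y. norm x \<le> R \<Longrightarrow> y \<in> J \<Longrightarrow> \<bar>\<sigma> (x, y)\<bar> \<le> w y"
    and m: "integrable lborel m" "m = slice_integral M (\<lambda>p. \<zeta> (snd p))"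
    and S: "integrable lborel S" "S = slice_integral M (\<lambda>p. D' p (0, 1))"
  shows "estimate (conv \<eta> m) (conv \<eta> S)"
proof -
  note C\<eta> = mollifierD(8)[OF moll] and CG = mollifierD(9)[OF moll]
  obtain B where B: "\<And>x. \<bar>\<eta> x\<bar> \<le> B" "\<And>x. norm (G x) \<le> B" using mollifier_bounded[OF moll] by blast
  define \<mu> where "\<mu> = conv \<eta> m"
  define g where "g b x = conv (\<lambda>y. G y \<bullet> b) m x" for b x
  define s where "s = conv \<eta> S"
  have C\<mu>: "C1_deriv \<mu> (\<lambda>x h. g h x)" unfolding \<mu>_def g_def by (rule conv_C1_deriv[OF moll m(1)])
  have cg: "continuous_on UNIV (g b)" for b using C1_deriv_continuous_derivative[OF C\<mu>] .
  have c\<mu>: "continuous_on UNIV \<mu>" by (rule C1_deriv_continuous[OF C\<mu>])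
  have cs: "continuous_on UNIV s" unfolding s_def by (rule continuous_on_conv[OF C\<eta> B(1) S(1)])
  have g0: "g 0 x = 0" for x by (simp add: g_def conv_def)
  define t where "t p = \<tau>' (\<mu> (fst p) - W (snd p))" for p
  have c1: "C1_deriv (\<lambda>p. \<mu> (fst p) - W (snd p)) (\<lambda>p h. g (fst h) (fst p) - snd h * w (snd p))"
    by (intro C1_deriv_diff C1_deriv_compose_linear[OF C\<mu> bounded_linear_fst]
        C1_deriv_real_compose[OF C1_deriv_bounded_linear[OF bounded_linear_snd] W_deriv w_cont])
  define \<theta> where "\<theta> p = \<tau> (\<mu> (fst p) - W (snd p))" for p
  have C\<theta>: "C1_deriv \<theta> (\<lambda>p h. (g (fst h) (fst p) - snd h * w (snd p)) * t p)"
    unfolding \<theta>_def t_def by (rule C1_deriv_real_compose[OF c1 \<tau>_deriv \<tau>'_cont])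
  have ct: "continuous_on UNIV t" unfolding t_def
    by (rule continuous_on_compose2[OF \<tau>'_cont C1_deriv_continuous[OF c1]]) auto
  have c\<theta>: "continuous_on UNIV \<theta>" by (rule C1_deriv_continuous[OF C\<theta>])
  \<comment> \<open>The divergence of this field has integral zero, which replaces a boundary integral over the graph of \<open>\<mu>\<close>.\<close>
  define \<Theta> where "\<Theta> p = \<theta> p *\<^sub>R \<phi> p" for p
  have C\<Theta>: "C1_deriv \<Theta> (\<lambda>p h. \<theta> p *\<^sub>R D p h + ((g (fst h) (fst p) - snd h * w (snd p)) * t p) *\<^sub>R \<phi> p)"
    unfolding \<Theta>_def by (rule C1_deriv_scaleR[OF C\<theta> \<phi>_C1])
  obtain R' where R': "\<And>p. p \<in> K \<times> {l..u} \<Longrightarrow> norm p \<le> R'"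
    using compact_imp_bounded[OF compact_Times[OF K_compact compact_Icc], of l u]
    unfolding bounded_iff by blast
  have "(LINT p|lborel. divergence \<Theta> p) = 0"
  proof (rule integral_divergence_zero[OF C\<Theta>, of R'])
    fix p :: "'a \<times> real" assume "R' < norm p"
    then have "p \<notin> K \<times> {l..u}" using R' by force
    then show "\<Theta> p = 0" using \<phi>_support by (cases p) (auto simp: \<Theta>_def)
  qed
  define q where "q b p = t p * g b (fst p) * (fst (\<phi> p) \<bullet> b)" for b p
  have div: "divergence \<Theta> p = \<theta> p * divergence \<phi> p + (\<Sum>b\<in>Basis. q b p) - t p * snd (\<phi> p) * w (snd p)" for p
    unfolding divergence_C1_deriv[OF C\<Theta>] divergence_C1_deriv[OF \<phi>_C1] sum_Basis_times_real q_def
    by (cases "\<phi> p") (simp add: inner_add_left g0 sum.distrib sum_distrib_left algebra_simps)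
  have cq: "continuous_on UNIV (q b)" for b
    unfolding q_def by (intro continuous_intros ct continuous_on_compose2[OF cg] \<phi>_cont) auto
  have q0: "q b (x, y) = 0" if "\<not> (x \<in> K \<and> y \<in> {l..u})" for b x y
    by (simp only: q_def \<phi>_support[OF that]) simp
  note Iq = supported_integral[OF cq q0]
  have cd: "continuous_on UNIV (\<lambda>p. \<theta> p * divergence \<phi> p)"
    by (intro continuous_intros c\<theta> divergence_cont)
  have d0: "\<theta> (x, y) * divergence \<phi> (x, y) = 0" if "\<not> (x \<in> K \<and> y \<in> {l..u})" for x y
    using divergence_support[OF that] by simp
  note Id = supported_integral[OF cd d0]
  have cw: "continuous_on UNIV (\<lambda>p. t p * snd (\<phi> p) * w (snd p))"
    by (intro continuous_intros ct \<phi>_cont continuous_on_compose2[OF w_cont]) auto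
  have w0: "t (x, y) * snd (\<phi> (x, y)) * w (snd (x, y)) = 0" if "\<not> (x \<in> K \<and> y \<in> {l..u})" for x y
    by (simp only: \<phi>_support[OF that]) simp
  note Iw = supported_integral[OF cw w0]
  have cS: "continuous_on UNIV (\<lambda>p. t p * snd (\<phi> p) * s (fst p))"
    by (intro continuous_intros ct \<phi>_cont continuous_on_compose2[OF cs]) auto
  have S0: "t (x, y) * snd (\<phi> (x, y)) * s (fst (x, y)) = 0" if "\<not> (x \<in> K \<and> y \<in> {l..u})" for x y
    by (simp only: \<phi>_support[OF that]) simp
  note IS = supported_integral[OF cS S0]
  have zero: "0 = (LINT p|lborel. \<theta> p * divergence \<phi> p) + (\<Sum>b\<in>Basis. LINT p|lborel. q b p)
      - (LINT p|lborel. t p * snd (\<phi> p) * w (snd p))"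
    using \<open>(LINT p|lborel. divergence \<Theta> p) = 0\<close> Id(2) Iq(2) Iw(2)
    unfolding div by simp
  define V where "V x = (LINT y|lborel. t (x, y) *\<^sub>R \<phi> (x, y))" for x
  have cv: "continuous_on UNIV (\<lambda>p. t p *\<^sub>R \<phi> p)" by (intro continuous_intros ct \<phi>_cont)
  have v0: "t (x, y) *\<^sub>R \<phi> (x, y) = 0" if "\<not> (x \<in> K \<and> y \<in> {l..u})" for x y
    using \<phi>_support[OF that] by simp
  note Iv = supported_integral[OF cv v0]
  have V1: "norm (V x) \<le> 1" for x
  proof (cases "l \<le> u")
    case True
    define F where "F y = - \<tau> (\<mu> x - W y)" for y
    have "((\<lambda>y. \<tau> (\<mu> x - W y)) has_real_derivative \<tau>' (\<mu> x - W y) * - w y) (at y)" for y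
      by (rule DERIV_chain2[OF \<tau>_deriv]) (auto intro!: derivative_eq_intros W_deriv)
    from DERIV_minus[OF this] have F: "(F has_real_derivative t (x, y) * w y) (at y)" for y
      unfolding F_def t_def by simp
    have ctw: "continuous_on UNIV (\<lambda>y. t (x, y) * w y)"
      by (intro continuous_intros continuous_on_compose2[OF ct] w_cont) auto
    then have ci: "isCont (\<lambda>y. t (x, y) * w y) y" for y by (simp add: continuous_on_eq_continuous_at)
    have fi: "integrable lborel (\<lambda>y. t (x, y) * w y * indicator {l..u} y)"
      using borel_integrable_atLeastAtMost[of l u "\<lambda>y. t (x, y) * w y"] ci by simp
    have "norm (V x) \<le> (LINT y|lborel. norm (t (x, y) *\<^sub>R \<phi> (x, y)))"
      unfolding V_def by (rule integral_norm_bound)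
    also have "\<dots> \<le> (LINT y|lborel. t (x, y) * w y * indicator {l..u} y)"
    proof (rule integral_mono)
      show "integrable lborel (\<lambda>y. norm (t (x, y) *\<^sub>R \<phi> (x, y)))" by (rule integrable_norm[OF Iv(3)])
      show "norm (t (x, y) *\<^sub>R \<phi> (x, y)) \<le> t (x, y) * w y * indicator {l..u} y" for y
        using \<phi>_bound[of "(x, y)"] \<phi>_support[of x y] \<tau>'_bounds(1)
        by (cases "y \<in> {l..u}") (auto simp: t_def intro!: mult_left_mono)
    qed (rule fi)
    also have "\<dots> = F u - F l"
      by (rule integral_FTC_Icc_real[OF True F ci])
    also have "\<dots> \<le> 1"
      using \<tau>_bounds(1)[of "\<mu> x - W u"] \<tau>_bounds(2)[of "\<mu> x - W l"] by (simp add: F_def)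
    finally show ?thesis .
  next
    case False
    then have e: "(\<lambda>y. t (x, y) *\<^sub>R \<phi> (x, y)) = (\<lambda>y. 0)" by (intro ext v0) auto
    show ?thesis unfolding V_def e by simp
  qed
  have V0: "V x = 0" if "x \<notin> K" for x
  proof -
    have e: "(\<lambda>y. t (x, y) *\<^sub>R \<phi> (x, y)) = (\<lambda>y. 0)" using that by (intro ext v0) auto
    show ?thesis unfolding V_def e by simp
  qed
  have iV: "integrable lborel V" unfolding V_def[abs_def] by (rule Iv(5))
  have "(LINT x|lborel. snd (V x) * conv \<eta> S x)
     - (\<Sum>b\<in>Basis. LINT x|lborel. (fst (V x) \<bullet> b) * conv (\<lambda>y. G y \<bullet> b) m x) \<le> P"
    unfolding m(2) S(2)
    by (rule product_field_inequality[OF moll K_compact e iV V1 V0 ab \<zeta> \<sigma>])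
  moreover have "(LINT x|lborel. snd (V x) * conv \<eta> S x) = (LINT p|lborel. t p * snd (\<phi> p) * s (fst p))"
  proof -
    have "snd (V x) = (LINT y|lborel. t (x, y) * snd (\<phi> (x, y)))" for x
      unfolding V_def using integral_bounded_linear[OF bounded_linear_snd Iv(3)] by simp
    then show ?thesis using IS(4) by (simp flip: s_def)
  qed
  moreover have "(LINT x|lborel. (fst (V x) \<bullet> b) * conv (\<lambda>y. G y \<bullet> b) m x) = (LINT p|lborel. q b p)" for b
  proof -
    have "fst (V x) \<bullet> b = (LINT y|lborel. t (x, y) * (fst (\<phi> (x, y)) \<bullet> b))" for x
      unfolding V_def
      using integral_bounded_linear[OF bounded_linear_compose[OF bounded_linear_inner_left bounded_linear_fst] Iv(3)]
      by simp
    moreover have "(LINT y|lborel. q b (x, y)) = (LINT y|lborel. t (x, y) * (fst (\<phi> (x, y)) \<bullet> b)) * g b x" for x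
      by (simp add: q_def mult_ac flip: integral_mult_left_zero)
    ultimately show ?thesis using Iq(4)[of b] by (simp flip: g_def)
  qed
  ultimately have "(LINT p|lborel. t p * snd (\<phi> p) * s (fst p)) - (\<Sum>b\<in>Basis. LINT p|lborel. q b p) \<le> P"
    by simp
  then have "(LINT p|lborel. \<theta> p * divergence \<phi> p) - (LINT p|lborel. t p * snd (\<phi> p) * w (snd p))
      + (LINT p|lborel. t p * snd (\<phi> p) * s (fst p)) \<le> P"
    using zero by linarith
  moreover have "(LINT p|lborel. \<theta> p * divergence \<phi> p) - (LINT p|lborel. t p * snd (\<phi> p) * w (snd p))
      + (LINT p|lborel. t p * snd (\<phi> p) * s (fst p)) =
      (LINT p|lborel. \<theta> p * divergence \<phi> p - t p * snd (\<phi> p) * w (snd p) + t p * snd (\<phi> p) * s (fst p))"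
    using Id(2) Iw(2) IS(2) by simp
  ultimately show ?thesis
    unfolding estimate_def \<theta>_def t_def \<mu>_def s_def by (simp add: algebra_simps)
qed

end

lemma borel_measurable_fst_compose:
  fixes m :: "'a::euclidean_space \<Rightarrow> real"
  assumes "m \<in> borel_measurable borel"
  shows "(\<lambda>p :: 'a \<times> real. m (fst p)) \<in> borel_measurable borel"
  by (rule measurable_compose[OF borel_measurable_continuous_onI assms]) (intro continuous_intros)

context comparison_field begin

lemma estimate_measurable:
  assumes "m \<in> borel_measurable borel" "S \<in> borel_measurable borel"
  shows "(\<lambda>p. \<tau> (m (fst p) - W (snd p)) * divergence \<phi> p) \<in> borel_measurable borel"
    "(\<lambda>p. \<tau>' (m (fst p) - W (snd p)) * snd (\<phi> p) * (w (snd p) - S (fst p))) \<in> borel_measurable borel"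
    "(\<lambda>p. \<tau>' (m (fst p) - W (snd p)) * w (snd p)) \<in> borel_measurable borel"
proof -
  have "divergence \<phi> \<in> borel_measurable borel" "(\<lambda>p. snd (\<phi> p)) \<in> borel_measurable borel"
    "\<tau> \<in> borel_measurable borel" "\<tau>' \<in> borel_measurable borel"
    "(\<lambda>p::'a\<times>real. W (snd p)) \<in> borel_measurable borel" "(\<lambda>p::'a\<times>real. w (snd p)) \<in> borel_measurable borel"
    by (intro borel_measurable_continuous_onI continuous_intros divergence_cont \<phi>_cont \<tau>_cont \<tau>'_cont
        continuous_on_compose2[OF W_cont[of UNIV]] continuous_on_compose2[OF w_cont] subset_UNIV)+
  note [measurable] = this borel_measurable_fst_compose[OF assms(1)] borel_measurable_fst_compose[OF assms(2)]
  show "(\<lambda>p. \<tau> (m (fst p) - W (snd p)) * divergence \<phi> p) \<in> borel_measurable borel"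
    "(\<lambda>p. \<tau>' (m (fst p) - W (snd p)) * snd (\<phi> p) * (w (snd p) - S (fst p))) \<in> borel_measurable borel"
    "(\<lambda>p. \<tau>' (m (fst p) - W (snd p)) * w (snd p)) \<in> borel_measurable borel"
    by measurable
qed

text \<open>
  Everything happens under one integral whose integrand is bounded on a fixed compact set and depends
  continuously on the values of the height and of the density.
\<close>

lemma estimate_limit:
  assumes est: "\<And>i. estimate (m i) (S i)"
    and meas: "\<And>i. m i \<in> borel_measurable borel" "\<And>i. S i \<in> borel_measurable borel"
      "m' \<in> borel_measurable borel" "S' \<in> borel_measurable borel"
    and m: "AE x in lborel. x \<in> K \<longrightarrow> (\<lambda>i. m i x) \<longlonglongrightarrow> m' x"
    and S: "AE x in lborel. x \<in> K \<longrightarrow> (\<lambda>i. S i x) \<longlonglongrightarrow> S' x"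
    and B: "\<And>i. AE x in lborel. x \<in> K \<longrightarrow> \<bar>S i x\<bar> \<le> B"
  shows "estimate m' S'"
proof -
  define F where "F m S p = \<tau> (m (fst p) - W (snd p)) * divergence \<phi> p
        - \<tau>' (m (fst p) - W (snd p)) * snd (\<phi> p) * (w (snd p) - S (fst p))" for m S p
  obtain Cd where Cd: "Cd \<ge> 0" "\<And>p. \<bar>divergence \<phi> p\<bar> \<le> Cd"
    using supported_integral(1)[OF divergence_cont divergence_support] by auto
  obtain C\<phi> where C\<phi>: "C\<phi> \<ge> 0" "\<And>p. \<bar>snd (\<phi> p)\<bar> \<le> C\<phi>"
  proof -
    have "\<exists>B\<ge>0. \<forall>p. norm (snd (\<phi> p)) \<le> B"
      by (rule supported_integral(1)) (auto intro!: continuous_intros \<phi>_cont simp: \<phi>_support)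
    then show thesis using that by auto
  qed
  have "bounded (w ` {l..u})"
    by (intro compact_imp_bounded compact_continuous_image continuous_on_subset[OF w_cont]) auto
  then obtain Cw where Cw: "\<And>y. y \<in> {l..u} \<Longrightarrow> \<bar>w y\<bar> \<le> Cw"
    unfolding bounded_iff by (metis image_eqI real_norm_def)
  have T0: "0 \<le> T" using \<tau>'_bounds order_trans by blast
  define C where "C = Cd + T * C\<phi> * (\<bar>Cw\<bar> + \<bar>B\<bar>)"
  have FC: "\<bar>F (m i) (S i) p\<bar> \<le> C * indicator (K \<times> {l..u}) p"
    if B: "fst p \<in> K \<longrightarrow> \<bar>S i (fst p)\<bar> \<le> B" for i p
  proof (cases "p \<in> K \<times> {l..u}")
    case True
    then obtain x y where p: "p = (x, y)" "x \<in> K" "y \<in> {l..u}" by auto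
    have "\<bar>\<tau> (m i x - W y) * divergence \<phi> p\<bar> \<le> 1 * Cd"
      unfolding abs_mult using \<tau>_bounds Cd by (intro mult_mono) auto
    moreover have "\<bar>\<tau>' (m i x - W y) * snd (\<phi> p) * (w y - S i x)\<bar> \<le> T * C\<phi> * (\<bar>Cw\<bar> + \<bar>B\<bar>)"
      unfolding abs_mult using \<tau>'_bounds C\<phi> Cw[OF p(3)] B p T0
      by (intro mult_mono mult_nonneg_nonneg) auto
    ultimately show ?thesis using True by (simp add: F_def C_def p(1))
  next
    case False
    then have "\<phi> p = 0" "divergence \<phi> p = 0"
      using \<phi>_support[of "fst p" "snd p"] divergence_support[of "fst p" "snd p"] by (cases p; force)+
    then show ?thesis using False by (simp add: F_def)
  qed
  have Fm: "F m S \<in> borel_measurable borel"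
    if "m \<in> borel_measurable borel" "S \<in> borel_measurable borel" for m S
    using estimate_measurable[OF that] unfolding F_def by (intro borel_measurable_diff)
  have "(\<lambda>i. LINT p|lborel. F (m i) (S i) p) \<longlonglongrightarrow> (LINT p|lborel. F m' S' p)"
  proof (rule integral_dominated_convergence[where w = "\<lambda>p. C * indicator (K \<times> {l..u}) p"])
    have "emeasure lborel (K \<times> {l..u}) < \<infinity>"
      by (intro emeasure_compact_finite compact_Times K_compact compact_Icc)
    moreover have "K \<times> {l..u} \<in> sets borel"
      by (intro borel_closed closed_Times compact_imp_closed K_compact) auto
    ultimately show "integrable lborel (\<lambda>p. C * indicator (K \<times> {l..u}) p :: real)"
      by simp
    show "AE p in lborel. (\<lambda>i. F (m i) (S i) p) \<longlonglongrightarrow> F m' S' p"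
      using AE_lborel_fst[OF m] AE_lborel_fst[OF S]
    proof eventually_elim
      case (elim p)
      show ?case
      proof (cases "fst p \<in> K")
        case True
        have 1: "(\<lambda>i. \<tau> (m i (fst p) - W (snd p))) \<longlonglongrightarrow> \<tau> (m' (fst p) - W (snd p))"
          by (rule continuous_on_tendsto_compose[OF \<tau>_cont]) (use elim True in \<open>auto intro!: tendsto_intros\<close>)
        have 2: "(\<lambda>i. \<tau>' (m i (fst p) - W (snd p))) \<longlonglongrightarrow> \<tau>' (m' (fst p) - W (snd p))"
          by (rule continuous_on_tendsto_compose[OF \<tau>'_cont]) (use elim True in \<open>auto intro!: tendsto_intros\<close>)
        have 3: "(\<lambda>i. S i (fst p)) \<longlonglongrightarrow> S' (fst p)" using elim True by blast
        show ?thesis unfolding F_def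
          by (intro tendsto_diff tendsto_mult 1 2 3 tendsto_const)
      next
        case False
        then have "\<phi> p = 0" "divergence \<phi> p = 0"
          using \<phi>_support[of "fst p" "snd p"] divergence_support[of "fst p" "snd p"] by auto
        then show ?thesis by (simp add: F_def)
      qed
    qed
    show "AE p in lborel. norm (F (m i) (S i) p) \<le> C * indicator (K \<times> {l..u}) p" for i
      using AE_lborel_fst[OF B[of i]] by eventually_elim (simp add: FC)
  qed (simp_all add: Fm meas)
  moreover have "(LINT p|lborel. F (m i) (S i) p) \<le> P" for i
    using est[of i] unfolding estimate_def F_def .
  ultimately have "(LINT p|lborel. F m' S' p) \<le> P"
    by (intro LIMSEQ_le_const2) auto
  then show ?thesis unfolding estimate_def F_def .
qed

text \<open>
  The mollification parameter tends to zero along a subsequence for which both mollified functions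
  converge almost everywhere.
\<close>

lemma estimate_slices:
  assumes ab: "{a..b} \<subseteq> J"
    and \<zeta>: "\<And>t. (\<zeta> has_real_derivative \<zeta>' t) (at t)" "continuous_on UNIV \<zeta>'"
      "\<And>t. 0 \<le> \<zeta> t" "\<And>t. \<zeta> t \<le> w t" "\<And>t. t \<notin> {a..b} \<Longrightarrow> \<zeta> t = 0"
    and \<sigma>: "C1_deriv \<sigma> D'" "\<And>x y. y \<notin> {a..b} \<Longrightarrow> \<sigma> (x, y) = 0"
      "\<And>x y. norm x \<le> R \<Longrightarrow> y \<in> J \<Longrightarrow> \<bar>\<sigma> (x, y)\<bar> \<le> w y"
  shows "estimate (slice_integral M (\<lambda>p. \<zeta> (snd p))) (slice_integral M (\<lambda>p. D' p (0, 1)))"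
proof -
  define m where "m = slice_integral M (\<lambda>p. \<zeta> (snd p))"
  define S where "S = slice_integral M (\<lambda>p. D' p (0, 1))"
  have c\<zeta>: "continuous_on UNIV \<zeta>" using \<zeta>(1) by (auto intro!: DERIV_isCont continuous_at_imp_continuous_on)
  have cm: "continuous_on UNIV (\<lambda>p::'a\<times>real. \<zeta> (snd p))"
    by (intro continuous_on_compose2[OF c\<zeta>] continuous_intros) auto
  have cS: "continuous_on UNIV (\<lambda>p. D' p (0, 1))" by (rule C1_deriv_continuous_derivative[OF \<sigma>(1)])
  have S0: "D' (x, y) (0, 1) = 0" if "y \<notin> {a..b}" for x y
    by (rule C1_deriv_vertical_support[OF \<sigma>(1,2) that])
  obtain Bm where Bm: "\<And>x. \<bar>m x\<bar> \<le> Bm"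
    using slice_bounded[OF cm, of a b] \<zeta>(5) unfolding m_def by auto
  obtain BS where BS: "BS \<ge> 0" "\<And>x. \<bar>S x\<bar> \<le> BS"
    using slice_bounded[OF cS S0] unfolding S_def by blast
  have mm: "m \<in> borel_measurable borel" unfolding m_def
    by (rule slice_integral_measurable[OF M_borel borel_measurable_continuous_onI[OF cm]])
  have mS: "S \<in> borel_measurable borel" unfolding S_def
    by (rule slice_integral_measurable[OF M_borel borel_measurable_continuous_onI[OF cS]])
  have m0: "m x = 0" "S x = 0" if "R < norm x" for x using slice_integral_0[OF that] by (auto simp: m_def S_def)
  have im: "integrable lborel m"
    by (rule integrable_bounded_support[OF mm Bm[folded real_norm_def] m0(1)])
  have iS: "integrable lborel S"
    by (rule integrable_bounded_support[OF mS BS(2)[folded real_norm_def] m0(2)])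
  obtain e where e: "e > 0" "(\<Union>x\<in>K. cball x e) \<subseteq> \<Omega>"
    using compact_subset_open_imp_cball_epsilon_subset[OF K_compact \<Omega>_open K_sub] by blast
  define \<epsilon> where "\<epsilon> n = e * (1 / real (Suc n))" for n
  have \<epsilon>: "\<epsilon> n > 0" "\<epsilon> n \<le> e" for n using e by (auto simp: \<epsilon>_def field_simps)
  have "(\<lambda>n. e * (1 / real (Suc n))) \<longlonglongrightarrow> e * 0"
    by (intro tendsto_mult tendsto_const) (use LIMSEQ_inverse_real_of_nat in \<open>simp add: inverse_eq_divide\<close>)
  then have \<epsilon>0: "\<epsilon> \<longlonglongrightarrow> 0" by (simp add: \<epsilon>_def[abs_def])
  have "\<forall>n. \<exists>\<eta>G. mollifier (\<epsilon> n) (fst \<eta>G :: 'a \<Rightarrow> real) (snd \<eta>G)"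
    using mollifier_exists[OF \<epsilon>(1)] by auto
  then obtain \<eta>G where \<eta>G: "\<And>n. mollifier (\<epsilon> n) (fst (\<eta>G n) :: 'a \<Rightarrow> real) (snd (\<eta>G n))" by metis
  define \<eta> where "\<eta> n = fst (\<eta>G n)" for n
  define G where "G n = snd (\<eta>G n)" for n
  have moll: "mollifier (\<epsilon> n) (\<eta> n) (G n)" for n using \<eta>G by (simp add: \<eta>_def G_def)
  define d where "d n x = \<bar>conv (\<eta> n) m x - m x\<bar> + \<bar>conv (\<eta> n) S x - S x\<bar>" for n x
  have i1: "integrable lborel (\<lambda>x. \<bar>conv (\<eta> n) m x - m x\<bar>)" for n
    using integrable_conv(1)[OF moll im] im by auto
  have i2: "integrable lborel (\<lambda>x. \<bar>conv (\<eta> n) S x - S x\<bar>)" for n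
    using integrable_conv(1)[OF moll iS] iS by auto
  have id: "integrable lborel (d n)" for n unfolding d_def using i1[of n] i2[of n] by simp
  have "(\<lambda>n. (LINT x|lborel. \<bar>conv (\<eta> n) m x - m x\<bar>) + (LINT x|lborel. \<bar>conv (\<eta> n) S x - S x\<bar>)) \<longlonglongrightarrow> 0 + 0"
    by (intro tendsto_add conv_L1_tendsto[OF moll \<epsilon>0 mm Bm m0(1)] conv_L1_tendsto[OF moll \<epsilon>0 mS BS(2) m0(2)])
  moreover have "(LINT x|lborel. norm (d n x)) =
     (LINT x|lborel. \<bar>conv (\<eta> n) m x - m x\<bar>) + (LINT x|lborel. \<bar>conv (\<eta> n) S x - S x\<bar>)" for n
    using i1[of n] i2[of n] by (simp add: d_def)
  ultimately have "(\<lambda>n. LINT x|lborel. norm (d n x)) \<longlonglongrightarrow> 0" by simp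
  then obtain r where r: "strict_mono r" "AE x in lborel. (\<lambda>n. d (r n) x) \<longlonglongrightarrow> 0"
    using tendsto_L1_AE_subseq[where u = d, OF id] by blast
  have conv: "AE x in lborel. (\<lambda>n. conv (\<eta> (r n)) m x) \<longlonglongrightarrow> m x \<and> (\<lambda>n. conv (\<eta> (r n)) S x) \<longlonglongrightarrow> S x"
    using r(2)
  proof eventually_elim
    case (elim x)
    have "(\<lambda>n. conv (\<eta> (r n)) m x - m x) \<longlonglongrightarrow> 0" "(\<lambda>n. conv (\<eta> (r n)) S x - S x) \<longlonglongrightarrow> 0"
      by (rule Lim_null_comparison[OF _ elim], rule always_eventually, simp add: d_def)+
    then show ?case by (auto intro: LIM_zero_cancel)
  qed
  have "estimate m S"
  proof (rule estimate_limit[of "\<lambda>n. conv (\<eta> (r n)) m" "\<lambda>n. conv (\<eta> (r n)) S"])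
    show "estimate (conv (\<eta> (r n)) m) (conv (\<eta> (r n)) S)" for n
    proof (rule estimate_mollified[OF moll _ ab \<zeta> \<sigma> im m_def iS S_def])
      show "cball x (\<epsilon> (r n)) \<subseteq> \<Omega>" if "x \<in> K" for x
        using e(2) that \<epsilon>(2)[of "r n"] subset_cball[OF \<epsilon>(2)[of "r n"], of x] by blast
    qed
    show "conv (\<eta> (r n)) m \<in> borel_measurable borel" "conv (\<eta> (r n)) S \<in> borel_measurable borel" for n
      using integrable_conv(1)[OF moll im] integrable_conv(1)[OF moll iS] by auto
    show "AE x in lborel. x \<in> K \<longrightarrow> (\<lambda>n. conv (\<eta> (r n)) m x) \<longlonglongrightarrow> m x"
      "AE x in lborel. x \<in> K \<longrightarrow> (\<lambda>n. conv (\<eta> (r n)) S x) \<longlonglongrightarrow> S x"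
      using conv by auto
    show "AE x in lborel. x \<in> K \<longrightarrow> \<bar>conv (\<eta> (r n)) S x\<bar> \<le> BS" for n
      using norm_conv_le[OF moll iS BS(2)[folded real_norm_def]] by simp
  qed (rule mm mS)+
  then show ?thesis unfolding m_def S_def .
qed

lemma estimate_heights:
  assumes ab: "0 < a" "b \<in> J"
    and \<sigma>: "C1_deriv \<sigma> D'" "\<And>x y. y \<notin> {a..b} \<Longrightarrow> \<sigma> (x, y) = 0"
      "\<And>x y. norm x \<le> R \<Longrightarrow> y \<in> J \<Longrightarrow> \<bar>\<sigma> (x, y)\<bar> \<le> w y"
    and fin: "AE x in lborel. x \<in> \<Omega> \<longrightarrow> integrable lborel (\<lambda>y. indicator M (x, y) * w y)"
  shows "estimate (slice_integral M (\<lambda>p. w (snd p))) (slice_integral M (\<lambda>p. D' p (0, 1)))"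
proof -
  obtain \<zeta> \<zeta>' :: "nat \<Rightarrow> real \<Rightarrow> real" and c d :: "nat \<Rightarrow> real" where
    \<zeta>: "\<And>i t. (\<zeta> i has_real_derivative \<zeta>' i t) (at t)" "\<And>i. continuous_on UNIV (\<zeta>' i)"
    "\<And>i t. 0 \<le> \<zeta> i t" "\<And>i t. \<zeta> i t \<le> w t" "\<And>i. 0 < c i" "\<And>i. d i \<in> J"
    "\<And>i t. t \<notin> {c i..d i} \<Longrightarrow> \<zeta> i t = 0" "\<And>t. t \<in> J \<Longrightarrow> (\<lambda>i. \<zeta> i t) \<longlonglongrightarrow> w t"
    using horizontal_profiles by blast
  have c\<zeta>: "continuous_on UNIV (\<zeta> i)" for i
    using \<zeta>(1) by (auto intro!: DERIV_isCont continuous_at_imp_continuous_on)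
  have hull: "{min (c i) a..max (d i) b} \<subseteq> J" for i
  proof -
    have "max (d i) b \<in> J" using ab \<zeta>(6)[of i] by (simp add: max_def)
    moreover have "0 < min (c i) a" using ab \<zeta>(5)[of i] by simp
    ultimately show ?thesis using J_down[of "max (d i) b"] by (auto simp del: min_less_iff_conj)
  qed
  have cS: "continuous_on UNIV (\<lambda>p. D' p (0, 1))" by (rule C1_deriv_continuous_derivative[OF \<sigma>(1)])
  have S0: "D' (x, y) (0, 1) = 0" if "y \<notin> {a..b}" for x y
    by (rule C1_deriv_vertical_support[OF \<sigma>(1,2) that])
  obtain BS where BS: "\<And>x. \<bar>slice_integral M (\<lambda>p. D' p (0, 1)) x\<bar> \<le> BS"
    using slice_bounded[OF cS S0] by blast
  have mS: "slice_integral M (\<lambda>p. D' p (0, 1)) \<in> borel_measurable borel"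
    by (rule slice_integral_measurable[OF M_borel borel_measurable_continuous_onI[OF cS]])
  have mz: "slice_integral M (\<lambda>p. g (snd p)) \<in> borel_measurable borel" if "continuous_on UNIV g" for g
    by (intro slice_integral_measurable[OF M_borel] borel_measurable_continuous_onI
        continuous_on_compose2[OF that] continuous_intros) auto
  show ?thesis
  proof (rule estimate_limit[of "\<lambda>i. slice_integral M (\<lambda>p. \<zeta> i (snd p))" "\<lambda>i. slice_integral M (\<lambda>p. D' p (0, 1))"])
    show "estimate (slice_integral M (\<lambda>p. \<zeta> i (snd p))) (slice_integral M (\<lambda>p. D' p (0, 1)))" for i
    proof (rule estimate_slices[OF hull \<zeta>(1-4) _ \<sigma>(1) _ \<sigma>(3)])
      show "\<zeta> i t = 0" if "t \<notin> {min (c i) a..max (d i) b}" for t using that by (intro \<zeta>(7)) auto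
      show "\<sigma> (x, y) = 0" if "y \<notin> {min (c i) a..max (d i) b}" for x y using that by (intro \<sigma>(2)) auto
    qed
    show "AE x in lborel. x \<in> K \<longrightarrow> (\<lambda>i. slice_integral M (\<lambda>p. \<zeta> i (snd p)) x)
        \<longlonglongrightarrow> slice_integral M (\<lambda>p. w (snd p)) x"
      using fin
    proof eventually_elim
      case (elim x)
      show ?case
      proof
        assume "x \<in> K"
        then have ix: "integrable lborel (\<lambda>y. indicator M (x, y) * w y)" using elim K_sub by auto
        have [measurable]: "(\<lambda>y. indicator M (x, y) :: real) \<in> borel_measurable borel"
        proof -
          have "(\<lambda>y. (x, y)) \<in> borel_measurable borel"
            by (intro borel_measurable_continuous_onI continuous_intros)
          from measurable_compose[OF this, of "indicator M :: _ \<Rightarrow> real" borel] show ?thesis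
            using M_borel by simp
        qed
        have [measurable]: "\<zeta> i \<in> borel_measurable borel" "w \<in> borel_measurable borel" for i
          by (rule borel_measurable_continuous_onI[OF c\<zeta>], rule borel_measurable_continuous_onI[OF w_cont])
        show "(\<lambda>i. slice_integral M (\<lambda>p. \<zeta> i (snd p)) x) \<longlonglongrightarrow> slice_integral M (\<lambda>p. w (snd p)) x"
          unfolding slice_integral_def snd_conv
        proof (rule integral_dominated_convergence[OF _ _ ix])
          show "AE y in lborel. (\<lambda>i. indicator M (x, y) * \<zeta> i y) \<longlonglongrightarrow> indicator M (x, y) * w y"
          proof (rule AE_I2)
            fix y show "(\<lambda>i. indicator M (x, y) * \<zeta> i y) \<longlonglongrightarrow> indicator M (x, y) * w y"
            proof (cases "(x, y) \<in> M")
              case True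
              then have "y \<in> J" using M_sub by auto
              then show ?thesis by (intro tendsto_mult tendsto_const \<zeta>(8))
            qed simp
          qed
          show "AE y in lborel. norm (indicator M (x, y) * \<zeta> i y) \<le> indicator M (x, y) * w y" for i
            using \<zeta>(3,4) by (intro AE_I2) (auto simp: indicator_def)
        qed measurable
      qed
    qed
  qed (use BS mS mz c\<zeta> w_cont in auto)
qed

end

section \<open>The one-dimensional calibration\<close>

text \<open>
  Equal to \<open>1\<close> up to the level \<open>b\<close> and to \<open>0\<close> from the level \<open>B\<close> on.
\<close>

definition fade :: "real \<Rightarrow> real \<Rightarrow> real \<Rightarrow> real" where
  "fade b B z = smooth_step ((B - z) / (B - b))"

definition fade_rate :: "real \<Rightarrow> real \<Rightarrow> real \<Rightarrow> real" where
  "fade_rate b B z = smooth_step' ((B - z) / (B - b)) / (B - b)"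

text \<open>
  Equal to \<open>0\<close> up to \<open>r/2\<close> and to \<open>1\<close> from \<open>r\<close> on. Profiles vanish up to \<open>r\<close>, so this factor does not
  change the calibrating fields; it only guarantees compact support independently of the density.
\<close>

definition start :: "real \<Rightarrow> real \<Rightarrow> real" where
  "start r z = smooth_step (2 * z / r - 1)"

definition start_rate :: "real \<Rightarrow> real \<Rightarrow> real" where
  "start_rate r z = smooth_step' (2 * z / r - 1) * (2 / r)"

lemma fade_has_derivative: "(fade b B has_real_derivative - fade_rate b B z) (at z)"
proof -
  have "((\<lambda>z. B - z) has_real_derivative - 1) (at z)" by (auto intro!: derivative_eq_intros)
  then have "((\<lambda>z. (B - z) / (B - b)) has_real_derivative - 1 / (B - b)) (at z)"
    by (rule DERIV_cdivide)
  from DERIV_chain2[OF smooth_step_has_derivative this] show ?thesis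
    unfolding fade_def[abs_def] fade_rate_def by simp
qed

lemma start_has_derivative: "r \<noteq> 0 \<Longrightarrow> (start r has_real_derivative start_rate r z) (at z)"
  unfolding start_def[abs_def] start_rate_def by (auto intro!: derivative_eq_intros)

lemma fade_continuous: "b < B \<Longrightarrow> continuous_on UNIV (fade b B)" "b < B \<Longrightarrow> continuous_on UNIV (fade_rate b B)"
  unfolding fade_def[abs_def] fade_rate_def[abs_def] by (intro continuous_intros; simp)+

lemma start_continuous: "r > 0 \<Longrightarrow> continuous_on UNIV (start r)" "r > 0 \<Longrightarrow> continuous_on UNIV (start_rate r)"
  unfolding start_def[abs_def] start_rate_def[abs_def] by (intro continuous_intros; simp)+

lemma fade_bounds: "0 \<le> fade b B z" "fade b B z \<le> 1"
  unfolding fade_def by (rule smooth_step_bounds)+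

lemma start_bounds: "0 \<le> start r z" "start r z \<le> 1"
  unfolding start_def by (rule smooth_step_bounds)+

lemma fade_rate_bounds:
  assumes "b < B"
  shows "0 \<le> fade_rate b B z" "fade_rate b B z \<le> 2 / (B - b)"
  unfolding fade_rate_def using smooth_step'_bounds assms
  by (auto intro: divide_right_mono divide_nonneg_pos)

lemma fade_rate_0:
  assumes "b < B"
  shows "z \<le> b \<Longrightarrow> fade_rate b B z = 0" "B \<le> z \<Longrightarrow> fade_rate b B z = 0" "B \<le> z \<Longrightarrow> fade b B z = 0"
    "z \<le> b \<Longrightarrow> fade b B z = 1"
proof -
  show "fade_rate b B z = 0" if "z \<le> b"
    unfolding fade_rate_def using that assms by (subst smooth_step'_eq(2)) (auto simp: field_simps)
  show "fade_rate b B z = 0" if "B \<le> z"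
    unfolding fade_rate_def using that assms by (subst smooth_step'_eq(1)) (auto simp: field_simps)
  show "fade b B z = 0" if "B \<le> z"
    unfolding fade_def using that assms by (intro smooth_step_eq(1)) (auto simp: field_simps)
  show "fade b B z = 1" if "z \<le> b"
    unfolding fade_def using that assms by (intro smooth_step_eq(2)) (auto simp: field_simps)
qed

lemma start_eq:
  assumes "r > 0"
  shows "r \<le> z \<Longrightarrow> start r z = 1" "r \<le> z \<Longrightarrow> start_rate r z = 0" "z \<le> r / 2 \<Longrightarrow> start r z = 0"
proof -
  show "start r z = 1" if "r \<le> z"
    unfolding start_def using that assms by (intro smooth_step_eq(2)) (auto simp: field_simps)
  show "start_rate r z = 0" if "r \<le> z"
    unfolding start_rate_def using that assms by (subst smooth_step'_eq(2)) (auto simp: field_simps)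
  show "start r z = 0" if "z \<le> r / 2"
    unfolding start_def using that assms by (intro smooth_step_eq(1)) (auto simp: field_simps)
qed

context calibrated_weight begin

definition partial_height :: "real set \<Rightarrow> real \<Rightarrow> real" where
  "partial_height A y = (LINT t|lborel. indicator A t * w t * indicator {0..y} t)"

lemma partial_height_measurable:
  assumes [measurable]: "A \<in> sets borel"
  shows "partial_height A \<in> borel_measurable borel"
proof -
  have "(\<lambda>y. LINT t|lborel. indicator A t * w t * indicator {0..y} t) \<in> borel_measurable borel"
  proof (rule lborel.borel_measurable_lebesgue_integral)
    have [measurable]: "w \<in> borel_measurable borel" by (rule borel_measurable_continuous_onI[OF w_cont])
    have "{p :: real \<times> real. 0 \<le> snd p \<and> snd p \<le> fst p} \<in> sets borel"
      by (intro borel_closed closed_Collect_conj closed_Collect_le continuous_intros)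
    then have [measurable]: "{p :: real \<times> real. 0 \<le> snd p \<and> snd p \<le> fst p} \<in> sets (borel \<Otimes>\<^sub>M lborel)"
      by (simp add: borel_prod[symmetric] sets_pair_measure_cong[OF refl sets_lborel])
    have "(\<lambda>p. indicator A (snd p) * w (snd p) * indicator {p :: real \<times> real. 0 \<le> snd p \<and> snd p \<le> fst p} p :: real)
       \<in> borel_measurable (borel \<Otimes>\<^sub>M lborel)" by measurable
    also have "(\<lambda>p. indicator A (snd p) * w (snd p) * indicator {p :: real \<times> real. 0 \<le> snd p \<and> snd p \<le> fst p} p :: real)
      = (\<lambda>(y, t). indicator A t * w t * indicator {0..y} t)" by (auto simp: indicator_def)
    finally show "(\<lambda>(y, t). indicator A t * w t * indicator {0..y} t :: real) \<in> borel_measurable (borel \<Otimes>\<^sub>M lborel)" .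
  qed
  then show ?thesis by (simp add: partial_height_def[abs_def])
qed

lemma primitive_bounds:
  assumes y: "0 \<le> y" and a: "a 0 = 0" "\<And>t. (a has_real_derivative \<rho> t * w t) (at t)"
    and \<rho>: "\<And>t. 0 \<le> t \<Longrightarrow> t \<le> y \<Longrightarrow> 0 \<le> \<rho> t \<and> \<rho> t \<le> 1"
  shows "0 \<le> a y" "a y \<le> W y"
proof -
  have "a 0 \<le> a y"
  proof (rule DERIV_nonneg_imp_nondecreasing[OF y])
    show "\<exists>d. (a has_real_derivative d) (at t) \<and> 0 \<le> d" if "0 \<le> t" "t \<le> y" for t
      using a(2) \<rho>[OF that] w_nonneg by (intro exI[of _ "\<rho> t * w t"]) auto
  qed
  then show "0 \<le> a y" using a(1) by simp
  have "W 0 - a 0 \<le> W y - a y"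
  proof (rule DERIV_nonneg_imp_nondecreasing[OF y, where f = "\<lambda>y. W y - a y"])
    fix t assume t: "0 \<le> t" "t \<le> y"
    have "\<rho> t * w t \<le> 1 * w t" using \<rho>[OF t] w_nonneg by (intro mult_right_mono) auto
    then show "\<exists>d. ((\<lambda>y. W y - a y) has_real_derivative d) (at t) \<and> 0 \<le> d"
      by (intro exI[of _ "w t - \<rho> t * w t"] conjI DERIV_diff W_deriv a(2)) simp
  qed
  then show "a y \<le> W y" using a(1) W_0 by simp
qed

text \<open>
  The limit of the integrals over \<open>A\<close> of the derivatives of the faded calibrating fields. It is written as an
  average over the fading zone, which contains no derivative of \<open>F\<close>, so that it remains controlled when the
  profile \<open>F\<close> is not smooth in the limit.
\<close>

definition calibration_value ::
  "(real \<Rightarrow> real) \<Rightarrow> real \<Rightarrow> real \<Rightarrow> real set \<Rightarrow> real" where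
  "calibration_value F b B A =
     (LINT y|lborel. fade_rate b B (W y) * w y *
        (indicator A y * F (W y - partial_height A y) + (1 - indicator A y) * F (partial_height A y)))"

text \<open>
  The \<open>y\<close>-derivative of \<open>start r (W y) * fade b B (W y) * (F a - F (W y - a))\<close> when \<open>a\<close> is a function of \<open>y\<close> with
  derivative \<open>\<rho> w\<close>.
\<close>

definition calibration_derivative ::
  "(real \<Rightarrow> real) \<Rightarrow> (real \<Rightarrow> real) \<Rightarrow> real \<Rightarrow> real \<Rightarrow> real \<Rightarrow> real \<Rightarrow> real \<Rightarrow> real \<Rightarrow> real" where
  "calibration_derivative F F' r b B y a \<rho> =
     (start_rate r (W y) * fade b B (W y) - start r (W y) * fade_rate b B (W y)) * w y * (F a - F (W y - a))
     + start r (W y) * fade b B (W y) * (F' a * (\<rho> * w y) - F' (W y - a) * (w y - \<rho> * w y))"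

text \<open>
  Where the factor \<^term>\<open>start r\<close> is not constant, both arguments of \<open>F\<close> are below \<open>r\<close> and every term
  vanishes.
\<close>

lemma calibration_derivative_eq:
  assumes F: "\<And>t. (F has_real_derivative F' t) (at t)" "0 < r" "\<And>z. z \<le> r \<Longrightarrow> F z = 0"
    and a: "0 \<le> a" "a \<le> W y"
  shows "calibration_derivative F F' r b B y a \<rho> =
     - fade_rate b B (W y) * w y * (F a - F (W y - a))
     + fade b B (W y) * (F' a * (\<rho> * w y) - F' (W y - a) * (w y - \<rho> * w y))"
proof (cases "W y < r")
  case True
  have F'0: "F' z = 0" if "z < r" for z
  proof -
    have "(F has_real_derivative 0) (at z)"
      by (rule has_field_derivative_transform_within_open[of "\<lambda>_. 0" _ _ "{..<r}"]) (use F(3) that in auto)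
    then show ?thesis using DERIV_unique[OF F(1)] by blast
  qed
  have "F a = 0" "F (W y - a) = 0" "F' a = 0" "F' (W y - a) = 0"
    using True a by (auto intro!: F(3) F'0)
  then show ?thesis by (simp add: calibration_derivative_def)
next
  case False
  then show ?thesis using F(2) by (simp add: calibration_derivative_def start_eq)
qed

lemma calibration_derivative_bounded:
  assumes y1: "y1 \<in> J" "W y1 = B" and b: "b < B"
    and F: "\<And>t. (F has_real_derivative F' t) (at t)" "continuous_on UNIV F'" "0 < r" "\<And>z. z \<le> r \<Longrightarrow> F z = 0"
  obtains C where "0 \<le> C" "\<And>y a \<rho>. 0 \<le> y \<Longrightarrow> y \<le> y1 \<Longrightarrow> 0 \<le> a \<Longrightarrow> a \<le> W y \<Longrightarrow> 0 \<le> \<rho> \<Longrightarrow> \<rho> \<le> 1 \<Longrightarrow>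
     \<bar>calibration_derivative F F' r b B y a \<rho>\<bar> \<le> C"
    "\<And>z. 0 \<le> z \<Longrightarrow> z \<le> B \<Longrightarrow> \<bar>F z\<bar> \<le> C" "\<And>z. 0 \<le> z \<Longrightarrow> z \<le> B \<Longrightarrow> \<bar>F' z\<bar> \<le> C"
    "\<And>y. 0 \<le> y \<Longrightarrow> y \<le> y1 \<Longrightarrow> w y \<le> C" "2 / (B - b) \<le> C"
proof -
  have cF: "continuous_on UNIV F"
    using F(1) by (auto intro!: DERIV_isCont continuous_at_imp_continuous_on)
  have bd: "\<exists>C. \<forall>z\<in>{c..d}. \<bar>g z\<bar> \<le> C" if "continuous_on UNIV g" for g :: "real \<Rightarrow> real" and c d
  proof -
    have "bounded (g ` {c..d})"
      by (intro compact_imp_bounded compact_continuous_image continuous_on_subset[OF that]) auto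
    then show ?thesis unfolding bounded_iff by auto
  qed
  obtain C1 where C1: "\<And>z. z \<in> {0..B} \<Longrightarrow> \<bar>F z\<bar> \<le> C1" using bd[OF cF] by meson
  obtain C2 where C2: "\<And>z. z \<in> {0..B} \<Longrightarrow> \<bar>F' z\<bar> \<le> C2" using bd[OF F(2)] by meson
  obtain C3 where C3: "\<And>y. y \<in> {0..y1} \<Longrightarrow> \<bar>w y\<bar> \<le> C3" using bd[OF w_cont] by meson
  define c where "c = max 0 (max (max C1 C2) (max C3 (2 / (B - b))))"
  have c: "0 \<le> c" "C1 \<le> c" "C2 \<le> c" "C3 \<le> c" "2 / (B - b) \<le> c" by (auto simp: c_def)
  have cw: "w y \<le> c" if "0 \<le> y" "y \<le> y1" for y using C3[of y] that c by auto
  have cF': "\<bar>F z\<bar> \<le> c" "\<bar>F' z\<bar> \<le> c" if "0 \<le> z" "z \<le> B" for z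
    using C1[of z] C2[of z] that c by auto
  show thesis
  proof (rule that[of "max c (c * c * (2 * c) + 1 * (c * c + c * c))"])
    fix y a \<rho> :: real
    assume y: "0 \<le> y" "y \<le> y1" and a: "0 \<le> a" "a \<le> W y" and \<rho>: "0 \<le> \<rho>" "\<rho> \<le> 1"
    have WB: "W y \<le> B" using W_mono[OF y(2)] y1 by simp
    have wc: "w y \<le> c" "0 \<le> w y" using cw[OF y] w_nonneg by auto
    have k: "\<bar>fade_rate b B (W y)\<bar> \<le> c"
      using fade_rate_bounds[OF b, of "W y"] c by auto
    have Fa: "\<bar>F a\<bar> \<le> c" "\<bar>F (W y - a)\<bar> \<le> c" "\<bar>F' a\<bar> \<le> c" "\<bar>F' (W y - a)\<bar> \<le> c"
      using cF' a WB by auto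
    have "\<bar>- fade_rate b B (W y) * w y * (F a - F (W y - a))\<bar> \<le> c * c * (2 * c)"
      unfolding abs_mult abs_minus_cancel using k wc Fa c by (intro mult_mono) auto
    moreover have "\<bar>fade b B (W y) * (F' a * (\<rho> * w y) - F' (W y - a) * (w y - \<rho> * w y))\<bar> \<le> 1 * (c * c + c * c)"
    proof -
      have r1: "\<bar>\<rho> * w y\<bar> \<le> c" using mult_mono[OF \<rho>(2) wc(1)] \<rho> wc by (simp add: abs_mult)
      have "w y - \<rho> * w y = (1 - \<rho>) * w y" by (simp add: algebra_simps)
      then have r2: "\<bar>w y - \<rho> * w y\<bar> \<le> c"
        using mult_mono[of "1 - \<rho>" 1 "w y" c] \<rho> wc by (simp add: abs_mult)
      have "\<bar>F' a * (\<rho> * w y)\<bar> \<le> c * c" "\<bar>F' (W y - a) * (w y - \<rho> * w y)\<bar> \<le> c * c"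
        unfolding abs_mult[of "F' _"] using Fa r1 r2 c by (intro mult_mono; simp)+
      then have "\<bar>F' a * (\<rho> * w y) - F' (W y - a) * (w y - \<rho> * w y)\<bar> \<le> c * c + c * c" by linarith
      then show ?thesis unfolding abs_mult[of "fade _ _ _"] using fade_bounds[of b B "W y"] by (intro mult_mono) auto
    qed
    ultimately show "\<bar>calibration_derivative F F' r b B y a \<rho>\<bar> \<le> max c (c * c * (2 * c) + 1 * (c * c + c * c))"
    proof -
      have eq: "calibration_derivative F F' r b B y a \<rho> =
         - fade_rate b B (W y) * w y * (F a - F (W y - a))
         + fade b B (W y) * (F' a * (\<rho> * w y) - F' (W y - a) * (w y - \<rho> * w y))"
        by (rule calibration_derivative_eq[OF F(1,3,4) a])
      assume "\<bar>- fade_rate b B (W y) * w y * (F a - F (W y - a))\<bar> \<le> c * c * (2 * c)"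
        "\<bar>fade b B (W y) * (F' a * (\<rho> * w y) - F' (W y - a) * (w y - \<rho> * w y))\<bar> \<le> 1 * (c * c + c * c)"
      from add_mono[OF this] show ?thesis
        unfolding eq by (intro max.coboundedI2 order_trans[OF abs_triangle_ineq])
    qed
  next
    show "0 \<le> max c (c * c * (2 * c) + 1 * (c * c + c * c))" using c by linarith
    show "\<bar>F z\<bar> \<le> max c (c * c * (2 * c) + 1 * (c * c + c * c))" "\<bar>F' z\<bar> \<le> max c (c * c * (2 * c) + 1 * (c * c + c * c))"
      if "0 \<le> z" "z \<le> B" for z using cF'[OF that] by linarith+
    show "w y \<le> max c (c * c * (2 * c) + 1 * (c * c + c * c))" if "0 \<le> y" "y \<le> y1" for y using cw[OF that] by linarith
    show "2 / (B - b) \<le> max c (c * c * (2 * c) + 1 * (c * c + c * c))" using c by linarith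
  qed
qed

text \<open>
  Integration by parts cannot be applied to the function \<open>a\<close> belonging to \<open>A\<close> itself, which is only
  Lipschitz. For the smooth densities \<open>\<rho>\<^sub>j\<close> it can: the total derivative of \<open>fade b B (W y) * F (a\<^sub>j y)\<close> has integral zero, and after
  subtracting it the remaining terms with \<open>F'\<close> carry the factors \<open>(1 - \<chi>) \<rho>\<^sub>j\<close> or \<open>\<chi> (1 - \<rho>\<^sub>j)\<close>, with \<open>\<chi>\<close> the
  indicator of \<open>A\<close>, and disappear in the limit.
\<close>

lemma calibration_limit:
  assumes A: "A \<in> sets borel" "A \<subseteq> J" and y1: "y1 \<in> J" "W y1 = B" and b: "b < B"
    and F: "\<And>t. (F has_real_derivative F' t) (at t)" "continuous_on UNIV F'" "0 < r" "\<And>z. z \<le> r \<Longrightarrow> F z = 0"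
    and \<rho>: "\<And>j. continuous_on UNIV (\<rho> j)" "\<And>j t. 0 \<le> t \<Longrightarrow> t \<le> y1 \<Longrightarrow> 0 \<le> \<rho> j t \<and> \<rho> j t \<le> 1"
      "AE t in lborel. 0 \<le> t \<and> t \<le> y1 \<longrightarrow> (\<lambda>j. \<rho> j t) \<longlonglongrightarrow> indicator A t"
    and a: "\<And>j. a j 0 = 0" "\<And>j t. (a j has_real_derivative \<rho> j t * w t) (at t)"
  shows "(\<lambda>j. LINT y|lborel. indicator A y * calibration_derivative F F' r b B y (a j y) (\<rho> j y))
     \<longlonglongrightarrow> calibration_value F b B A"
proof -
  define Q where "Q j y = indicator A y * calibration_derivative F F' r b B y (a j y) (\<rho> j y)
     - (fade b B (W y) * (F' (a j y) * (\<rho> j y * w y)) - fade_rate b B (W y) * w y * F (a j y)) * indicator {0..y1} y" for j y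
  have y1pos: "0 < y1" using J_pos y1 by blast
  have cF: "continuous_on UNIV F"
    using F(1) by (auto intro!: DERIV_isCont continuous_at_imp_continuous_on)
  have ca: "continuous_on UNIV (a j)" for j
    using a(2) by (auto intro!: DERIV_isCont continuous_at_imp_continuous_on)
  have cfW: "continuous_on UNIV (\<lambda>y. fade b B (W y))" "continuous_on UNIV (\<lambda>y. fade_rate b B (W y))"
    by (rule continuous_on_compose2[OF fade_continuous(1)[OF b] W_cont[of UNIV]], simp,
        rule continuous_on_compose2[OF fade_continuous(2)[OF b] W_cont[of UNIV]], simp)
  have csW: "continuous_on UNIV (\<lambda>y. start r (W y))" "continuous_on UNIV (\<lambda>y. start_rate r (W y))"
    by (rule continuous_on_compose2[OF start_continuous(1)[OF F(3)] W_cont[of UNIV]], simp,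
        rule continuous_on_compose2[OF start_continuous(2)[OF F(3)] W_cont[of UNIV]], simp)
  have cFa: "continuous_on UNIV (\<lambda>y. F (a j y))" "continuous_on UNIV (\<lambda>y. F (W y - a j y))"
    "continuous_on UNIV (\<lambda>y. F' (a j y))" "continuous_on UNIV (\<lambda>y. F' (W y - a j y))" for j
    by (intro continuous_on_compose2[OF cF] continuous_on_compose2[OF F(2)] continuous_intros ca W_cont subset_UNIV)+
  have cE: "continuous_on UNIV (\<lambda>y. calibration_derivative F F' r b B y (a j y) (\<rho> j y))" for j
    unfolding calibration_derivative_def
    by (intro continuous_intros cfW csW cFa w_cont \<rho>(1))
  have ar: "0 \<le> a j y" "a j y \<le> W y" if "0 \<le> y" "y \<le> y1" for j y
    using primitive_bounds[OF that(1) a(1) a(2), of j] \<rho>(2) that by auto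
  obtain C where C: "0 \<le> C" "\<And>y a \<rho>. 0 \<le> y \<Longrightarrow> y \<le> y1 \<Longrightarrow> 0 \<le> a \<Longrightarrow> a \<le> W y \<Longrightarrow> 0 \<le> \<rho> \<Longrightarrow> \<rho> \<le> 1 \<Longrightarrow>
     \<bar>calibration_derivative F F' r b B y a \<rho>\<bar> \<le> C"
    "\<And>z. 0 \<le> z \<Longrightarrow> z \<le> B \<Longrightarrow> \<bar>F z\<bar> \<le> C" "\<And>z. 0 \<le> z \<Longrightarrow> z \<le> B \<Longrightarrow> \<bar>F' z\<bar> \<le> C"
    "\<And>y. 0 \<le> y \<Longrightarrow> y \<le> y1 \<Longrightarrow> w y \<le> C" "2 / (B - b) \<le> C"
    using calibration_derivative_bounded[OF y1 b F] by blast
  have WB: "W y \<le> B" if "y \<le> y1" for y using W_mono[OF that] y1 by simp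
  have outside: "fade_rate b B (W y) = 0" "fade b B (W y) = 0" if "y > y1" for y
    using fade_rate_0[OF b] W_mono[of y1 y] that y1 by auto
  have A0: "0 < y" if "y \<in> A" for y using A J_pos that by auto
  have E0: "calibration_derivative F F' r b B y (a j y) (\<rho> j y) = 0" if "y > y1" for j y
    using outside[OF that] by (simp add: calibration_derivative_def)
  have AE_eq: "indicator A y * calibration_derivative F F' r b B y (a j y) (\<rho> j y) =
     indicator A y * calibration_derivative F F' r b B y (a j y) (\<rho> j y) * indicator {0..y1} y" for j y
    using E0[of y j] A0[of y] by (cases "y > y1") (auto simp: indicator_def)
  have [measurable]: "A \<in> sets borel" by fact
  have mE [measurable]: "(\<lambda>y. calibration_derivative F F' r b B y (a j y) (\<rho> j y)) \<in> borel_measurable borel" for j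
    by (rule borel_measurable_continuous_onI[OF cE])
  \<comment> \<open>The total derivative of \<open>fade b B (W y) * F (a j y)\<close>.\<close>
  define X where "X j y = fade b B (W y) * (F' (a j y) * (\<rho> j y * w y)) - fade_rate b B (W y) * w y * F (a j y)" for j y
  have cX: "continuous_on UNIV (X j)" for j unfolding X_def
    by (intro continuous_intros cfW cFa w_cont \<rho>(1))
  have iX: "integrable lborel (\<lambda>y. X j y * indicator {0..y1} y)" for j
    using borel_integrable_atLeastAtMost[of 0 y1 "X j"] cX[of j] by (simp add: continuous_on_eq_continuous_at)
  have "integrable lborel (\<lambda>y. C * indicator {0..y1} y)" by (simp add: emeasure_lborel_Icc_eq)
  then have iE: "integrable lborel (\<lambda>y. indicator A y * calibration_derivative F F' r b B y (a j y) (\<rho> j y))" for j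
  proof (rule Bochner_Integration.integrable_bound)
    show "AE y in lborel. norm (indicator A y * calibration_derivative F F' r b B y (a j y) (\<rho> j y))
       \<le> norm (C * indicator {0..y1} y)"
      using C(2)[OF _ _ ar] \<rho>(2) C(1) by (subst AE_eq) (auto simp: indicator_def)
  qed measurable
  have X0: "(LINT y|lborel. X j y * indicator {0..y1} y) = 0" for j
  proof -
    have d: "((\<lambda>y. fade b B (W y) * F (a j y)) has_real_derivative X j y) (at y)" for y
      unfolding X_def
      by (rule derivative_eq_intros DERIV_chain2[OF fade_has_derivative W_deriv] DERIV_chain2[OF F(1) a(2)])+
        (simp add: algebra_simps)
    have "(LINT y|lborel. X j y * indicator {0..y1} y) = fade b B (W y1) * F (a j y1) - fade b B (W 0) * F (a j 0)"
      by (rule integral_FTC_Icc_real[OF less_imp_le[OF y1pos] d])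
        (use cX[of j] in \<open>simp add: continuous_on_eq_continuous_at\<close>)
    then show ?thesis using a(1) F(3,4) fade_rate_0(3)[OF b] y1 by simp
  qed
  have LQ: "(LINT y|lborel. indicator A y * calibration_derivative F F' r b B y (a j y) (\<rho> j y)) = (LINT y|lborel. Q j y)" for j
    unfolding Q_def X_def[symmetric] using iE[of j] iX[of j] X0[of j] by simp
  have h_lim: "(\<lambda>j. a j y) \<longlonglongrightarrow> partial_height A y" if y: "0 \<le> y" "y \<le> y1" for y
  proof -
    have eq: "a j y = (LINT t|lborel. \<rho> j t * w t * indicator {0..y} t)" for j
      using integral_FTC_Icc_real[OF y(1) a(2)] a(1)[of j] continuous_on_mult[OF \<rho>(1) w_cont]
      by (simp add: continuous_on_eq_continuous_at)
    have [measurable]: "\<rho> j \<in> borel_measurable borel" "w \<in> borel_measurable borel" for j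
      by (rule borel_measurable_continuous_onI[OF \<rho>(1)], rule borel_measurable_continuous_onI[OF w_cont])
    show ?thesis
      unfolding eq partial_height_def
    proof (rule integral_dominated_convergence[where w = "\<lambda>t. w t * indicator {0..y1} t"])
      show "integrable lborel (\<lambda>t. w t * indicator {0..y1} t)"
        using borel_integrable_atLeastAtMost[of 0 y1 w] w_cont by (simp add: continuous_on_eq_continuous_at)
      show "AE t in lborel. (\<lambda>j. \<rho> j t * w t * indicator {0..y} t) \<longlonglongrightarrow> indicator A t * w t * indicator {0..y} t"
        using \<rho>(3)
      proof eventually_elim
        case (elim t)
        show ?case
        proof (cases "t \<in> {0..y}")
          case True
          then have "(\<lambda>j. \<rho> j t) \<longlonglongrightarrow> indicator A t" using elim y by auto
          then show ?thesis by (intro tendsto_mult tendsto_const)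
        qed simp
      qed
      show "AE t in lborel. norm (\<rho> j t * w t * indicator {0..y} t) \<le> w t * indicator {0..y1} t" for j
        using \<rho>(2)[of _ j] w_nonneg y by (intro AE_I2) (auto simp: indicator_def abs_mult mult_left_le_one_le)
    qed measurable
  qed
  have Qeq: "Q j y = indicator {0..y1} y *
     (fade_rate b B (W y) * w y * (F (a j y) - indicator A y * (F (a j y) - F (W y - a j y)))
      + (indicator A y - 1) * \<rho> j y * (fade b B (W y) * F' (a j y) * w y)
      - indicator A y * (1 - \<rho> j y) * (fade b B (W y) * F' (W y - a j y) * w y))" for j y
  proof (cases "y \<in> {0..y1}")
    case True
    then show ?thesis
      unfolding Q_def by (simp add: calibration_derivative_eq[OF F(1,3,4) ar] algebra_simps)
  next
    case False
    then have "indicator A y * calibration_derivative F F' r b B y (a j y) (\<rho> j y) = 0"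
      by (subst AE_eq) simp
    then show ?thesis using False by (simp add: Q_def)
  qed
  have "(\<lambda>j. LINT y|lborel. Q j y) \<longlonglongrightarrow> (LINT y|lborel. fade_rate b B (W y) * w y *
        (indicator A y * F (W y - partial_height A y) + (1 - indicator A y) * F (partial_height A y)))"
  proof (rule integral_dominated_convergence[where w = "\<lambda>y. (C + (C * C + C * C * C)) * indicator {0..y1} y"])
    show "integrable lborel (\<lambda>y. (C + (C * C + C * C * C)) * indicator {0..y1} y)" by (simp add: emeasure_lborel_Icc_eq)
    show "AE y in lborel. norm (Q j y) \<le> (C + (C * C + C * C * C)) * indicator {0..y1} y" for j
    proof (rule AE_I2)
      fix y
      show "norm (Q j y) \<le> (C + (C * C + C * C * C)) * indicator {0..y1} y"
      proof (cases "y \<in> {0..y1}")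
        case True
        then have y: "0 \<le> y" "y \<le> y1" by auto
        note aa = ar[OF y, of j]
        have "\<bar>indicator A y * calibration_derivative F F' r b B y (a j y) (\<rho> j y)\<bar> \<le> C"
          using C(2)[OF y aa] \<rho>(2)[OF y, of j] C(1) by (simp add: indicator_def)
        moreover have "\<bar>X j y\<bar> \<le> C * C + C * C * C"
        proof -
          have 1: "\<bar>\<rho> j y * w y\<bar> \<le> 1 * C" unfolding abs_mult using \<rho>(2)[OF y, of j] C(5)[OF y] w_nonneg[of y] C(1)
            by (intro mult_mono) auto
          have Fa: "\<bar>F' (a j y)\<bar> \<le> C" "\<bar>F (a j y)\<bar> \<le> C"
            using C(3,4)[of "a j y"] aa WB[OF y(2)] by auto
          have "\<bar>F' (a j y) * (\<rho> j y * w y)\<bar> \<le> C * C"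
            unfolding abs_mult[of "F' _"] using 1 Fa C(1) by (intro mult_mono) auto
          then have "\<bar>fade b B (W y) * (F' (a j y) * (\<rho> j y * w y))\<bar> \<le> 1 * (C * C)"
            unfolding abs_mult[of "fade _ _ _"] using fade_bounds[of b B "W y"] by (intro mult_mono) auto
          moreover have "\<bar>fade_rate b B (W y) * w y * F (a j y)\<bar> \<le> C * C * C"
            unfolding abs_mult using fade_rate_bounds[OF b, of "W y"] C(6) C(5)[OF y] w_nonneg[of y] Fa C(1)
            by (intro mult_mono) auto
          ultimately show ?thesis unfolding X_def by linarith
        qed
        ultimately show ?thesis using True unfolding Q_def X_def[symmetric] by simp
      next
        case False then show ?thesis by (simp add: Qeq)
      qed
    qed
    show "AE y in lborel. (\<lambda>j. Q j y) \<longlonglongrightarrow> fade_rate b B (W y) * w y *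
        (indicator A y * F (W y - partial_height A y) + (1 - indicator A y) * F (partial_height A y))"
      using \<rho>(3)
    proof eventually_elim
      case (elim y)
      show ?case
      proof (cases "y \<in> {0..y1}")
        case True
        then have y: "0 \<le> y" "y \<le> y1" by auto
        define h where "h = partial_height A y"
        have r: "(\<lambda>j. \<rho> j y) \<longlonglongrightarrow> indicator A y" using elim y by blast
        have al: "(\<lambda>j. a j y) \<longlonglongrightarrow> h" unfolding h_def by (rule h_lim[OF y])
        have Fl: "(\<lambda>j. F (a j y)) \<longlonglongrightarrow> F h" "(\<lambda>j. F (W y - a j y)) \<longlonglongrightarrow> F (W y - h)"
          "(\<lambda>j. F' (a j y)) \<longlonglongrightarrow> F' h" "(\<lambda>j. F' (W y - a j y)) \<longlonglongrightarrow> F' (W y - h)"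
          by (rule continuous_on_tendsto_compose[OF cF] continuous_on_tendsto_compose[OF F(2)];
              (intro tendsto_diff tendsto_const al)?; simp)+
        have "(\<lambda>j. Q j y) \<longlonglongrightarrow> indicator {0..y1} y *
           (fade_rate b B (W y) * w y * (F h - indicator A y * (F h - F (W y - h)))
            + (indicator A y - 1) * indicator A y * (fade b B (W y) * F' h * w y)
            - indicator A y * (1 - indicator A y) * (fade b B (W y) * F' (W y - h) * w y))"
          unfolding Qeq by (intro tendsto_add tendsto_diff tendsto_mult tendsto_const r Fl)
        then show ?thesis using True unfolding h_def by (cases "y \<in> A") auto
      next
        case False
        then have "fade_rate b B (W y) * w y = 0 \<or> y < 0" using outside[of y] by auto
        moreover have "fade_rate b B (W y) = 0 \<or> F (partial_height A y) = 0" if "y < 0"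
          using that F(3,4) by (simp add: partial_height_def)
        moreover have "indicator A y = (0::real)" if "y < 0" using A0[of y] that by (auto simp: indicator_def)
        ultimately show ?thesis using False by (auto simp: Qeq)
      qed
    qed
    show "Q j \<in> borel_measurable lborel" for j
      unfolding Q_def X_def[symmetric] using borel_measurable_integrable[OF iX[of j]] by simp
    note [measurable] = partial_height_measurable[OF A(1)]
    have [measurable]: "F \<in> borel_measurable borel" "W \<in> borel_measurable borel" "w \<in> borel_measurable borel"
      "(\<lambda>y. fade_rate b B (W y)) \<in> borel_measurable borel"
      by (rule borel_measurable_continuous_onI, rule cF W_cont w_cont cfW)+
    show "(\<lambda>y. fade_rate b B (W y) * w y *
        (indicator A y * F (W y - partial_height A y) + (1 - indicator A y) * F (partial_height A y))) \<in> borel_measurable lborel"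
      by measurable
  qed
  then show ?thesis unfolding LQ calibration_value_def .
qed

end

context calibrated_weight begin

lemma partial_height_bounds:
  assumes A: "A \<in> sets borel" "A \<subseteq> J" and int: "integrable lborel (\<lambda>t. indicator A t * w t)"
    and m: "m = (LINT t|lborel. indicator A t * w t)" and y: "0 \<le> y"
  shows "0 \<le> partial_height A y" "partial_height A y \<le> m" "partial_height A y \<le> W y"
    "b \<le> W y \<Longrightarrow> (LINT t|lborel. indicator A t * w t * indicator {t. W t \<le> b} t) \<le> partial_height A y"
proof -
  have [measurable]: "A \<in> sets borel" "W \<in> borel_measurable borel" "w \<in> borel_measurable borel"
    using A borel_measurable_continuous_onI[OF W_cont] borel_measurable_continuous_onI[OF w_cont] by auto
  have i1: "integrable lborel (\<lambda>t. indicator A t * w t * indicator {0..y} t)"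
    by (rule Bochner_Integration.integrable_bound[OF int]) (auto simp: indicator_def)
  have i2: "integrable lborel (\<lambda>t. indicator A t * w t * indicator {t. W t \<le> b} t)"
    by (rule Bochner_Integration.integrable_bound[OF int]) (auto simp: indicator_def)
  show "0 \<le> partial_height A y"
    unfolding partial_height_def using w_nonneg by (intro Bochner_Integration.integral_nonneg) (auto simp: indicator_def)
  show "partial_height A y \<le> m"
    unfolding partial_height_def m using w_nonneg by (intro integral_mono[OF i1 int]) (auto simp: indicator_def)
  have "W y - W 0 = (LINT t|lborel. w t * indicator {0..y} t)"
    by (rule integral_FTC_Icc_real[OF y W_deriv, symmetric]) (use w_cont in \<open>simp add: continuous_on_eq_continuous_at\<close>)
  moreover have "partial_height A y \<le> (LINT t|lborel. w t * indicator {0..y} t)"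
    unfolding partial_height_def
  proof (rule integral_mono[OF i1])
    show "integrable lborel (\<lambda>t. w t * indicator {0..y} t)"
      using borel_integrable_atLeastAtMost[of 0 y w] w_cont by (simp add: continuous_on_eq_continuous_at)
  qed (use w_nonneg in \<open>auto simp: indicator_def\<close>)
  ultimately show "partial_height A y \<le> W y" by (simp add: W_0)
  show "(LINT t|lborel. indicator A t * w t * indicator {t. W t \<le> b} t) \<le> partial_height A y" if b: "b \<le> W y"
    unfolding partial_height_def
  proof (rule integral_mono[OF i2 i1])
    fix t
    have "t \<in> {0..y}" if "t \<in> A" "W t \<le> b"
    proof -
      have tJ: "t \<in> J" using that A by auto
      then have "\<not> y < t" using W_strict_mono[OF tJ y] that b by auto
      then show ?thesis using J_pos[OF tJ] by auto
    qed
    then show "indicator A t * w t * indicator {t. W t \<le> b} t \<le> indicator A t * w t * indicator {0..y} t"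
      using w_nonneg by (auto simp: indicator_def)
  qed
qed

text \<open>
  Total mass one is what turns \<open>calibration_value\<close> into an average.
\<close>

lemma fade_total:
  assumes y1: "y1 \<in> J" "W y1 = B" and b: "0 \<le> b" "b < B"
  shows "integrable lborel (\<lambda>y. fade_rate b B (W y) * w y)" "(LINT y|lborel. fade_rate b B (W y) * w y) = 1"
proof -
  have eq: "fade_rate b B (W y) * w y = fade_rate b B (W y) * w y * indicator {0..y1} y" for y
  proof (cases "y \<in> {0..y1}")
    case False
    then have "W y \<le> b \<or> B \<le> W y" using W_mono[of y 0] W_0 b W_mono[of y1 y] y1 by auto
    then show ?thesis using fade_rate_0[OF b(2)] by auto
  qed simp
  have c: "continuous_on UNIV (\<lambda>y. fade_rate b B (W y) * w y)"
    by (intro continuous_intros w_cont continuous_on_compose2[OF fade_continuous(2)[OF b(2)] W_cont[of UNIV]]) simp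
  show "integrable lborel (\<lambda>y. fade_rate b B (W y) * w y)"
    by (subst eq) (use borel_integrable_atLeastAtMost[of 0 y1 "\<lambda>y. fade_rate b B (W y) * w y"] c in
      \<open>simp add: continuous_on_eq_continuous_at\<close>)
  have d: "((\<lambda>y. - fade b B (W y)) has_real_derivative fade_rate b B (W y) * w y) (at y)" for y
    using DERIV_minus[OF DERIV_chain2[OF fade_has_derivative W_deriv]] by simp
  have "(LINT y|lborel. fade_rate b B (W y) * w y * indicator {0..y1} y) = - fade b B (W y1) - - fade b B (W 0)"
    by (rule integral_FTC_Icc_real[OF _ d]) (use J_pos[OF y1(1)] c in \<open>auto simp: continuous_on_eq_continuous_at\<close>)
  then show "(LINT y|lborel. fade_rate b B (W y) * w y) = 1"
    using fade_rate_0(3)[OF b(2), of B] fade_rate_0(4)[OF b(2), of 0] b y1 W_0 by (subst eq) simp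
qed

lemma calibration_integrable:
  assumes A: "A \<in> sets borel" "A \<subseteq> J" and int: "integrable lborel (\<lambda>t. indicator A t * w t)"
    and y1: "y1 \<in> J" "W y1 = B" and b: "0 \<le> b" "b < B"
    and F: "continuous_on UNIV F" "\<And>z. 0 \<le> z \<Longrightarrow> z \<le> B \<Longrightarrow> \<bar>F z\<bar> \<le> C"
  shows "integrable lborel (\<lambda>y. fade_rate b B (W y) * w y *
        (indicator A y * F (W y - partial_height A y) + (1 - indicator A y) * F (partial_height A y)))"
    "\<bar>calibration_value F b B A\<bar> \<le> C"
proof -
  have [measurable]: "A \<in> sets borel" "W \<in> borel_measurable borel" "w \<in> borel_measurable borel"
    "F \<in> borel_measurable borel" "fade_rate b B \<in> borel_measurable borel"
    "partial_height A \<in> borel_measurable borel"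
    using A borel_measurable_continuous_onI[OF W_cont] borel_measurable_continuous_onI[OF w_cont]
      borel_measurable_continuous_onI[OF F(1)] borel_measurable_continuous_onI[OF fade_continuous(2)[OF b(2)]]
      partial_height_measurable by auto
  define E where "E y = fade_rate b B (W y) * w y *
        (indicator A y * F (W y - partial_height A y) + (1 - indicator A y) * F (partial_height A y))" for y
  have C: "0 \<le> C" using F(2)[of 0] b by simp
  have bd: "\<bar>E y\<bar> \<le> C * (fade_rate b B (W y) * w y)" for y
  proof (cases "fade_rate b B (W y) = 0")
    case False
    then have W: "b < W y" "W y < B"
      using fade_rate_0[OF b(2), of "W y"] by (meson not_le)+
    then have y: "0 \<le> y" using W_mono[of y 0] W_0 b by force
    note h = partial_height_bounds(1,3)[OF A int refl y]
    have "\<bar>indicator A y * F (W y - partial_height A y) + (1 - indicator A y) * F (partial_height A y)\<bar> \<le> C"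
      using h W F(2)[of "W y - partial_height A y"] F(2)[of "partial_height A y"] by (simp add: indicator_def)
    then show ?thesis
      unfolding E_def abs_mult[of "fade_rate _ _ _ * _"]
      using fade_rate_bounds[OF b(2), of "W y"] w_nonneg[of y]
      by (simp add: abs_mult mult.commute[of C] mult_left_mono)
  qed (simp add: E_def)
  have k0: "0 \<le> fade_rate b B (W y) * w y" for y
    using fade_rate_bounds[OF b(2), of "W y"] w_nonneg[of y] by simp
  have iE: "integrable lborel E"
  proof (rule Bochner_Integration.integrable_bound)
    show "integrable lborel (\<lambda>y. C * (fade_rate b B (W y) * w y))" using fade_total(1)[OF y1 b] by simp
    show "AE y in lborel. norm (E y) \<le> norm (C * (fade_rate b B (W y) * w y))"
      using bd by (intro AE_I2) (metis abs_ge_self order_trans real_norm_def)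
    show "E \<in> borel_measurable lborel" unfolding E_def by measurable
  qed
  then show "integrable lborel (\<lambda>y. fade_rate b B (W y) * w y *
        (indicator A y * F (W y - partial_height A y) + (1 - indicator A y) * F (partial_height A y)))"
    unfolding E_def .
  have "\<bar>calibration_value F b B A\<bar> \<le> (LINT y|lborel. \<bar>E y\<bar>)"
    unfolding calibration_value_def E_def[symmetric] using integral_norm_bound[of lborel E] by simp
  also have "\<dots> \<le> (LINT y|lborel. C * (fade_rate b B (W y) * w y))"
    using iE fade_total(1)[OF y1 b] bd by (intro integral_mono) auto
  also have "\<dots> = C" using fade_total(2)[OF y1 b] by simp
  finally show "\<bar>calibration_value F b B A\<bar> \<le> C" .
qed

text \<open>
  In the fading zone \<open>partial_height A y\<close> is close to \<open>m\<close>, so points outside \<open>A\<close> contribute about \<open>f(m)\<close>. For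
  infinite \<open>\<alpha>\<close> the points of \<open>A\<close> carry a vanishing share of the average, since \<open>A\<close> has finite measure and the
  fading slope tends to zero. For finite \<open>\<alpha>\<close> they contribute about \<open>f(\<alpha> - m) = f(m)\<close>.
\<close>

lemma calibration_value_tendsto:
  assumes A: "A \<in> sets borel" "A \<subseteq> J" and int: "integrable lborel (\<lambda>t. indicator A t * w t)"
    and m: "m = (LINT t|lborel. indicator A t * w t)" "0 < m" "ereal m < \<alpha>" and C: "0 < C"
    and b: "\<And>i. 0 < b i" "\<And>i. b i < B i" "\<And>i. ereal (B i) < \<alpha>"
      "\<And>z. ereal z < \<alpha> \<Longrightarrow> eventually (\<lambda>i. z < b i) sequentially"
      "\<And>i. \<alpha> = \<infinity> \<Longrightarrow> B i - b i = Suc i"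
    and y1: "\<And>i. y1 i \<in> J" "\<And>i. W (y1 i) = B i"
    and F: "\<And>i. continuous_on UNIV (F i)" "\<And>i z. 0 \<le> z \<Longrightarrow> z \<le> B i \<Longrightarrow> \<bar>F i z\<bar> \<le> C + 1"
      "\<And>i z. e i \<le> z \<Longrightarrow> z \<le> B i \<Longrightarrow> \<bar>F i z - min (f z) C\<bar> \<le> e i" and e: "e \<longlonglongrightarrow> 0"
  shows "(\<lambda>i. calibration_value (F i) (b i) (B i) A) \<longlonglongrightarrow> min (f m) C"
proof (rule LIMSEQ_I)
  define g where "g z = min (f z) C" for z
  fix \<epsilon> :: real assume \<epsilon>: "\<epsilon> > 0"
  define \<epsilon>' where "\<epsilon>' = \<epsilon> / 4"
  have \<epsilon>': "\<epsilon>' > 0" using \<epsilon> by (simp add: \<epsilon>'_def)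
  have g_cont: "isCont g z" if "0 < z" "ereal z < \<alpha>" for z
  proof -
    have o: "open {z. 0 < z \<and> ereal z < \<alpha>}"
      by (intro open_Collect_conj open_Collect_less continuous_intros continuous_on_ereal)
    have "continuous_on {z. 0 < z \<and> ereal z < \<alpha>} g"
      unfolding g_def by (intro continuous_intros continuous_on_subset[OF f_cont]) auto
    then show ?thesis using o that by (simp add: continuous_on_eq_continuous_at)
  qed
  have gC: "\<bar>g m\<bar> \<le> C" using f_nonneg[of m] m C by (simp add: g_def)
  \<comment> \<open>A lower bound for \<open>partial_height A\<close> throughout the fading zone.\<close>
  define \<mu> where "\<mu> i = (LINT t|lborel. indicator A t * w t * indicator {t. W t \<le> b i} t)" for i
  have [measurable]: "A \<in> sets borel" "W \<in> borel_measurable borel" "w \<in> borel_measurable borel"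
    using A borel_measurable_continuous_onI[OF W_cont] borel_measurable_continuous_onI[OF w_cont] by auto
  have \<mu>: "\<mu> \<longlonglongrightarrow> m"
    unfolding \<mu>_def m(1)
  proof (rule integral_dominated_convergence[OF _ _ int])
    show "AE t in lborel. (\<lambda>i. indicator A t * w t * indicator {t. W t \<le> b i} t) \<longlonglongrightarrow> indicator A t * w t"
    proof (rule AE_I2)
      fix t show "(\<lambda>i. indicator A t * w t * indicator {t. W t \<le> b i} t) \<longlonglongrightarrow> indicator A t * w t"
      proof (cases "t \<in> A")
        case True
        then have "ereal (W t) < \<alpha>" using A W_less by blast
        from b(4)[OF this] have "eventually (\<lambda>i. indicator A t * w t * indicator {t. W t \<le> b i} t = indicator A t * w t) sequentially"
          by eventually_elim simp
        then show ?thesis by (rule tendsto_eventually)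
      qed simp
    qed
  qed (use w_nonneg in \<open>auto simp: indicator_def\<close>)
  have near: "\<exists>\<delta>>0. \<delta> < z \<and> (\<forall>x. \<bar>x - z\<bar> \<le> \<delta> \<longrightarrow> \<bar>g x - g z\<bar> \<le> \<epsilon>')" if z: "0 < z" "ereal z < \<alpha>" for z
  proof -
    obtain d where d: "d > 0" "\<And>x. \<bar>x - z\<bar> < d \<Longrightarrow> \<bar>g x - g z\<bar> < \<epsilon>'"
      using g_cont[OF z] \<epsilon>' unfolding continuous_at_eps_delta dist_real_def by blast
    show ?thesis
      by (rule exI[of _ "min d z / 2"]) (use d z in \<open>auto intro!: less_imp_le[OF d(2)]\<close>)
  qed
  obtain \<delta> where \<delta>: "\<delta> > 0" "\<delta> < m" "\<And>x. \<bar>x - m\<bar> \<le> \<delta> \<Longrightarrow> \<bar>g x - g m\<bar> \<le> \<epsilon>'"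
    using near[OF m(2,3)] by blast
  \<comment> \<open>Bounds the share of the average carried by the points of \<open>A\<close> in the infinite case; in the finite case these points are treated like the others.\<close>
  define q where "q i = (if \<alpha> = \<infinity> then (2 * C + 1) * (2 / real (Suc i)) else 0)" for i
  have q0: "q \<longlonglongrightarrow> 0"
  proof (cases "\<alpha> = \<infinity>")
    case True
    have "(\<lambda>i. (2 * C + 1) * (2 * (1 / real (Suc i)))) \<longlonglongrightarrow> (2 * C + 1) * (2 * 0)"
      by (intro tendsto_mult tendsto_const) (use LIMSEQ_inverse_real_of_nat in \<open>simp add: inverse_eq_divide\<close>)
    then show ?thesis using True by (simp add: q_def[abs_def])
  qed (simp add: q_def[abs_def])
  define good where "good i \<longleftrightarrow> (\<forall>y. fade_rate (b i) (B i) (W y) \<noteq> 0 \<longrightarrow>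
      \<bar>F i (partial_height A y) - g m\<bar> \<le> 2 * \<epsilon>' \<and>
      (\<alpha> < \<infinity> \<longrightarrow> \<bar>F i (W y - partial_height A y) - g m\<bar> \<le> 2 * \<epsilon>'))" for i
  have support: "0 \<le> y \<and> b i < W y \<and> W y < B i" if "fade_rate (b i) (B i) (W y) \<noteq> 0" for i y
  proof -
    have "b i < W y" "W y < B i" using that fade_rate_0[OF b(2)[of i], of "W y"] by (meson not_le)+
    then show ?thesis using W_mono[of y 0] W_0 b(1)[of i] by force
  qed
  have ev1: "eventually (\<lambda>i. m - \<delta> < \<mu> i \<and> e i < m - \<delta> \<and> e i < \<epsilon>') sequentially"
    using order_tendstoD(1)[OF \<mu>, of "m - \<delta>"] order_tendstoD(2)[OF e, of "m - \<delta>"] order_tendstoD(2)[OF e \<epsilon>'] \<delta>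
    by (auto intro: eventually_conj)
  have first: "\<bar>F i (partial_height A y) - g m\<bar> \<le> 2 * \<epsilon>'"
    if i: "m - \<delta> < \<mu> i" "e i < m - \<delta>" "e i < \<epsilon>'" and y: "0 \<le> y" "b i < W y" "W y < B i" for i y
  proof -
    note h = partial_height_bounds[OF A int m(1) y(1)]
    have "\<mu> i \<le> partial_height A y" unfolding \<mu>_def using h(4) y by simp
    then have "\<bar>partial_height A y - m\<bar> \<le> \<delta>" "e i \<le> partial_height A y" "partial_height A y \<le> B i"
      using h i y by auto
    then show ?thesis using \<delta>(3)[of "partial_height A y"] F(3)[of i "partial_height A y"] i unfolding g_def by linarith
  qed
  have "eventually good sequentially"
  proof (cases "\<alpha> = \<infinity>")
    case True
    show ?thesis using ev1
    proof eventually_elim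
      case (elim i)
      then show ?case unfolding good_def using first[of i] support True by auto
    qed
  next
    case False
    then obtain c where c: "\<alpha> = ereal c" using \<alpha>_pos by (cases \<alpha>) auto
    have cm: "0 < c - m" "ereal (c - m) < \<alpha>" using m c by auto
    obtain \<delta>2 where \<delta>2: "\<delta>2 > 0" "\<delta>2 < c - m" "\<And>x. \<bar>x - (c - m)\<bar> \<le> \<delta>2 \<Longrightarrow> \<bar>g x - g (c - m)\<bar> \<le> \<epsilon>'"
      using near[OF cm] by blast
    have gs: "g (c - m) = g m" using f_symmetric[of m] m c by (simp add: g_def)
    have ev2: "eventually (\<lambda>i. m - \<delta>2 < \<mu> i \<and> e i < c - m - \<delta>2 \<and> c - \<delta>2 < b i) sequentially"
      using order_tendstoD(1)[OF \<mu>, of "m - \<delta>2"] order_tendstoD(2)[OF e, of "c - m - \<delta>2"] b(4)[of "c - \<delta>2"] \<delta>2 c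
      by (auto intro: eventually_conj)
    show ?thesis using ev1 ev2
    proof eventually_elim
      case (elim i)
      have "\<bar>F i (W y - partial_height A y) - g m\<bar> \<le> 2 * \<epsilon>'" if y: "0 \<le> y" "b i < W y" "W y < B i" for y
      proof -
        note h = partial_height_bounds[OF A int m(1) y(1)]
        have "\<mu> i \<le> partial_height A y" unfolding \<mu>_def using h(4) y by simp
        then have "\<bar>W y - partial_height A y - (c - m)\<bar> \<le> \<delta>2" "e i \<le> W y - partial_height A y"
          "W y - partial_height A y \<le> B i"
          using h elim y b(3)[of i] c by auto
        then show ?thesis using \<delta>2(3)[of "W y - partial_height A y"] F(3)[of i "W y - partial_height A y"] elim gs
          unfolding g_def by linarith
      qed
      then show ?case unfolding good_def using first[of i] support elim by auto
    qed
  qed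
  moreover have "eventually (\<lambda>i. q i < \<epsilon>' / (m + 1)) sequentially"
    using m \<epsilon>' by (intro order_tendstoD(2)[OF q0]) auto
  ultimately have "eventually (\<lambda>i. \<bar>calibration_value (F i) (b i) (B i) A - g m\<bar> < \<epsilon>) sequentially"
  proof eventually_elim
    case (elim i)
    define k where "k y = fade_rate (b i) (B i) (W y) * w y" for y
    define E where "E y = k y * (indicator A y * F i (W y - partial_height A y) + (1 - indicator A y) * F i (partial_height A y))" for y
    have k: "0 \<le> k y" for y using fade_rate_bounds[OF b(2)[of i], of "W y"] w_nonneg[of y] by (simp add: k_def)
    note kt = fade_total[OF y1(1)[of i] y1(2)[of i] less_imp_le[OF b(1)[of i]] b(2)[of i]]
    have ik: "integrable lborel k" "(LINT y|lborel. k y) = 1" using kt unfolding k_def by auto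
    have iE: "integrable lborel E"
      using calibration_integrable(1)[OF A int y1(1)[of i] y1(2)[of i] less_imp_le[OF b(1)[of i]] b(2)[of i] F(1)[of i] F(2)[of _ i]] unfolding E_def k_def .
    have q: "0 \<le> q i" using C by (simp add: q_def)
    have bd: "\<bar>E y - k y * g m\<bar> \<le> 2 * \<epsilon>' * k y + q i * (indicator A y * w y)" for y
    proof (cases "fade_rate (b i) (B i) (W y) = 0")
      case True
      then show ?thesis using q w_nonneg[of y] by (simp add: E_def k_def)
    next
      case False
      note s = support[OF False]
      have G: "\<bar>F i (partial_height A y) - g m\<bar> \<le> 2 * \<epsilon>'"
        "\<alpha> < \<infinity> \<Longrightarrow> \<bar>F i (W y - partial_height A y) - g m\<bar> \<le> 2 * \<epsilon>'"
        using elim(1) False unfolding good_def by blast+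
      show ?thesis
      proof (cases "y \<in> A \<and> \<alpha> = \<infinity>")
        case True
        note h = partial_height_bounds[OF A int m(1), of y]
        have "\<bar>F i (W y - partial_height A y)\<bar> \<le> C + 1" using h s by (intro F(2)) auto
        then have 1: "\<bar>F i (W y - partial_height A y) - g m\<bar> \<le> 2 * C + 1" using gC by linarith
        have 2: "k y \<le> 2 / real (Suc i) * w y"
          unfolding k_def using fade_rate_bounds(2)[OF b(2)[of i], of "W y"] b(5)[of i] True w_nonneg[of y]
          by (intro mult_right_mono) auto
        have "\<bar>E y - k y * g m\<bar> = k y * \<bar>F i (W y - partial_height A y) - g m\<bar>"
          using True k[of y] by (simp add: E_def abs_mult flip: right_diff_distrib)
        also have "\<dots> \<le> (2 / real (Suc i) * w y) * (2 * C + 1)"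
          using 1 2 k[of y] C w_nonneg[of y] by (intro mult_mono) auto
        also have "\<dots> = q i * (indicator A y * w y)" using True by (simp add: q_def)
        finally show ?thesis using k[of y] \<epsilon>' by (simp add: add_increasing)
      next
        case F: False
        then have "\<bar>(indicator A y * F i (W y - partial_height A y) + (1 - indicator A y) * F i (partial_height A y)) - g m\<bar> \<le> 2 * \<epsilon>'"
          using G \<alpha>_pos by (cases "y \<in> A") (auto simp: less_top[symmetric])
        from mult_left_mono[OF this k[of y]] have "\<bar>E y - k y * g m\<bar> \<le> k y * (2 * \<epsilon>')"
          using k[of y] by (simp add: E_def abs_mult flip: right_diff_distrib)
        moreover have "0 \<le> q i * (indicator A y * w y)" using q w_nonneg[of y] by simp
        ultimately show ?thesis by (simp add: mult.commute)
      qed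
    qed
    have "\<bar>calibration_value (F i) (b i) (B i) A - g m\<bar> = \<bar>LINT y|lborel. E y - k y * g m\<bar>"
    proof -
      have "calibration_value (F i) (b i) (B i) A = (LINT y|lborel. E y)"
        by (simp add: calibration_value_def E_def k_def)
      then show ?thesis using iE ik by simp
    qed
    also have "\<dots> \<le> (LINT y|lborel. \<bar>E y - k y * g m\<bar>)"
      using integral_norm_bound[of lborel "\<lambda>y. E y - k y * g m"] by simp
    also have "\<dots> \<le> (LINT y|lborel. 2 * \<epsilon>' * k y + q i * (indicator A y * w y))"
      using iE ik int bd by (intro integral_mono) auto
    also have "\<dots> = 2 * \<epsilon>' + q i * m" using ik int m(1) by simp
    also have "q i * m \<le> \<epsilon>' / (m + 1) * (m + 1)"
      using elim(2) q m(2) by (intro mult_mono) auto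
    also have "\<dots> = \<epsilon>'" using m(2) by simp
    finally show ?case using \<epsilon> by (simp add: \<epsilon>'_def)
  qed
  then show "\<exists>no. \<forall>i\<ge>no. norm (calibration_value (F i) (b i) (B i) A - min (f m) C) < \<epsilon>"
    unfolding eventually_sequentially g_def by simp
qed

end

section \<open>The vertical density attached to the rearranged boundary\<close>

context comparison_field begin

abbreviation height :: "'a \<Rightarrow> real" where
  "height \<equiv> slice_integral M (\<lambda>p. w (snd p))"

lemma height_measurable: "height \<in> borel_measurable borel"
  by (intro slice_integral_measurable[OF M_borel] borel_measurable_continuous_onI
      continuous_on_compose2[OF w_cont] continuous_intros) auto

text \<open>
  Where \<open>m\<close> is not strictly between \<open>0\<close> and \<open>\<alpha>\<close>, the support of \<open>\<phi>\<close> keeps away from the places charged by \<open>\<tau>'\<close>, so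
  the values of the density there are irrelevant.
\<close>

lemma estimate_cong:
  assumes est: "estimate m S" and meas: "m \<in> borel_measurable borel" "S \<in> borel_measurable borel"
      "S' \<in> borel_measurable borel"
    and \<delta>: "\<And>t. t \<le> 0 \<Longrightarrow> \<tau>' t = 0" "\<And>t. \<delta> \<le> t \<Longrightarrow> \<tau>' t = 0" "ereal (W u + \<delta>) \<le> \<alpha>"
    and eq: "AE x in lborel. x \<in> K \<longrightarrow> 0 < m x \<longrightarrow> ereal (m x) < \<alpha> \<longrightarrow> S x = S' x"
  shows "estimate m S'"
proof -
  have "(LINT p|lborel. \<tau> (m (fst p) - W (snd p)) * divergence \<phi> p
        - \<tau>' (m (fst p) - W (snd p)) * snd (\<phi> p) * (w (snd p) - S (fst p))) =
     (LINT p|lborel. \<tau> (m (fst p) - W (snd p)) * divergence \<phi> p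
        - \<tau>' (m (fst p) - W (snd p)) * snd (\<phi> p) * (w (snd p) - S' (fst p)))"
  proof (rule integral_cong_AE)
    show "AE p in lborel. \<tau> (m (fst p) - W (snd p)) * divergence \<phi> p
        - \<tau>' (m (fst p) - W (snd p)) * snd (\<phi> p) * (w (snd p) - S (fst p)) =
        \<tau> (m (fst p) - W (snd p)) * divergence \<phi> p
        - \<tau>' (m (fst p) - W (snd p)) * snd (\<phi> p) * (w (snd p) - S' (fst p))"
      using AE_lborel_fst[OF eq]
    proof eventually_elim
      case (elim p)
      obtain x y where p: "p = (x, y)" by (cases p)
      consider "\<not> (x \<in> K \<and> y \<in> {l..u})" | "x \<in> K" "y \<in> {l..u}" "m x \<le> 0"
        | "x \<in> K" "y \<in> {l..u}" "\<alpha> \<le> ereal (m x)" | "x \<in> K" "0 < m x" "ereal (m x) < \<alpha>"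
        by (meson not_le)
      then show ?case
      proof cases
        case 1
        then have "\<phi> p = 0" unfolding p by (rule \<phi>_support)
        then show ?thesis by simp
      next
        case 2
        then have "0 < W y" using lu_sub W_pos by blast
        then have "\<tau>' (m x - W y) = 0" using 2 by (intro \<delta>(1)) simp
        then show ?thesis by (simp add: p)
      next
        case 3
        have "ereal (W u + \<delta>) \<le> ereal (m x)" using \<delta>(3) 3(3) by (rule order_trans)
        moreover have "W y \<le> W u" using 3 by (intro W_mono) auto
        ultimately have "\<tau>' (m x - W y) = 0" by (intro \<delta>(2)) simp
        then show ?thesis by (simp add: p)
      next
        case 4
        then show ?thesis using elim by (simp add: p)
      qed
    qed
  qed (use estimate_measurable[OF meas(1,2)] estimate_measurable[OF meas(1,3)] in auto)
  then show ?thesis using est unfolding estimate_def by simp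
qed

text \<open>
  Defining the limit density as a pointwise limit gives its measurability for free.
\<close>

lemma estimate_AE_limit:
  assumes est: "\<And>i. estimate m (S i)"
    and meas: "m \<in> borel_measurable borel" "\<And>i. S i \<in> borel_measurable borel"
    and S: "AE x in lborel. x \<in> K \<longrightarrow> (\<lambda>i. S i x) \<longlonglongrightarrow> L x"
    and B: "\<And>i. AE x in lborel. x \<in> K \<longrightarrow> \<bar>S i x\<bar> \<le> B"
  shows "\<exists>S' \<in> borel_measurable borel. estimate m S' \<and> (AE x in lborel. x \<in> K \<longrightarrow> S' x = L x)"
proof -
  define S' where "S' x = lim (\<lambda>i. S i x)" for x
  have m': "S' \<in> borel_measurable borel"
    unfolding S'_def[abs_def] using meas(2) by (rule borel_measurable_lim_metric)
  have eq: "AE x in lborel. x \<in> K \<longrightarrow> S' x = L x"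
    using S by eventually_elim (auto simp: S'_def limI)
  have "estimate m S'"
  proof (rule estimate_limit[OF est])
    show "AE x in lborel. x \<in> K \<longrightarrow> (\<lambda>i. S i x) \<longlonglongrightarrow> S' x"
      using S eq by eventually_elim simp
  qed (use meas m' B in auto)
  then show ?thesis using m' eq by blast
qed

lemma slice_borel: "{y. (x, y) \<in> M} \<in> sets borel" "{y. (x, y) \<in> M} \<subseteq> J"
proof -
  have "(\<lambda>y. (x, y)) \<in> borel_measurable borel" by (intro borel_measurable_continuous_onI continuous_intros)
  from measurable_sets[OF this M_borel] show "{y. (x, y) \<in> M} \<in> sets borel" by (simp add: vimage_def)
  show "{y. (x, y) \<in> M} \<subseteq> J" using M_sub by auto
qed

text \<open>
  The calibrating fields for smooth densities \<open>\<rho>\<^sub>n\<close> tending to the indicator of \<open>M\<close> are honest \<open>C\<^sup>1\<close> fields in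
  \<open>(x, y)\<close>, because the partial integrals of separable densities are. The bound by \<open>w\<close> is the inequality
  \<open>|F(a) - F(b)| \<le> f(a + b)\<close> with \<open>a + b = W(y)\<close>; it holds for each density with values in the unit interval.
\<close>

lemma estimate_calibrated:
  assumes y1: "y1 \<in> J" "W y1 = B" and b: "0 < b" "b < B"
    and F: "\<And>t. (F has_real_derivative F' t) (at t)" "continuous_on UNIV F'" "0 < r" "\<And>z. z \<le> r \<Longrightarrow> F z = 0"
      "\<And>x y. 0 \<le> x \<Longrightarrow> 0 \<le> y \<Longrightarrow> x + y \<le> B \<Longrightarrow> \<bar>F x - F y\<bar> \<le> f (x + y)"
    and fin: "AE x in lborel. x \<in> \<Omega> \<longrightarrow> integrable lborel (\<lambda>y. indicator M (x, y) * w y)"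
  shows "\<exists>S \<in> borel_measurable borel. estimate height S \<and>
     (AE x in lborel. x \<in> K \<longrightarrow> S x = calibration_value F b B {y. (x, y) \<in> M})"
proof -
  have y1pos: "0 < y1" using J_pos y1 by blast
  have B: "0 < B" using b by simp
  have B\<alpha>: "ereal B < \<alpha>" using W_less[OF y1(1)] y1(2) by simp
  \<comment> \<open>The densities are controlled on a ball containing every slice over the relevant \<open>x\<close> up to height \<open>y1\<close>.\<close>
  define R2 where "R2 = \<bar>R\<bar> + y1"
  have R2: "norm (x, t) \<le> R2" if "norm x \<le> R" "0 \<le> t" "t \<le> y1" for x :: 'a and t
    using norm_Pair_le[of x t] that by (simp add: R2_def)
  obtain \<rho> :: "nat \<Rightarrow> 'a \<times> real \<Rightarrow> real" where \<rho>: "\<And>n. separable (\<rho> n)"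
    "\<And>n p. norm p \<le> R2 \<Longrightarrow> 0 \<le> \<rho> n p \<and> \<rho> n p \<le> 1"
    "AE p in lborel. norm p \<le> R2 \<longrightarrow> (\<lambda>n. \<rho> n p) \<longlonglongrightarrow> indicator M p"
    using indicator_AE_limit_of_separable[OF M_borel, of R2] by blast
  have "\<forall>n. \<exists>A. \<exists>D. C1_deriv A D \<and> (\<forall>x. A (x, 0) = 0) \<and>
    (\<forall>x y. ((\<lambda>y. A (x, y)) has_real_derivative \<rho> n (x, y) * w y) (at y))"
    using separable_primitive[OF \<rho>(1) w_cont] by blast
  then obtain A DA where A: "\<And>n. C1_deriv (A n) (DA n)" "\<And>n x. A n (x, 0) = 0"
    "\<And>n x y. ((\<lambda>y. A n (x, y)) has_real_derivative \<rho> n (x, y) * w y) (at y)" by metis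
  have DA: "DA n (x, y) (0, 1) = \<rho> n (x, y) * w y" for n x y
  proof -
    have "((\<lambda>y. A n (x, y)) has_derivative (\<lambda>h. DA n (x, y) (0, h))) (at y)"
      by (rule has_derivative_compose[OF _ C1_deriv_has_derivative[OF A(1)], where f = "\<lambda>y. (x, y)"])
        (auto intro!: derivative_eq_intros)
    from has_derivative_unique[OF this A(3)[of n x y, unfolded has_field_derivative_def]]
    show ?thesis by (metis mult.right_neutral)
  qed
  have Ab: "0 \<le> A n (x, y)" "A n (x, y) \<le> W y" if "norm x \<le> R" "0 \<le> y" "y \<le> y1" for n x y
  proof -
    have "0 \<le> \<rho> n (x, t) \<and> \<rho> n (x, t) \<le> 1" if "0 \<le> t" "t \<le> y" for t
      using that \<open>y \<le> y1\<close> \<open>norm x \<le> R\<close> by (intro \<rho>(2) R2) auto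
    from primitive_bounds[OF that(2), of "\<lambda>y. A n (x, y)" "\<lambda>t. \<rho> n (x, t)", OF A(2,3) this]
    show "0 \<le> A n (x, y)" "A n (x, y) \<le> W y" by auto
  qed
  define c where "c z = start r z * fade b B z" for z
  define c' where "c' z = start_rate r z * fade b B z - start r z * fade_rate b B z" for z
  have cd: "(c has_real_derivative c' z) (at z)" for z
    unfolding c_def[abs_def] c'_def using start_has_derivative[of r z] fade_has_derivative[of b B z] F(3)
    by (auto intro!: derivative_eq_intros)
  have cc': "continuous_on UNIV c'"
    unfolding c'_def[abs_def] using fade_continuous[OF b(2)] start_continuous[OF F(3)] by (intro continuous_intros)
  define \<sigma> where "\<sigma> n p = c (W (snd p)) * (F (A n p) - F (W (snd p) - A n p))" for n p
  define D\<sigma> where "D\<sigma> n p h = c (W (snd p)) * (DA n p h * F' (A n p) - (snd h * w (snd p) - DA n p h) * F' (W (snd p) - A n p))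
     + (snd h * w (snd p)) * c' (W (snd p)) * (F (A n p) - F (W (snd p) - A n p))" for n p h
  have CW: "C1_deriv (\<lambda>p::'a\<times>real. W (snd p)) (\<lambda>p h. snd h * w (snd p))"
    by (rule C1_deriv_real_compose[OF C1_deriv_bounded_linear[OF bounded_linear_snd] W_deriv w_cont])
  have C\<sigma>: "C1_deriv (\<sigma> n) (D\<sigma> n)" for n
    unfolding \<sigma>_def[abs_def] D\<sigma>_def[abs_def]
    by (intro C1_deriv_mult C1_deriv_diff C1_deriv_real_compose[OF CW cd cc']
        C1_deriv_real_compose[OF A(1) F(1,2)] C1_deriv_real_compose[OF C1_deriv_diff[OF CW A(1)] F(1,2)])
  have D\<sigma>1: "D\<sigma> n (x, y) (0, 1) = calibration_derivative F F' r b B y (A n (x, y)) (\<rho> n (x, y))" for n x y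
    unfolding D\<sigma>_def calibration_derivative_def c_def c'_def by (simp add: DA algebra_simps)
  have "ereal (min (r / 2) (B / 2)) \<le> ereal B" using B by (simp add: min_def)
  then have "ereal (min (r / 2) (B / 2)) < \<alpha>" using B\<alpha> by (rule le_less_trans)
  moreover have "0 < min (r / 2) (B / 2)" using F(3) B by simp
  ultimately obtain y0 where y0: "y0 \<in> J" "W y0 = min (r / 2) (B / 2)"
    using W_surj[of "min (r / 2) (B / 2)"] by blast
  have y0pos: "0 < y0" using J_pos y0 by blast
  have \<sigma>0: "\<sigma> n (x, y) = 0" if "y \<notin> {y0..y1}" for n x y
  proof -
    have "W y \<le> r / 2 \<or> B \<le> W y" using that W_mono[of y y0] W_mono[of y1 y] y0 y1 by auto
    then have "c (W y) = 0" unfolding c_def using start_eq(3)[OF F(3)] fade_rate_0(3)[OF b(2)] by auto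
    then show ?thesis by (simp add: \<sigma>_def)
  qed
  have \<sigma>w: "\<bar>\<sigma> n (x, y)\<bar> \<le> w y" if x: "norm x \<le> R" and y: "y \<in> J" for n x y
  proof (cases "y \<le> y1")
    case True
    have yp: "0 \<le> y" using J_pos[OF y] by simp
    have WB: "W y \<le> B" using W_mono[OF True] y1 by simp
    have "\<bar>F (A n (x, y)) - F (W y - A n (x, y))\<bar> \<le> f (A n (x, y) + (W y - A n (x, y)))"
      using Ab[OF x yp True, of n] WB by (intro F(5)) auto
    also have "\<dots> = w y" using f_W[OF y] by simp
    finally have 1: "\<bar>F (A n (x, y)) - F (W y - A n (x, y))\<bar> \<le> w y" .
    have "\<bar>c (W y)\<bar> \<le> 1" unfolding c_def abs_mult
      using start_bounds[of r "W y"] fade_bounds[of b B "W y"] by (intro mult_le_one) auto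
    then have "\<bar>\<sigma> n (x, y)\<bar> \<le> 1 * w y" unfolding \<sigma>_def abs_mult snd_conv using 1 by (intro mult_mono) auto
    then show ?thesis by simp
  next
    case False
    then show ?thesis using \<sigma>0[of y n x] w_nonneg[of y] by simp
  qed
  define S where "S n = slice_integral M (\<lambda>p. D\<sigma> n p (0, 1))" for n
  have est: "estimate height (S n)" for n
    unfolding S_def by (rule estimate_heights[OF y0pos y1(1) C\<sigma> \<sigma>0 \<sigma>w fin])
  have Sm: "S n \<in> borel_measurable borel" for n
    unfolding S_def by (rule slice_integral_measurable[OF M_borel borel_measurable_continuous_onI[OF C1_deriv_continuous_derivative[OF C\<sigma>]]])
  have Seq: "S n x = (LINT y|lborel. indicator {y. (x, y) \<in> M} y *
      calibration_derivative F F' r b B y (A n (x, y)) (\<rho> n (x, y)))" for n x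
  proof -
    have "indicator M (x, y) = (indicator {y. (x, y) \<in> M} y :: real)" for y by (simp add: indicator_def)
    then show ?thesis unfolding S_def slice_integral_def D\<sigma>1 by (simp only:)
  qed
  obtain C where C: "0 \<le> C" "\<And>y a \<rho>. 0 \<le> y \<Longrightarrow> y \<le> y1 \<Longrightarrow> 0 \<le> a \<Longrightarrow> a \<le> W y \<Longrightarrow> 0 \<le> \<rho> \<Longrightarrow> \<rho> \<le> 1 \<Longrightarrow>
     \<bar>calibration_derivative F F' r b B y a \<rho>\<bar> \<le> C"
    "\<And>z. 0 \<le> z \<Longrightarrow> z \<le> B \<Longrightarrow> \<bar>F z\<bar> \<le> C" "\<And>z. 0 \<le> z \<Longrightarrow> z \<le> B \<Longrightarrow> \<bar>F' z\<bar> \<le> C"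
    "\<And>y. 0 \<le> y \<Longrightarrow> y \<le> y1 \<Longrightarrow> w y \<le> C" "2 / (B - b) \<le> C"
    using calibration_derivative_bounded[OF y1 b(2) F(1-4)] by blast
  have SB: "\<bar>S n x\<bar> \<le> C * y1" if x: "norm x \<le> R" for n x
  proof -
    have bd: "\<bar>indicator {y. (x, y) \<in> M} y * calibration_derivative F F' r b B y (A n (x, y)) (\<rho> n (x, y))\<bar>
        \<le> C * indicator {0..y1} y" for y
    proof (cases "y \<in> {0..y1}")
      case True
      then show ?thesis using C(2)[OF _ _ Ab[OF x]] \<rho>(2)[OF R2[OF x]] C(1) by (auto simp: indicator_def)
    next
      case False
      have "y \<notin> {y. (x, y) \<in> M}" if "y < 0" using slice_borel(2)[of x] J_pos[of y] that by auto
      moreover have "D\<sigma> n (x, y) (0, 1) = 0" if "y1 < y"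
        using fade_rate_0[OF b(2), of "W y"] W_mono[of y1 y] that y1(2) by (simp add: D\<sigma>_def c_def c'_def)
      ultimately show ?thesis using False D\<sigma>1[of n x y] C(1) by (auto simp: indicator_def)
    qed
    have "\<bar>S n x\<bar> \<le> (LINT y|lborel. \<bar>indicator {y. (x, y) \<in> M} y *
      calibration_derivative F F' r b B y (A n (x, y)) (\<rho> n (x, y))\<bar>)"
      unfolding Seq using integral_norm_bound[of lborel "\<lambda>y. indicator {y. (x, y) \<in> M} y *
      calibration_derivative F F' r b B y (A n (x, y)) (\<rho> n (x, y))"] by simp
    also have "\<dots> \<le> (LINT y|lborel. C * indicator {0..y1} y)"
    proof (rule integral_mono')
      show "integrable lborel (\<lambda>y. C * indicator {0..y1} y)" by (simp add: emeasure_lborel_Icc_eq)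
      show "0 \<le> C * indicator {0..y1} y" for y using C(1) by simp
    qed (rule bd)
    also have "\<dots> = C * y1" using y1pos by simp
    finally show ?thesis .
  qed
  have KR: "norm x \<le> R" if "x \<in> K" for x using K_sub \<Omega>_bounded that by blast
  have lim: "AE x in lborel. x \<in> K \<longrightarrow> (\<lambda>n. S n x) \<longlonglongrightarrow> calibration_value F b B {y. (x, y) \<in> M}"
  proof -
    have "AE x in lborel. AE t in lborel. norm (x, t) \<le> R2 \<longrightarrow> (\<lambda>n. \<rho> n (x, t)) \<longlonglongrightarrow> indicator M (x, t)"
      using \<rho>(3) unfolding lborel_prod[symmetric] by (rule lborel_pair.AE_pair)
    then show ?thesis
    proof eventually_elim
      case (elim x)
      show ?case
      proof
        assume "x \<in> K"
        then have x: "norm x \<le> R" by (rule KR)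
        have cx: "continuous_on UNIV (\<lambda>t. \<rho> n (x, t))" for n
          by (intro continuous_on_compose2[OF separable_continuous[OF \<rho>(1)]] continuous_intros) auto
        show "(\<lambda>n. S n x) \<longlonglongrightarrow> calibration_value F b B {y. (x, y) \<in> M}"
          unfolding Seq
        proof (rule calibration_limit[OF slice_borel y1 b(2) F(1-4) cx])
          show "0 \<le> \<rho> n (x, t) \<and> \<rho> n (x, t) \<le> 1" if "0 \<le> t" "t \<le> y1" for n t
            using that x by (intro \<rho>(2) R2)
          show "AE t in lborel. 0 \<le> t \<and> t \<le> y1 \<longrightarrow> (\<lambda>j. \<rho> j (x, t)) \<longlonglongrightarrow> indicator {y. (x, y) \<in> M} t"
            using elim
          proof eventually_elim
            case (elim t)
            then show ?case using R2[OF x, of t] by (auto simp: indicator_def)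
          qed
        qed (use A in auto)
      qed
    qed
  qed
  show ?thesis
    by (rule estimate_AE_limit[OF est height_measurable Sm lim, of "C * y1"]) (use SB KR in auto)
qed

end

context comparison_field begin

lemma indicator_slice: "indicator M (x, y) = (indicator {y. (x, y) \<in> M} y :: real)"
  by (simp add: indicator_def)

text \<open>
  The profiles are refined and the fading zone is moved to the upper end simultaneously.
\<close>

lemma estimate_boundary_density:
  assumes fin: "AE x in lborel. x \<in> \<Omega> \<longrightarrow> integrable lborel (\<lambda>y. indicator M (x, y) * w y)"
    and \<delta>: "\<And>t. t \<le> 0 \<Longrightarrow> \<tau>' t = 0" "\<And>t. \<delta> \<le> t \<Longrightarrow> \<tau>' t = 0" "ereal (W u + \<delta>) \<le> \<alpha>"
    and C: "0 < C"
  shows "\<exists>S \<in> borel_measurable borel. estimate height S \<and> (\<forall>x. 0 \<le> S x \<and> S x \<le> C) \<and>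
     (AE x in lborel. x \<in> K \<longrightarrow> 0 < height x \<longrightarrow> ereal (height x) < \<alpha> \<longrightarrow> S x = min (f (height x)) C)"
proof -
  obtain b B :: "nat \<Rightarrow> real" where b: "\<And>i. 0 < b i" "\<And>i. b i < B i" "\<And>i. ereal (B i) < \<alpha>"
    "\<And>z. ereal z < \<alpha> \<Longrightarrow> eventually (\<lambda>i. z < b i) sequentially"
    "\<And>i. \<alpha> = \<infinity> \<Longrightarrow> B i - b i = Suc i"
    using levels_exist by blast
  have B: "0 < B i" for i using b(1,2)[of i] by simp
  have "\<forall>i. \<exists>y\<in>J. W y = B i" using W_surj[OF B b(3)] by blast
  then obtain y1 where y1: "\<And>i. y1 i \<in> J" "\<And>i. W (y1 i) = B i" by metis
  define e where "e i = 1 / real (Suc i)" for i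
  have e: "e i > 0" for i by (simp add: e_def)
  have e0: "e \<longlonglongrightarrow> 0" unfolding e_def[abs_def]
    using LIMSEQ_inverse_real_of_nat by (simp add: inverse_eq_divide)
  define prof where "prof i F F' r \<longleftrightarrow> (\<forall>t. (F has_real_derivative F' t) (at t)) \<and> continuous_on UNIV F' \<and>
    0 < r \<and> (\<forall>z. z \<le> r \<longrightarrow> F z = 0) \<and> (\<forall>z. 0 \<le> z \<longrightarrow> z \<le> B i \<longrightarrow> \<bar>F z\<bar> \<le> C + 1) \<and>
    (\<forall>z. e i \<le> z \<longrightarrow> z \<le> B i \<longrightarrow> \<bar>F z - min (f z) C\<bar> \<le> e i) \<and>
    (\<forall>x y. 0 \<le> x \<longrightarrow> 0 \<le> y \<longrightarrow> x + y \<le> B i \<longrightarrow> \<bar>F x - F y\<bar> \<le> f (x + y))" for i F F' r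
  have "\<exists>F F' r. prof i F F' r" for i
    by (rule calibration_profile[OF B[of i] b(3)[of i] e[of i] C]) (unfold prof_def, blast)
  then obtain F F' r where F: "\<And>i. prof i (F i) (F' i) (r i)" by metis
  have cF: "continuous_on UNIV (F i)" for i
    using F[of i] unfolding prof_def by (auto intro!: DERIV_isCont continuous_at_imp_continuous_on)
  have "\<exists>S \<in> borel_measurable borel. estimate height S \<and>
     (AE x in lborel. x \<in> K \<longrightarrow> S x = calibration_value (F i) (b i) (B i) {y. (x, y) \<in> M})" for i
  proof (rule estimate_calibrated[OF y1(1)[of i] y1(2)[of i] b(1)[of i] b(2)[of i] _ _ _ _ _ fin])
    show "(F i has_real_derivative F' i t) (at t)" for t using F[of i] unfolding prof_def by blast
    show "continuous_on UNIV (F' i)" using F[of i] unfolding prof_def by blast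
    show "0 < r i" using F[of i] unfolding prof_def by blast
    show "F i z = 0" if "z \<le> r i" for z using F[of i] that unfolding prof_def by blast
    show "\<bar>F i x - F i y\<bar> \<le> f (x + y)" if "0 \<le> x" "0 \<le> y" "x + y \<le> B i" for x y
      using F[of i] that unfolding prof_def by blast
  qed
  then have "\<forall>i. \<exists>S. S \<in> borel_measurable borel \<and> estimate height S \<and>
     (AE x in lborel. x \<in> K \<longrightarrow> S x = calibration_value (F i) (b i) (B i) {y. (x, y) \<in> M})" by blast
  from choice[OF this] obtain S where SS: "\<forall>i. S i \<in> borel_measurable borel \<and> estimate height (S i) \<and>
     (AE x in lborel. x \<in> K \<longrightarrow> S i x = calibration_value (F i) (b i) (B i) {y. (x, y) \<in> M})" ..
  have S: "S i \<in> borel_measurable borel" "estimate height (S i)"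
     "AE x in lborel. x \<in> K \<longrightarrow> S i x = calibration_value (F i) (b i) (B i) {y. (x, y) \<in> M}" for i
    using SS by blast+
  define G where "G = {x. 0 < height x \<and> ereal (height x) < \<alpha>}"
  note [measurable] = height_measurable S(1)
  have [measurable]: "G \<in> sets borel" unfolding G_def by measurable
  \<comment> \<open>Convergence of the calibration values is only claimed on \<open>G\<close>, and only there do they matter.\<close>
  define S' where "S' i x = S i x * indicator G x" for i x
  have S'm: "S' i \<in> borel_measurable borel" for i unfolding S'_def by measurable
  have S'est: "estimate height (S' i)" for i
    by (rule estimate_cong[OF S(2) height_measurable S(1) S'm \<delta>]) (auto simp: S'_def G_def indicator_def)
  define L where "L x = (if x \<in> G then min (f (height x)) C else 0)" for x
  have hm: "height x = (LINT t|lborel. indicator {y. (x, y) \<in> M} t * w t)" for x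
    unfolding slice_integral_def by (simp add: indicator_slice)
  have all: "AE x in lborel. \<forall>i. x \<in> K \<longrightarrow> S i x = calibration_value (F i) (b i) (B i) {y. (x, y) \<in> M}"
    unfolding AE_all_countable using S(3) by blast
  have "\<exists>S0 \<in> borel_measurable borel. estimate height S0 \<and> (AE x in lborel. x \<in> K \<longrightarrow> S0 x = L x)"
  proof (rule estimate_AE_limit[OF S'est height_measurable S'm])
    show "AE x in lborel. x \<in> K \<longrightarrow> (\<lambda>i. S' i x) \<longlonglongrightarrow> L x"
      using all fin
    proof eventually_elim
      case (elim x)
      show ?case
      proof
        assume x: "x \<in> K"
        show "(\<lambda>i. S' i x) \<longlonglongrightarrow> L x"
        proof (cases "x \<in> G")
          case True
          have int: "integrable lborel (\<lambda>t. indicator {y. (x, y) \<in> M} t * w t)"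
            using elim(2) x K_sub by (auto simp: indicator_slice)
          have "(\<lambda>i. calibration_value (F i) (b i) (B i) {y. (x, y) \<in> M}) \<longlonglongrightarrow> min (f (height x)) C"
          proof (rule calibration_value_tendsto[OF slice_borel int hm _ _ C b y1 cF _ _ e0])
            show "0 < height x" "ereal (height x) < \<alpha>" using True by (auto simp: G_def)
            show "\<bar>F i z\<bar> \<le> C + 1" if "0 \<le> z" "z \<le> B i" for i z
              using F[of i] that unfolding prof_def by blast
            show "\<bar>F i z - min (f z) C\<bar> \<le> e i" if "e i \<le> z" "z \<le> B i" for i z
              using F[of i] that unfolding prof_def by blast
          qed
          then show ?thesis using True elim(1) x by (simp add: S'_def L_def)
        qed (simp add: S'_def L_def)
      qed
    qed
    show "AE x in lborel. x \<in> K \<longrightarrow> \<bar>S' i x\<bar> \<le> C + 1" for i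
      using all fin
    proof eventually_elim
      case (elim x)
      show ?case
      proof
        assume x: "x \<in> K"
        have int: "integrable lborel (\<lambda>t. indicator {y. (x, y) \<in> M} t * w t)"
          using elim(2) x K_sub by (auto simp: indicator_slice)
        have "\<bar>calibration_value (F i) (b i) (B i) {y. (x, y) \<in> M}\<bar> \<le> C + 1"
        proof (rule calibration_integrable(2)[OF slice_borel int y1(1)[of i] y1(2)[of i] less_imp_le[OF b(1)[of i]] b(2)[of i] cF])
          show "\<bar>F i z\<bar> \<le> C + 1" if "0 \<le> z" "z \<le> B i" for z
            using F[of i] that unfolding prof_def by blast
        qed
        then show "\<bar>S' i x\<bar> \<le> C + 1" using elim(1) x C by (auto simp: S'_def indicator_def)
      qed
    qed
  qed
  then obtain S0 where S0: "S0 \<in> borel_measurable borel" "estimate height S0"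
    "AE x in lborel. x \<in> K \<longrightarrow> S0 x = L x" by blast
  note [measurable] = S0(1)
  have Lb: "0 \<le> L x \<and> L x \<le> C" for x
    using f_nonneg[of "height x"] C by (auto simp: L_def G_def)
  \<comment> \<open>Clamping makes the bounds hold everywhere, at the price of an almost everywhere equality.\<close>
  define S1 where "S1 x = max 0 (min C (S0 x))" for x
  have S1m: "S1 \<in> borel_measurable borel" unfolding S1_def by measurable
  have S1L: "AE x in lborel. x \<in> K \<longrightarrow> S1 x = L x"
    using S0(3)
  proof eventually_elim
    case (elim x)
    then show ?case using Lb[of x] by (auto simp: S1_def)
  qed
  have "estimate height S1"
  proof (rule estimate_cong[OF S0(2) height_measurable S0(1) S1m \<delta>])
    show "AE x in lborel. x \<in> K \<longrightarrow> 0 < height x \<longrightarrow> ereal (height x) < \<alpha> \<longrightarrow> S0 x = S1 x"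
      using S0(3) S1L by eventually_elim auto
  qed
  moreover have "AE x in lborel. x \<in> K \<longrightarrow> 0 < height x \<longrightarrow> ereal (height x) < \<alpha> \<longrightarrow> S1 x = min (f (height x)) C"
    using S1L by eventually_elim (auto simp: L_def G_def)
  moreover have "\<forall>x. 0 \<le> S1 x \<and> S1 x \<le> C" using C by (auto simp: S1_def)
  ultimately show ?thesis using S1m by blast
qed

text \<open>
  The remaining vertical term is bounded by \<open>\<omega>\<close> times the integral of \<open>\<tau>'(m(x) - W(y)) w(y)\<close> over the box,
  and for each \<open>x\<close> that integral is at most \<open>1\<close>.
\<close>

lemma rearranged_divergence_approx:
  assumes fin: "AE x in lborel. x \<in> \<Omega> \<longrightarrow> integrable lborel (\<lambda>y. indicator M (x, y) * w y)"
    and \<delta>: "\<And>t. t \<le> 0 \<Longrightarrow> \<tau>' t = 0" "\<And>t. \<delta> \<le> t \<Longrightarrow> \<tau>' t = 0" "ereal (W u + \<delta>) < \<alpha>"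
    and C: "0 < C" and lu: "l \<le> u" and \<omega>0: "0 \<le> \<omega>"
    and \<omega>: "\<And>y z. y \<in> {l..u} \<Longrightarrow> W y < z \<Longrightarrow> z < W y + \<delta> \<Longrightarrow> \<bar>w y - min (f z) C\<bar> \<le> \<omega>"
  shows "(LINT p|lborel. \<tau> (height (fst p) - W (snd p)) * divergence \<phi> p) \<le> P + \<omega> * measure lborel K"
proof -
  obtain S where S: "S \<in> borel_measurable borel" "estimate height S" "\<And>x. 0 \<le> S x \<and> S x \<le> C"
     "AE x in lborel. x \<in> K \<longrightarrow> 0 < height x \<longrightarrow> ereal (height x) < \<alpha> \<longrightarrow> S x = min (f (height x)) C"
    using estimate_boundary_density[OF fin \<delta>(1,2) less_imp_le[OF \<delta>(3)] C] by blast
  define t where "t p = \<tau>' (height (fst p) - W (snd p))" for p :: "'a \<times> real"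
  define E where "E p = \<tau> (height (fst p) - W (snd p)) * divergence \<phi> p" for p
  define H where "H p = t p * snd (\<phi> p) * (w (snd p) - S (fst p))" for p
  define h where "h p = t p * w (snd p) * indicator (K \<times> {l..u}) p" for p
  have KB: "K \<times> {l..u} \<in> sets borel" "K \<in> sets borel"
    by (intro borel_closed closed_Times compact_imp_closed K_compact; simp)+
  have Em: "E \<in> borel_measurable borel" and Hm: "H \<in> borel_measurable borel"
    and twm: "(\<lambda>p. t p * w (snd p)) \<in> borel_measurable borel"
    unfolding E_def H_def t_def by (rule estimate_measurable[OF height_measurable S(1)])+
  have hm: "h \<in> borel_measurable borel" unfolding h_def using twm KB by simp
  have t0: "0 \<le> t p" "t p \<le> T" for p unfolding t_def using \<tau>'_bounds by auto
  have T0: "0 \<le> T" using t0 order_trans by blast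
  have "bounded (w ` {l..u})"
    by (intro compact_imp_bounded compact_continuous_image continuous_on_subset[OF w_cont]) auto
  then obtain Cw where Cw: "\<And>y. y \<in> {l..u} \<Longrightarrow> \<bar>w y\<bar> \<le> Cw"
    unfolding bounded_iff by (metis image_eqI real_norm_def)
  have hb: "norm (h p) \<le> T * \<bar>Cw\<bar>" for p
  proof (cases "p \<in> K \<times> {l..u}")
    case True
    then have "\<bar>w (snd p)\<bar> \<le> \<bar>Cw\<bar>" using Cw[of "snd p"] by force
    then have "\<bar>t p * w (snd p)\<bar> \<le> T * \<bar>Cw\<bar>" unfolding abs_mult using t0[of p] T0 by (intro mult_mono) auto
    then show ?thesis using True by (simp add: h_def)
  qed (use T0 in \<open>simp add: h_def\<close>)
  have hz: "h (x, y) = 0" if "R < norm x" for x y using K_R[OF that] by (simp add: h_def)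
  have hz': "h (x, y) = 0" if "y \<notin> {l..u}" for x y using that by (simp add: h_def)
  note hI = integrable_lborel_prodI[OF hm hb hz hz']
  have hint: "(LINT p|lborel. h p) \<le> measure lborel K"
  proof -
    have K_fin: "emeasure lborel K < \<infinity>" by (rule emeasure_compact_finite[OF K_compact])
    have "(LINT y|lborel. h (x, y)) \<le> indicator K x" for x
    proof (cases "x \<in> K")
      case True
      define c where "c = height x"
      have "((\<lambda>y. \<tau> (c - W y)) has_real_derivative \<tau>' (c - W y) * - w y) (at y)" for y
        by (rule DERIV_chain2[OF \<tau>_deriv]) (auto intro!: derivative_eq_intros W_deriv)
      from DERIV_minus[OF this] have d: "((\<lambda>y. - \<tau> (c - W y)) has_real_derivative \<tau>' (c - W y) * w y) (at y)" for y
        by simp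
      have cc: "continuous_on UNIV (\<lambda>y. \<tau>' (c - W y) * w y)"
        by (intro continuous_intros continuous_on_compose2[OF \<tau>'_cont] W_cont w_cont) auto
      have "(LINT y|lborel. \<tau>' (c - W y) * w y * indicator {l..u} y) = - \<tau> (c - W u) - - \<tau> (c - W l)"
        by (rule integral_FTC_Icc_real[OF lu d]) (use cc in \<open>simp add: continuous_on_eq_continuous_at\<close>)
      also have "\<dots> \<le> 1" using \<tau>_bounds(1)[of "c - W u"] \<tau>_bounds(2)[of "c - W l"] by simp
      finally show ?thesis using True by (simp add: h_def t_def c_def indicator_times)
    qed (simp add: h_def)
    then have "(LINT x|lborel. LINT y|lborel. h (x, y)) \<le> (LINT x|lborel. indicator K x)"
      using hI(4) K_fin KB by (intro integral_mono) auto
    then show ?thesis using hI(3) by simp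
  qed
  have Hh: "AE p in lborel. \<bar>H p\<bar> \<le> \<omega> * h p"
    using AE_lborel_fst[OF S(4)]
  proof eventually_elim
    case (elim p)
    obtain x y where p: "p = (x, y)" by (cases p)
    show ?case
    proof (cases "x \<in> K \<and> y \<in> {l..u}")
      case False
      then have "\<phi> p = 0" unfolding p by (rule \<phi>_support)
      then show ?thesis using False by (auto simp: H_def h_def p)
    next
      case True
      have hp: "h p = t p * w y" using True by (simp add: h_def p)
      show ?thesis
      proof (cases "t p = 0")
        case False
        then have hx: "0 < height x - W y" "height x - W y < \<delta>"
          using \<delta>(1,2) unfolding t_def p by (metis fst_conv snd_conv not_le)+
        have Wy: "0 < W y" "W y \<le> W u" using True lu_sub W_pos by (blast, intro W_mono, simp)
        have "ereal (height x) \<le> ereal (W u + \<delta>)" using hx Wy by simp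
        then have "ereal (height x) < \<alpha>" using \<delta>(3) by (rule le_less_trans)
        then have Sx: "S x = min (f (height x)) C" using elim True hx Wy by (simp add: p)
        have "\<bar>w y - S x\<bar> \<le> \<omega>" unfolding Sx using True hx by (intro \<omega>) auto
        moreover have "\<bar>snd (\<phi> p)\<bar> \<le> w y"
          using \<phi>_bound[of p] norm_snd_le[of "snd (\<phi> p)" "fst (\<phi> p)"] by (simp add: p)
        ultimately have "\<bar>snd (\<phi> p)\<bar> * \<bar>w y - S x\<bar> \<le> w y * \<omega>"
          using w_nonneg by (intro mult_mono) auto
        then have "t p * (\<bar>snd (\<phi> p)\<bar> * \<bar>w y - S x\<bar>) \<le> t p * (w y * \<omega>)"
          by (intro mult_left_mono t0)
        then show ?thesis unfolding hp using t0(1)[of p] by (simp add: H_def p abs_mult mult_ac)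
      qed (simp add: H_def hp)
    qed
  qed
  have h0: "0 \<le> h p" for p using t0(1)[of p] w_nonneg by (simp add: h_def)
  have iH: "integrable lborel H"
  proof (rule Bochner_Integration.integrable_bound[of _ "\<lambda>p. \<omega> * h p"])
    show "AE p in lborel. norm (H p) \<le> norm (\<omega> * h p)"
      using Hh by eventually_elim simp
  qed (use hI(1) Hm in auto)
  obtain Cd where Cd: "Cd \<ge> 0" "\<And>p. \<bar>divergence \<phi> p\<bar> \<le> Cd"
    using supported_integral(1)[OF divergence_cont divergence_support] by auto
  have Eb: "norm (E p) \<le> Cd" for p
  proof -
    have "\<bar>E p\<bar> \<le> 1 * Cd" unfolding E_def abs_mult using \<tau>_bounds Cd by (intro mult_mono) auto
    then show ?thesis by simp
  qed
  have iE: "integrable lborel E"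
    by (rule integrable_lborel_prodI(1)[OF Em Eb, of R l u])
      (use K_R divergence_support in \<open>auto simp: E_def\<close>)
  have "(LINT p|lborel. E p - H p) \<le> P"
    using S(2) unfolding estimate_def E_def H_def t_def .
  then have "(LINT p|lborel. E p) \<le> P + (LINT p|lborel. H p)" using iE iH by simp
  also have "(LINT p|lborel. H p) \<le> (LINT p|lborel. \<omega> * h p)"
    using Hh by (intro integral_mono_AE iH) (use hI(1) in \<open>auto elim: eventually_mono\<close>)
  also have "\<dots> \<le> \<omega> * measure lborel K" using hint \<omega>0 by (simp add: mult_left_mono)
  finally show ?thesis unfolding E_def by simp
qed

end

text \<open>
  The width of the smooth step tends to zero, and with it the oscillation \<open>\<omega>\<close> of \<open>f\<close> over this width. The
  truncation height \<open>C\<close> is chosen above \<open>f\<close> on the range of \<open>W\<close> that the support of \<open>\<phi>\<close> meets, enlarged by one step width.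
\<close>

lemma (in finite_perimeter_set) rearranged_divergence_le:
  assumes fin: "AE x in lborel. x \<in> \<Omega> \<longrightarrow> integrable lborel (\<lambda>y. indicator M (x, y) * w y)"
    and \<phi>: "C1_deriv \<phi> D" "\<And>x y. \<not> (x \<in> K \<and> y \<in> {l..u}) \<Longrightarrow> \<phi> (x, y) = 0" "\<And>p. norm (\<phi> p) \<le> w (snd p)"
    and K: "compact K" "K \<subseteq> \<Omega>" and lu: "{l..u} \<subseteq> J" "l \<le> u"
  shows "(LINT p|lborel. indicator {p. W (snd p) < slice_integral M (\<lambda>p. w (snd p)) (fst p)} p * divergence \<phi> p) \<le> P"
proof -
  define H where "H = slice_integral M (\<lambda>p. w (snd p))"
  have uJ: "u \<in> J" using lu by auto
  obtain v where v: "v \<in> J" "W u < W v" using W_reach[OF W_less[OF uJ]] by blast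
  define d where "d = W v - W u"
  have d: "0 < d" "ereal (W u + d) < \<alpha>" using v W_less[OF v(1)] by (auto simp: d_def)
  have sub: "{0..W u + d} \<subseteq> {z. 0 \<le> z \<and> ereal z \<le> \<alpha>}"
  proof
    fix z assume z: "z \<in> {0..W u + d}"
    then have "ereal z \<le> ereal (W u + d)" by simp
    then have "ereal z < \<alpha>" using d(2) by (rule le_less_trans)
    then show "z \<in> {z. 0 \<le> z \<and> ereal z \<le> \<alpha>}" using z by auto
  qed
  note cf = continuous_on_subset[OF f_cont sub]
  have "bounded (f ` {0..W u + d})" by (intro compact_imp_bounded compact_continuous_image cf) auto
  then obtain C0 where C0: "\<And>z. z \<in> {0..W u + d} \<Longrightarrow> \<bar>f z\<bar> \<le> C0"
    unfolding bounded_iff by (metis image_eqI real_norm_def)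
  define C where "C = \<bar>C0\<bar> + 1"
  have C: "0 < C" by (simp add: C_def)
  have C2: "f z \<le> C" if "z \<in> {0..W u + d}" for z using C0[OF that] unfolding C_def by linarith
  have uc: "uniformly_continuous_on {0..W u + d} f" by (rule compact_uniformly_continuous[OF cf]) simp
  define dn where "dn n = d / real (Suc n)" for n
  have dn: "0 < dn n" "dn n \<le> d" for n using d by (auto simp: dn_def field_simps)
  have "(\<lambda>n. d * (1 / real (Suc n))) \<longlonglongrightarrow> d * 0"
    by (intro tendsto_mult tendsto_const) (use LIMSEQ_inverse_real_of_nat in \<open>simp add: inverse_eq_divide\<close>)
  then have dn0: "dn \<longlonglongrightarrow> 0" by (simp add: dn_def[abs_def])
  define \<tau> where "\<tau> n t = smooth_step (t / dn n)" for n t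
  define \<tau>' where "\<tau>' n t = smooth_step' (t / dn n) / dn n" for n t
  have F: "comparison_field w W f J \<alpha> \<Omega> M P R \<phi> D K l u (\<tau> n) (\<tau>' n) (2 / dn n)" for n
  proof
    show "(\<tau> n has_real_derivative \<tau>' n t) (at t)" for t
    proof -
      have "((\<lambda>t. t / dn n) has_real_derivative 1 / dn n) (at t)" by (rule DERIV_cdivide[OF DERIV_ident])
      from DERIV_chain2[OF smooth_step_has_derivative this] show ?thesis by (simp add: \<tau>_def[abs_def] \<tau>'_def)
    qed
    show "continuous_on UNIV (\<tau>' n)" unfolding \<tau>'_def[abs_def] using dn(1)[of n] by (intro continuous_intros) auto
    show "0 \<le> \<tau> n t" "\<tau> n t \<le> 1" for t unfolding \<tau>_def by (rule smooth_step_bounds)+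
    show "0 \<le> \<tau>' n t" "\<tau>' n t \<le> 2 / dn n" for t
      unfolding \<tau>'_def using smooth_step'_bounds[of "t / dn n"] dn(1)[of n] by (auto intro: divide_right_mono)
  qed (use \<phi> K lu in auto)
  define E where "E n p = \<tau> n (H (fst p) - W (snd p)) * divergence \<phi> p" for n p
  have approx: "eventually (\<lambda>n. (LINT p|lborel. E n p) \<le> P + \<omega> * measure lborel K) sequentially" if \<omega>: "0 < \<omega>" for \<omega>
  proof -
    obtain e where e: "e > 0" "\<And>x y. x \<in> {0..W u + d} \<Longrightarrow> y \<in> {0..W u + d} \<Longrightarrow> dist y x < e \<Longrightarrow> dist (f y) (f x) < \<omega>"
      using uc \<omega> unfolding uniformly_continuous_on_def by metis
    have "eventually (\<lambda>n. dn n < min e d) sequentially" using order_tendstoD(2)[OF dn0, of "min e d"] e d by simp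
    then show ?thesis
    proof eventually_elim
      case (elim n)
      interpret comparison_field w W f J \<alpha> \<Omega> M P R \<phi> D K l u "\<tau> n" "\<tau>' n" "2 / dn n" by (rule F)
      show ?case
        unfolding E_def H_def
      proof (rule rearranged_divergence_approx[OF fin])
        show "\<tau>' n t = 0" if "t \<le> 0" for t
          using that dn(1)[of n] by (simp add: \<tau>'_def smooth_step'_eq(1) divide_nonpos_pos)
        show "\<tau>' n t = 0" if "dn n \<le> t" for t
          using that dn(1)[of n] by (simp add: \<tau>'_def smooth_step'_eq(2))
        have "ereal (W u + dn n) \<le> ereal (W u + d)" using dn(2)[of n] by simp
        then show "ereal (W u + dn n) < \<alpha>" using d(2) by (rule le_less_trans)
        show "0 < C" by (rule C)
        show "l \<le> u" by (rule lu)
        show "0 \<le> \<omega>" using \<omega> by simp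
        fix y z assume y: "y \<in> {l..u}" and z: "W y < z" "z < W y + dn n"
        have yJ: "y \<in> J" using y lu by blast
        have "0 < W y" "W y \<le> W u" using W_pos[OF yJ] W_mono[of y u] y by auto
        then have r: "W y \<in> {0..W u + d}" "z \<in> {0..W u + d}" using z dn(2)[of n] d(1) by auto
        have "dist (f z) (f (W y)) < \<omega>" using e(2)[OF r] z elim by (simp add: dist_real_def)
        then show "\<bar>w y - min (f z) C\<bar> \<le> \<omega>" using f_W[OF yJ] C2[OF r(2)] by (simp add: dist_real_def)
      qed
    qed
  qed
  define I where "I p = indicator {p. W (snd p) < H (fst p)} p * divergence \<phi> p" for p
  interpret comparison_field w W f J \<alpha> \<Omega> M P R \<phi> D K l u "\<tau> 0" "\<tau>' 0" "2 / dn 0" by (rule F)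
  obtain Cd where Cd: "Cd \<ge> 0" "\<And>p. \<bar>divergence \<phi> p\<bar> \<le> Cd"
    using supported_integral(1)[OF divergence_cont divergence_support] by auto
  have Hm: "H \<in> borel_measurable borel" unfolding H_def by (rule height_measurable)
  have cm: "divergence \<phi> \<in> borel_measurable borel" "(\<lambda>p::'a\<times>real. W (snd p)) \<in> borel_measurable borel"
    by (intro borel_measurable_continuous_onI divergence_cont
        continuous_on_compose2[OF W_cont[of UNIV]] continuous_intros subset_UNIV)+
  note [measurable] = cm borel_measurable_fst_compose[OF Hm]
  have "(\<lambda>n. LINT p|lborel. E n p) \<longlonglongrightarrow> (LINT p|lborel. I p)"
  proof (rule integral_dominated_convergence[where w = "\<lambda>p. Cd * indicator (K \<times> {l..u}) p"])
    have "emeasure lborel (K \<times> {l..u}) < \<infinity>"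
      by (intro emeasure_compact_finite compact_Times K_compact compact_Icc)
    moreover have "K \<times> {l..u} \<in> sets borel"
      by (intro borel_closed closed_Times compact_imp_closed K_compact) auto
    ultimately show "integrable lborel (\<lambda>p. Cd * indicator (K \<times> {l..u}) p :: real)" by simp
    show "AE p in lborel. (\<lambda>n. E n p) \<longlonglongrightarrow> I p"
    proof (rule AE_I2)
      fix p :: "'a \<times> real"
      define s where "s = H (fst p) - W (snd p)"
      have "(\<lambda>n. \<tau> n s) \<longlonglongrightarrow> indicator {p. W (snd p) < H (fst p)} p"
      proof (cases "0 < s")
        case True
        have "eventually (\<lambda>n. \<tau> n s = 1) sequentially"
          using order_tendstoD(2)[OF dn0 True]
          by eventually_elim (use dn(1) in \<open>simp add: \<tau>_def smooth_step_eq(2)\<close>)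
        then show ?thesis using True by (intro tendsto_eventually) (simp add: s_def)
      next
        case False
        then have "\<tau> n s = 0" for n using dn(1)[of n] unfolding \<tau>_def
          by (intro smooth_step_eq(1)) (simp add: divide_nonpos_pos)
        then show ?thesis using False by (simp add: s_def)
      qed
      then show "(\<lambda>n. E n p) \<longlonglongrightarrow> I p" unfolding E_def I_def s_def by (intro tendsto_mult tendsto_const)
    qed
    show "AE p in lborel. norm (E n p) \<le> Cd * indicator (K \<times> {l..u}) p" for n
    proof (rule AE_I2)
      fix p :: "'a \<times> real"
      obtain x y where p: "p = (x, y)" by (cases p)
      have "\<bar>E n p\<bar> \<le> 1 * Cd" unfolding E_def abs_mult
        using smooth_step_bounds Cd by (intro mult_mono) (auto simp: \<tau>_def)
      moreover have "E n p = 0" if "\<not> (x \<in> K \<and> y \<in> {l..u})"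
        using divergence_support[OF that] by (simp add: E_def p)
      ultimately show "norm (E n p) \<le> Cd * indicator (K \<times> {l..u}) p"
        by (auto simp: p indicator_def)
    qed
    show "E n \<in> borel_measurable lborel" for n
    proof -
      have "\<tau> n \<in> borel_measurable borel" unfolding \<tau>_def[abs_def]
        using dn(1)[of n] by (intro borel_measurable_continuous_onI continuous_intros) auto
      note [measurable] = this
      show ?thesis unfolding E_def by measurable
    qed
    show "I \<in> borel_measurable lborel" unfolding I_def by measurable
  qed
  then have le: "(LINT p|lborel. I p) \<le> P + \<omega> * measure lborel K" if "0 < \<omega>" for \<omega>
    using approx[OF that] by (intro tendsto_upperbound[where F = sequentially]) auto
  have "(LINT p|lborel. I p) \<le> P"
  proof (rule field_le_epsilon)
    fix e :: real assume e: "0 < e"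
    define \<omega> where "\<omega> = e / (measure lborel K + 1)"
    have "0 < measure lborel K + 1" by (simp add: add_nonneg_pos)
    then have \<omega>: "0 < \<omega>" "\<omega> * measure lborel K \<le> e" using e by (auto simp: \<omega>_def field_simps)
    show "(LINT p|lborel. I p) \<le> P + e" using le[OF \<omega>(1)] \<omega>(2) by linarith
  qed
  then show ?thesis unfolding I_def H_def .
qed

section \<open>The rearrangement of a set\<close>

text \<open>
  Passing from a Lebesgue measurable set, or from one that is only known up to null sets, to a Borel set.
\<close>

lemma set_lebesgue_integral_AE_borel:
  fixes g :: "'a::euclidean_space \<Rightarrow> real"
  assumes A0: "A0 \<in> sets borel" and g: "g \<in> borel_measurable borel"
    and eq: "AE x in lborel. g x \<noteq> 0 \<longrightarrow> (x \<in> A \<longleftrightarrow> x \<in> A0)"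
  shows "(LINT x:A|lebesgue. g x) = (LINT x|lborel. indicator A0 x * g x)"
proof -
  define h where "h x = indicator A0 x * g x" for x
  have h: "h \<in> borel_measurable borel" unfolding h_def using A0 g by measurable
  have eq': "AE x in lebesgue. indicator A x *\<^sub>R g x = h x"
    unfolding AE_completion_iff using eq by eventually_elim (auto simp: h_def indicator_def)
  have hl: "h \<in> borel_measurable lebesgue" using h by (simp add: measurable_completion)
  then have "(\<lambda>x. indicator A x *\<^sub>R g x) \<in> borel_measurable lebesgue"
    by (rule borel_measurable_AE) (use eq' in \<open>auto elim: eventually_mono\<close>)
  then have "(LINT x:A|lebesgue. g x) = (LINT x|lebesgue. h x)"
    unfolding set_lebesgue_integral_def using hl eq' by (intro integral_cong_AE)
  also have "\<dots> = (LINT x|lborel. h x)" using h by (intro integral_completion) simp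
  finally show ?thesis unfolding h_def .
qed

lemma closure_einterval_0:
  assumes "0 < \<alpha>"
  shows "closure (einterval 0 \<alpha>) = {y. 0 \<le> y \<and> ereal y \<le> \<alpha>}"
proof (cases \<alpha>)
  case (real a)
  then have "einterval 0 \<alpha> = {0<..<a}" "0 < a" using assms by (auto simp: einterval_def zero_ereal_def)
  then show ?thesis using real by auto
next
  case PInf
  then have "einterval 0 \<alpha> = {0<..}" by (auto simp: einterval_def zero_ereal_def)
  then show ?thesis using PInf by auto
qed (use assms in auto)

text \<open>
  The weight is continued by its end values.
\<close>

lemma continuous_extension_const:
  fixes w :: "real \<Rightarrow> real"
  assumes \<alpha>: "0 < \<alpha>" and w: "continuous_on (closure (einterval 0 \<alpha>)) w"
    and pos: "\<And>y. y \<in> einterval 0 \<alpha> \<Longrightarrow> 0 < w y"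
  obtains v where "continuous_on UNIV v" "\<And>y. 0 \<le> v y" "\<And>y. y \<in> closure (einterval 0 \<alpha>) \<Longrightarrow> v y = w y"
proof -
  define c where "c y = (if \<alpha> = \<infinity> then max 0 y else max 0 (min y (real_of_ereal \<alpha>)))" for y
  have cc: "continuous_on UNIV c" unfolding c_def[abs_def] by (cases "\<alpha> = \<infinity>") (auto intro!: continuous_intros)
  have c1: "c y \<in> closure (einterval 0 \<alpha>)" for y
    unfolding closure_einterval_0[OF \<alpha>] using \<alpha> by (cases \<alpha>) (auto simp: c_def)
  have c2: "c y = y" if "y \<in> closure (einterval 0 \<alpha>)" for y
    using that unfolding closure_einterval_0[OF \<alpha>] using \<alpha> by (cases \<alpha>) (auto simp: c_def)
  show thesis
  proof (rule that[of "\<lambda>y. w (c y)"])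
    show "continuous_on UNIV (\<lambda>y. w (c y))"
      by (rule continuous_on_compose2[OF w cc]) (use c1 in auto)
    show "0 \<le> w (c y)" for y
      by (rule continuous_ge_on_closure[OF w c1]) (use pos in \<open>auto intro: less_imp_le\<close>)
  qed (simp add: c2)
qed

lemma W_prim_primitive:
  assumes W: "\<And>y. (W has_real_derivative v y) (at y)" "W 0 = 0"
    and v: "\<And>y. y \<in> closure (einterval 0 \<alpha>) \<Longrightarrow> v y = w y" and \<alpha>: "0 < \<alpha>"
    and y: "y \<in> closure (einterval 0 \<alpha>)"
  shows "W_prim w y = W y"
proof -
  have y0: "0 \<le> y" "ereal y \<le> \<alpha>" using y unfolding closure_einterval_0[OF \<alpha>] by auto
  have sub: "t \<in> closure (einterval 0 \<alpha>)" if "t \<in> {0..y}" for t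
    using that y0 unfolding closure_einterval_0[OF \<alpha>] by (auto intro: order_trans[of _ "ereal y"])
  have "(v has_integral (W y - W 0)) {0..y}"
    using W(1) y0(1) by (intro fundamental_theorem_of_calculus)
      (auto simp: has_real_derivative_iff_has_vector_derivative intro: has_vector_derivative_at_within)
  then have "(w has_integral (W y - W 0)) {0..y}"
    by (rule has_integral_eq[rotated]) (use v sub in auto)
  then show ?thesis unfolding W_prim_def using W(2) by (simp add: integral_unique)
qed

lemma primitive_strict_mono:
  assumes W: "\<And>y. (W has_real_derivative v y) (at y)"
    and v: "\<And>y. y \<in> einterval 0 \<alpha> \<Longrightarrow> 0 < v y" and \<alpha>: "0 < \<alpha>"
    and xy: "x \<in> closure (einterval 0 \<alpha>)" "y \<in> closure (einterval 0 \<alpha>)" "x < y"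
  shows "W x < (W y :: real)"
proof -
  obtain z where z: "x < z" "z < y" "W y - W x = (y - x) * v z"
    using MVT2[of x y W v] xy W by auto
  have "ereal z < ereal y" using z by simp
  also have "ereal y \<le> \<alpha>" using xy unfolding closure_einterval_0[OF \<alpha>] by simp
  finally have "z \<in> einterval 0 \<alpha>"
    using xy z unfolding closure_einterval_0[OF \<alpha>] by (auto simp: einterval_def zero_ereal_def)
  then have "0 < (y - x) * v z" using v xy by (intro mult_pos_pos) auto
  then show ?thesis using z by linarith
qed

text \<open>
  All superlevel sets of an indicator at levels in the open unit interval coincide.
\<close>

lemma w_rearr_fun_indicator:
  "w_rearr_fun w \<alpha> \<alpha>\<^sub>1 (indicator M) (x, y) =
     (if 0 < W_prim w y \<and> W_prim w y < measure lebesgue {t \<in> einterval 0 \<alpha>. (x, W_inv w \<alpha>\<^sub>1 t) \<in> M} then 1 else 0)"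
proof -
  define A where "A = {t \<in> einterval 0 \<alpha>. (x, W_inv w \<alpha>\<^sub>1 t) \<in> M}"
  define S where "S = {c::real. 0 < c \<and>
      W_prim w y \<in> star_set {t \<in> einterval 0 \<alpha>. c < indicator M (x, W_inv w \<alpha>\<^sub>1 t)}}"
  have T: "w_rearr_fun w \<alpha> \<alpha>\<^sub>1 (indicator M) (x, y) = (if S = {} then 0 else Sup S)"
    unfolding w_rearr_fun_def star_fun_def S_def Let_def prod.case ..
  have lev: "{t \<in> einterval 0 \<alpha>. c < (indicator M (x, W_inv w \<alpha>\<^sub>1 t) :: real)} = (if c < 1 then A else {})"
    if "0 < c" for c :: real
    using that unfolding A_def indicator_def by (cases "c < 1") auto
  have "c \<in> S \<longleftrightarrow> c \<in> (if W_prim w y \<in> star_set A then {0<..<1} else {})" for c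
    unfolding S_def mem_Collect_eq
    by (cases "0 < c"; simp only: lev) (simp_all add: star_set_def)
  then have "S = (if W_prim w y \<in> star_set A then {0<..<1} else {})" by (rule set_eqI)
  then show ?thesis unfolding T by (simp add: A_def star_set_def)
qed

text \<open>
  The change of variables \<open>z = W(y)\<close>.
\<close>

lemma measure_primitive_image:
  assumes W: "\<And>y. (W has_real_derivative v y) (at y)" and inj: "inj_on W A"
    and A: "A \<in> sets lebesgue" and v: "\<And>y. 0 \<le> v y" and int: "set_integrable lebesgue A v"
  shows "measure lebesgue (W ` A) = (LINT y:A|lebesgue. v y)"
proof -
  define b where "b = integral A v"
  have "(\<lambda>y. \<bar>v y\<bar> * 1) absolutely_integrable_on A \<and> integral A (\<lambda>y. \<bar>v y\<bar> * 1) = b"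
    using int v by (simp add: b_def)
  then have "(\<lambda>y. 1::real) absolutely_integrable_on (W ` A) \<and> integral (W ` A) (\<lambda>y. 1) = b"
    using has_absolute_integral_change_of_variables_1'[OF A has_field_derivative_at_within[OF W] inj, of "\<lambda>y. 1" b] by simp
  then have "(\<lambda>y. 1::real) integrable_on (W ` A)" "integral (W ` A) (\<lambda>y. 1::real) = b"
    using set_lebesgue_integral_eq_integral(1) by blast+
  then have "W ` A \<in> lmeasurable" by (simp add: lmeasurable_iff_integrable_on)
  from lmeasure_integral[OF this] show ?thesis
    using \<open>integral (W ` A) (\<lambda>y. 1::real) = b\<close> set_lebesgue_integral_eq_integral(2)[OF int]
    by (simp add: b_def)
qed

text \<open>
  If \<open>\<phi>\<close> vanishes identically, its support is empty and a single point of \<open>J\<close> serves as the interval.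
\<close>

lemma compact_support_box:
  fixes \<phi> :: "'a::euclidean_space \<times> real \<Rightarrow> 'a \<times> real"
  assumes \<phi>: "compact (closure {p. \<phi> p \<noteq> 0})" "closure {p. \<phi> p \<noteq> 0} \<subseteq> \<Omega> \<times> J"
    and J: "J \<noteq> {}" "\<And>x y z. x \<in> J \<Longrightarrow> y \<in> J \<Longrightarrow> x \<le> z \<Longrightarrow> z \<le> y \<Longrightarrow> z \<in> J"
  obtains K l u where "compact K" "K \<subseteq> \<Omega>" "{l..u} \<subseteq> J" "l \<le> (u::real)"
    "\<And>x y. \<not> (x \<in> K \<and> y \<in> {l..u}) \<Longrightarrow> \<phi> (x, y) = 0"
proof (cases "closure {p. \<phi> p \<noteq> 0} = {}")
  case True
  then have "{p. \<phi> p \<noteq> 0} = {}" by (metis closure_eq_empty)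
  then have "\<phi> p = 0" for p by blast
  moreover obtain y where "y \<in> J" using J by blast
  ultimately show thesis by (intro that[of "{}" y y]) auto
next
  case False
  define S where "S = closure {p. \<phi> p \<noteq> 0}"
  have cont: "continuous_on S fst" "continuous_on S snd" by (intro continuous_intros)+
  have S: "compact S" "S \<subseteq> \<Omega> \<times> J" "S \<noteq> {}" using \<phi> False by (auto simp: S_def)
  have c: "compact (snd ` S)" "snd ` S \<noteq> {}" using S cont by (auto intro: compact_continuous_image)
  obtain l where l: "l \<in> snd ` S" "\<And>y. y \<in> snd ` S \<Longrightarrow> l \<le> y" using compact_attains_inf[OF c] by blast
  obtain u where u: "u \<in> snd ` S" "\<And>y. y \<in> snd ` S \<Longrightarrow> y \<le> u" using compact_attains_sup[OF c] by blast
  have lJ: "l \<in> J" "u \<in> J" using l u S by auto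
  show thesis
  proof (rule that[of "fst ` S" l u])
    show "compact (fst ` S)" using S cont by (auto intro: compact_continuous_image)
    show "fst ` S \<subseteq> \<Omega>" using S by auto
    show "{l..u} \<subseteq> J" using J(2)[OF lJ] by auto
    show "l \<le> u" using l(2)[OF u(1)] .
    show "\<phi> (x, y) = 0" if "\<not> (x \<in> fst ` S \<and> y \<in> {l..u})" for x y
    proof (rule ccontr)
      assume "\<phi> (x, y) \<noteq> 0"
      then have pS: "(x, y) \<in> S" unfolding S_def by (intro subsetD[OF closure_subset]) simp
      have xS: "x \<in> fst ` S" using imageI[OF pS, of fst] by simp
      have yS: "y \<in> snd ` S" using imageI[OF pS, of snd] by simp
      from xS l(2)[OF yS] u(2)[OF yS] that show False by simp
    qed
  qed
qed

theorem corollary4p9: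
  fixes \<Omega>' :: "(real ^ 'n) set"
    and \<alpha> \<alpha>\<^sub>1 :: ereal
    and w :: "real \<Rightarrow> real"
    and M TM :: "((real ^ 'n) \<times> real) set"
  defines "I \<equiv> einterval 0 \<alpha>"
    and "I\<^sub>1 \<equiv> einterval 0 \<alpha>\<^sub>1"
    and "f \<equiv> weight_f w \<alpha> \<alpha>\<^sub>1"
  assumes "bounded_lipschitz_domain \<Omega>'"
    and "0 < \<alpha>" and "0 < \<alpha>\<^sub>1"
    and "continuous_on (closure I\<^sub>1) w"
    and "\<And>y. y \<in> I\<^sub>1 \<Longrightarrow> 0 < w y"
    and "((ereal \<circ> W_prim w \<circ> real_of_ereal) \<longlongrightarrow> \<alpha>) (at_left \<alpha>\<^sub>1)"
    and "continuous_on (closure I) f"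
    and "\<And>z\<^sub>1 z\<^sub>2. z\<^sub>1 \<in> closure I \<Longrightarrow> z\<^sub>2 \<in> closure I \<Longrightarrow> z\<^sub>1 \<le> z\<^sub>2 \<Longrightarrow>
           f (z\<^sub>2 - z\<^sub>1) \<le> f z\<^sub>1 + f z\<^sub>2"
    and "\<And>z. \<alpha> < \<infinity> \<Longrightarrow> z \<in> closure I \<Longrightarrow> f z = f (real_of_ereal \<alpha> - z)"
    and "M \<in> sets lebesgue" and "M \<subseteq> \<Omega>' \<times> I\<^sub>1"
    and "w_perimeter w M (\<Omega>' \<times> I\<^sub>1) < \<infinity>"
    and "AE x' in lebesgue. x' \<in> \<Omega>' \<longrightarrow>
           (\<integral>\<^sup>+ y \<in> {y \<in> I\<^sub>1. (x', y) \<in> M}. ennreal (w y) \<partial>lebesgue) < \<infinity>"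
    and "is_w_rearrangement w \<alpha> \<alpha>\<^sub>1 \<Omega>' M TM"
  shows "w_perimeter w TM (\<Omega>' \<times> I\<^sub>1) \<le> w_perimeter w M (\<Omega>' \<times> I\<^sub>1)"
proof -
  note I_def = assms(1) and I\<^sub>1_def = assms(2) and f_def = assms(3)
  note dom = assms(4) and \<alpha>_pos = assms(5) and \<alpha>\<^sub>1_pos = assms(6) and w_cont = assms(7) and w_pos = assms(8)
    and W_lim = assms(9) and f_cont = assms(10) and f_sub = assms(11) and f_sym = assms(12)
    and M_leb = assms(13) and M_sub = assms(14) and per_fin = assms(15) and slices = assms(16) and TM = assms(17)
  note clI = closure_einterval_0[OF \<alpha>_pos, folded I_def] and clI1 = closure_einterval_0[OF \<alpha>\<^sub>1_pos, folded I\<^sub>1_def]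
  have I1_mem: "y \<in> I\<^sub>1 \<longleftrightarrow> 0 < y \<and> ereal y < \<alpha>\<^sub>1" for y
    by (simp add: I\<^sub>1_def einterval_def zero_ereal_def)
  have I_mem: "y \<in> I \<longleftrightarrow> 0 < y \<and> ereal y < \<alpha>" for y
    by (simp add: I_def einterval_def zero_ereal_def)
  have I1_cl: "y \<in> closure I\<^sub>1" if "y \<in> I\<^sub>1" for y using that closure_subset by blast
  obtain v where v: "continuous_on UNIV v" "\<And>y. 0 \<le> v y" "\<And>y. y \<in> closure I\<^sub>1 \<Longrightarrow> v y = w y"
    using continuous_extension_const[OF \<alpha>\<^sub>1_pos w_cont[unfolded I\<^sub>1_def] w_pos[unfolded I\<^sub>1_def]]
    unfolding I\<^sub>1_def by blast
  have vw: "v y = w y" if "y \<in> I\<^sub>1" for y using v(3) I1_cl that by blast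
  obtain W where W: "\<And>y. (W has_real_derivative v y) (at y)" "W 0 = 0"
    using continuous_antiderivative[OF v(1)] by blast
  have WW: "W_prim w y = W y" if "y \<in> closure I\<^sub>1" for y
    using W_prim_primitive[OF W v(3)[unfolded I\<^sub>1_def] \<alpha>\<^sub>1_pos] that unfolding I\<^sub>1_def by blast
  have v_pos: "0 < v y" if "y \<in> I\<^sub>1" for y using vw w_pos that by simp
  have strict: "W x < W y" if "x \<in> closure I\<^sub>1" "y \<in> closure I\<^sub>1" "x < y" for x y
    using primitive_strict_mono[OF W(1) v_pos[unfolded I\<^sub>1_def] \<alpha>\<^sub>1_pos] that unfolding I\<^sub>1_def by blast
  have W_inj: "inj_on W (closure I\<^sub>1)"
    by (rule linorder_inj_onI) (use strict in force)+
  have W_inv: "W_inv w \<alpha>\<^sub>1 (W y) = y" if "y \<in> closure I\<^sub>1" for y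
  proof -
    have "inj_on (W_prim w) (closure I\<^sub>1)" using W_inj WW by (simp add: inj_on_def)
    from inv_into_f_f[OF this that] show ?thesis unfolding W_inv_def I\<^sub>1_def[symmetric] WW[OF that] .
  qed
  have I1_down: "x \<in> I\<^sub>1" if "y \<in> I\<^sub>1" "0 < x" "x \<le> y" for x y
    using that unfolding I1_mem by (auto intro: le_less_trans[of "ereal x" "ereal y"])
  have I1_open: "open I\<^sub>1" unfolding I\<^sub>1_def by (rule open_einterval)
  have next_I1: "\<exists>y'\<in>I\<^sub>1. y < y'" if "y \<in> I\<^sub>1" for y
  proof -
    obtain e where "e > 0" "ball y e \<subseteq> I\<^sub>1" using I1_open \<open>y \<in> I\<^sub>1\<close> open_contains_ball by blast
    then show ?thesis by (intro bexI[of _ "y + e / 2"]) (auto simp: dist_norm)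
  qed
  have lim: "((\<lambda>t. ereal (W_prim w (real_of_ereal t))) \<longlongrightarrow> \<alpha>) (at_left \<alpha>\<^sub>1)"
    using W_lim by (simp add: comp_def)
  have at_left: "eventually P (at_left \<alpha>\<^sub>1) \<longleftrightarrow> (\<exists>b<\<alpha>\<^sub>1. \<forall>y>b. y < \<alpha>\<^sub>1 \<longrightarrow> P y)" for P
    by (rule eventually_at_left[OF \<alpha>\<^sub>1_pos])
  \<comment> \<open>The limit of \<open>W\<close> at the upper end is evaluated at points of \<open>I\<^sub>1\<close> as close to the end as needed.\<close>
  have point: "\<exists>t\<in>I\<^sub>1. y < t \<and> P (ereal t)" if P: "eventually P (at_left \<alpha>\<^sub>1)" and y: "0 \<le> y" "ereal y < \<alpha>\<^sub>1" for P y
  proof -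
    obtain b where b: "b < \<alpha>\<^sub>1" "\<And>s. b < s \<Longrightarrow> s < \<alpha>\<^sub>1 \<Longrightarrow> P s" using P unfolding at_left by blast
    have "max b (ereal y) < \<alpha>\<^sub>1" using b y by simp
    then obtain t where t: "max b (ereal y) < ereal t" "ereal t < \<alpha>\<^sub>1" using ereal_dense2 by blast
    then have "y < t" by simp
    then show ?thesis using t b(2)[of "ereal t"] y by (intro bexI[of _ t]) (auto simp: I1_mem)
  qed
  have W_reach: "\<exists>y\<in>I\<^sub>1. z < W y" if "ereal z < \<alpha>" for z
  proof -
    have "eventually (\<lambda>t. ereal z < ereal (W_prim w (real_of_ereal t))) (at_left \<alpha>\<^sub>1)"
      by (rule order_tendstoD(1)[OF lim that])
    from point[OF this, of 0] \<alpha>\<^sub>1_pos obtain t where "t \<in> I\<^sub>1" "z < W_prim w t" by (auto simp: zero_ereal_def)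
    then show ?thesis using WW I1_cl by force
  qed
  have W_less: "ereal (W y) < \<alpha>" if y: "y \<in> I\<^sub>1" for y
  proof (rule ccontr)
    assume "\<not> ereal (W y) < \<alpha>"
    obtain y' where y': "y' \<in> I\<^sub>1" "y < y'" using next_I1[OF y] by blast
    have "W y < W y'" using strict[of y y'] y y' I1_cl by blast
    then have "ereal (W y) < ereal (W y')" by simp
    then have "\<alpha> < ereal (W y')" using \<open>\<not> ereal (W y) < \<alpha>\<close> by (meson not_le le_less_trans)
    then have "eventually (\<lambda>t. ereal (W_prim w (real_of_ereal t)) < ereal (W y')) (at_left \<alpha>\<^sub>1)"
      by (rule order_tendstoD(2)[OF lim])
    from point[OF this, of y'] y' obtain t where t: "t \<in> I\<^sub>1" "y' < t" "W_prim w t < W y'"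
      by (auto simp: I1_mem)
    then show False using strict[of y' t] y'(1) WW[of t] I1_cl by force
  qed
  have W0: "0 < W y" if "y \<in> I\<^sub>1" for y
    using strict[of 0 y] that W(2) \<alpha>\<^sub>1_pos I1_cl[OF that] unfolding clI1 by (auto simp: I1_mem zero_ereal_def)
  have f_W: "f (W y) = v y" if "y \<in> I\<^sub>1" for y
  proof -
    have c: "y \<in> closure I\<^sub>1" by (rule I1_cl[OF that])
    have "W y \<in> W_prim w ` closure (einterval 0 \<alpha>\<^sub>1)"
      using c WW[OF c] unfolding I\<^sub>1_def by (metis image_eqI)
    then show ?thesis unfolding f_def weight_f_def using W_inv[OF c] v(3)[OF c] by simp
  qed
  have cw: "calibrated_weight v W f I\<^sub>1 \<alpha>"
  proof
    show "continuous_on {z. 0 \<le> z \<and> ereal z \<le> \<alpha>} f" using f_cont unfolding clI .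
    show "f a \<le> f b + f (a + b)" if "0 \<le> a" "0 \<le> b" "ereal (a + b) \<le> \<alpha>" for a b
    proof -
      have "ereal b \<le> ereal (a + b)" using that by simp
      then have "ereal b \<le> \<alpha>" using that(3) by (rule order_trans)
      then show ?thesis using f_sub[of b "a + b"] that unfolding clI by simp
    qed
    show "f z = f (real_of_ereal \<alpha> - z)" if "\<alpha> < \<infinity>" "0 \<le> z" "ereal z \<le> \<alpha>" for z
      using f_sym[of z] that unfolding clI by simp
    show "x \<in> I\<^sub>1" if "y \<in> I\<^sub>1" "0 < x" "x \<le> y" for x y by (rule I1_down[OF that])
    show "0 < y" if "y \<in> I\<^sub>1" for y using that by (simp add: I1_mem)
  qed (use v W W_less W_reach f_W v_pos I1_open \<alpha>_pos in auto)
  interpret calibrated_weight v W f I\<^sub>1 \<alpha> by (rule cw)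
  have \<Omega>_open: "open \<Omega>'" and \<Omega>_bdd: "bounded \<Omega>'" using dom by (auto simp: bounded_lipschitz_domain_def)
  obtain R where R: "\<And>x. x \<in> \<Omega>' \<Longrightarrow> norm x \<le> R" using \<Omega>_bdd unfolding bounded_iff by blast
  \<comment> \<open>A Borel kernel of \<open>M\<close>; for almost every \<open>x\<close> its slice differs from that of \<open>M\<close> by a null set.\<close>
  obtain M0 N N' where M0: "M = M0 \<union> N" "N \<subseteq> N'" "N' \<in> null_sets lborel" "M0 \<in> sets lborel"
    using sets_completionE[OF M_leb] by blast
  have M0_borel: "M0 \<in> sets borel" using M0(4) by simp
  have AE_N': "AE p in lborel. p \<notin> N'" by (rule AE_not_in[OF M0(3)])
  have div_borel: "divergence \<psi> \<in> borel_measurable borel" if "\<psi> \<in> C1_compact_support (\<Omega>' \<times> I\<^sub>1)" for \<psi>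
  proof -
    obtain D where D: "C1_deriv \<psi> D" using \<open>\<psi> \<in> _\<close> unfolding C1_compact_support_iff by blast
    show ?thesis unfolding divergence_C1_deriv[OF D, abs_def]
      by (intro borel_measurable_continuous_onI continuous_intros C1_deriv_continuous_derivative[OF D])
  qed
  define Q where "Q = w_perimeter w M (\<Omega>' \<times> I\<^sub>1)"
  have Q: "ereal (LINT p|lborel. indicator M0 p * divergence \<psi> p) \<le> Q"
    if "\<psi> \<in> C1_compact_support (\<Omega>' \<times> I\<^sub>1)" "\<And>p. p \<in> \<Omega>' \<times> I\<^sub>1 \<Longrightarrow> norm (\<psi> p) \<le> v (snd p)" for \<psi>
  proof -
    have "(LINT p:M|lebesgue. divergence \<psi> p) = (LINT p|lborel. indicator M0 p * divergence \<psi> p)"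
    proof (rule set_lebesgue_integral_AE_borel[OF M0_borel div_borel[OF that(1)]])
      show "AE p in lborel. divergence \<psi> p \<noteq> 0 \<longrightarrow> (p \<in> M \<longleftrightarrow> p \<in> M0)"
        using AE_N' by eventually_elim (use M0 in auto)
    qed
    moreover have "norm (\<psi> p) \<le> w (snd p)" if "p \<in> \<Omega>' \<times> I\<^sub>1" for p
      using \<open>\<And>p. p \<in> \<Omega>' \<times> I\<^sub>1 \<Longrightarrow> norm (\<psi> p) \<le> v (snd p)\<close>[OF that] vw[of "snd p"] that by auto
    ultimately show ?thesis unfolding Q_def w_perimeter_def using that(1) by (intro SUP_upper2) auto
  qed
  define P where "P = real_of_ereal Q"
  have "(\<lambda>p. 0) \<in> C1_compact_support (\<Omega>' \<times> I\<^sub>1)"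
    unfolding C1_compact_support_iff using C1_deriv_const by auto
  from Q[OF this] v(2) have "ereal (LINT p|lborel. indicator M0 p * divergence (\<lambda>p. 0 :: (real^'n) \<times> real) p) \<le> Q" by simp
  then have QP: "Q = ereal P" using per_fin unfolding Q_def[symmetric] P_def by (cases Q) auto
  interpret finite_perimeter_set v W f I\<^sub>1 \<alpha> \<Omega>' M0 P R
  proof
    show "(LINT p|lborel. indicator M0 p * divergence \<psi> p) \<le> P"
      if "\<psi> \<in> C1_compact_support (\<Omega>' \<times> I\<^sub>1)" "\<And>p. p \<in> \<Omega>' \<times> I\<^sub>1 \<Longrightarrow> norm (\<psi> p) \<le> v (snd p)" for \<psi>
      using Q[OF that] unfolding QP by simp
  qed (use \<Omega>_open R M0_borel M_sub M0 in auto)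
  define H where "H = slice_integral M0 (\<lambda>p. v (snd p))"
  have N'_slices: "AE x in lborel. AE y in lborel. (x, y) \<notin> N'"
    using AE_N' unfolding lborel_prod[symmetric] by (rule lborel_pair.AE_pair)
  have slice: "AE x in lborel. x \<in> \<Omega>' \<longrightarrow> integrable lborel (\<lambda>y. indicator M0 (x, y) * v y) \<and>
      measure lebesgue {t \<in> einterval 0 \<alpha>. (x, W_inv w \<alpha>\<^sub>1 t) \<in> M} = H x"
    using N'_slices slices[unfolded AE_completion_iff]
  proof eventually_elim
    case (elim x)
    show ?case
    proof
      assume x: "x \<in> \<Omega>'"
      define A where "A = {y \<in> I\<^sub>1. (x, y) \<in> M}"
      define A0 where "A0 = {y. (x, y) \<in> M0}"
      have A0_sub: "A0 \<subseteq> A" using M0(1) M_sub by (auto simp: A_def A0_def)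
      have "(\<lambda>y. (x, y)) \<in> borel_measurable borel" by (intro borel_measurable_continuous_onI continuous_intros)
      from measurable_sets[OF this M0_borel] have A0_borel: "A0 \<in> sets borel" by (simp add: A0_def vimage_def)
      have AA0: "AE y in lborel. y \<in> A \<longleftrightarrow> y \<in> A0"
        using elim(1) by eventually_elim (use A0_sub M0 in \<open>auto simp: A_def A0_def\<close>)
      have vb: "v \<in> borel_measurable borel" by (rule borel_measurable_continuous_onI[OF v(1)])
      have A_leb: "A \<in> sets lebesgue"
      proof -
        obtain Z where Z: "Z \<in> null_sets lborel" "{y. \<not> (y \<in> A \<longleftrightarrow> y \<in> A0)} \<subseteq> Z"
          using AE_E[OF AA0] by (auto simp: null_sets_def)
        have "A = A0 \<union> (A - A0)" using A0_sub by blast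
        moreover have "A - A0 \<subseteq> Z" using Z(2) by blast
        ultimately show ?thesis using sets_completionI[of A A0 "A - A0" Z lborel] Z(1) A0_borel by simp
      qed
      have eq: "AE y in lborel. indicator A y * v y = indicator A0 y * v y"
        using AA0 by eventually_elim (auto simp: indicator_def)
      have eqn: "(\<integral>\<^sup>+ y. ennreal (indicator A0 y * v y) \<partial>lborel) = (\<integral>\<^sup>+ y \<in> A. ennreal (w y) \<partial>lebesgue)"
        unfolding nn_integral_completion
      proof (rule nn_integral_cong_AE)
        show "AE y in lborel. ennreal (indicator A0 y * v y) = ennreal (w y) * indicator A y"
          using AA0 by eventually_elim (use A0_sub vw in \<open>auto simp: indicator_def A_def\<close>)
      qed
      have int: "integrable lborel (\<lambda>y. indicator A0 y * v y)"
      proof (rule integrableI_nonneg)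
        show "(\<lambda>y. indicator A0 y * v y) \<in> borel_measurable lborel" using A0_borel vb by measurable
        show "(\<integral>\<^sup>+ y. ennreal (indicator A0 y * v y) \<partial>lborel) < \<infinity>"
          unfolding eqn A_def using elim(2) x by blast
      qed (use v(2) in auto)
      have ind: "indicator M0 (x, y) = (indicator A0 y :: real)" for y by (simp add: A0_def indicator_def)
      have set_int: "set_integrable lebesgue A v"
      proof -
        have "integrable lebesgue (\<lambda>y. indicator A0 y * v y)" using int by (simp add: integrable_completion)
        moreover have "(\<lambda>y. indicator A y * v y) \<in> borel_measurable lebesgue"
          using A_leb vb by (intro borel_measurable_times borel_measurable_indicator measurable_completion) auto
        ultimately show ?thesis unfolding set_integrable_def
          using eq by (simp add: integrable_cong_AE[of _ lebesgue "\<lambda>y. indicator A0 y * v y"] AE_completion_iff)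
      qed
      have "{t \<in> einterval 0 \<alpha>. (x, W_inv w \<alpha>\<^sub>1 t) \<in> M} = W ` A"
      proof (intro equalityI subsetI)
        fix t assume t: "t \<in> {t \<in> einterval 0 \<alpha>. (x, W_inv w \<alpha>\<^sub>1 t) \<in> M}"
        then have "0 < t" "ereal t < \<alpha>" using I_mem[of t] by (auto simp: I_def)
        then obtain y where y: "y \<in> I\<^sub>1" "W y = t" using W_surj by blast
        then show "t \<in> W ` A" using t W_inv[OF I1_cl[OF y(1)]] by (auto simp: A_def)
      next
        fix t assume "t \<in> W ` A"
        then obtain y where y: "y \<in> I\<^sub>1" "(x, y) \<in> M" "t = W y" by (auto simp: A_def)
        then show "t \<in> {t \<in> einterval 0 \<alpha>. (x, W_inv w \<alpha>\<^sub>1 t) \<in> M}"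
          using W_inv[OF I1_cl[OF y(1)]] W0[OF y(1)] W_less[OF y(1)] I_mem[of "W y"] by (simp add: I_def)
      qed
      moreover have "measure lebesgue (W ` A) = (LINT y:A|lebesgue. v y)"
        by (rule measure_primitive_image[OF W(1) _ A_leb v(2) set_int])
          (use W_inj I1_cl in \<open>auto intro!: inj_on_subset[OF W_inj] simp: A_def\<close>)
      moreover have "(LINT y:A|lebesgue. v y) = (LINT y|lborel. indicator A0 y * v y)"
        by (rule set_lebesgue_integral_AE_borel[OF A0_borel vb]) (use AA0 in \<open>auto elim: eventually_mono\<close>)
      ultimately show "integrable lborel (\<lambda>y. indicator M0 (x, y) * v y) \<and>
          measure lebesgue {t \<in> einterval 0 \<alpha>. (x, W_inv w \<alpha>\<^sub>1 t) \<in> M} = H x"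
        unfolding H_def slice_integral_def ind using int by (simp add: ind)
    qed
  qed
  have fin: "AE x in lborel. x \<in> \<Omega>' \<longrightarrow> integrable lborel (\<lambda>y. indicator M0 (x, y) * v y)"
    using slice by eventually_elim blast
  have Hm: "H \<in> borel_measurable borel"
    unfolding H_def by (intro slice_integral_measurable[OF M0_borel] borel_measurable_continuous_onI
        continuous_on_compose2[OF v(1)] continuous_intros) auto
  \<comment> \<open>On \<open>\<Omega>' \<times> I\<^sub>1\<close> this is the rearranged set up to a null set; elsewhere test fields vanish.\<close>
  define U where "U = {p :: (real^'n) \<times> real. W (snd p) < H (fst p)}"
  have U: "U \<in> sets borel"
  proof -
    have "(\<lambda>p::(real^'n)\<times>real. W (snd p)) \<in> borel_measurable borel"
      by (intro borel_measurable_continuous_onI continuous_on_compose2[OF W_cont[of UNIV]] continuous_intros) auto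
    note [measurable] = this borel_measurable_fst_compose[OF Hm]
    show ?thesis unfolding U_def by measurable
  qed
  have TM_U: "AE p in lborel. p \<in> \<Omega>' \<times> I\<^sub>1 \<longrightarrow> (p \<in> TM \<longleftrightarrow> p \<in> U)"
  proof -
    have "AE p in lborel. p \<in> \<Omega>' \<times> einterval 0 \<alpha>\<^sub>1 \<longrightarrow> indicator TM p = w_rearr_fun w \<alpha> \<alpha>\<^sub>1 (indicator M) p"
      using TM unfolding is_w_rearrangement_def AE_completion_iff by blast
    then show ?thesis using AE_lborel_fst[OF slice]
    proof eventually_elim
      case (elim p)
      obtain x y where p: "p = (x, y)" by (cases p)
      show ?case
      proof
        assume pI: "p \<in> \<Omega>' \<times> I\<^sub>1"
        then have y: "y \<in> I\<^sub>1" "x \<in> \<Omega>'" by (auto simp: p)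
        have "indicator TM p = (if 0 < W y \<and> W y < H x then 1 else 0 :: real)"
          using elim pI y WW[OF I1_cl[OF y(1)]] unfolding p I\<^sub>1_def[symmetric] w_rearr_fun_indicator by simp
        then show "p \<in> TM \<longleftrightarrow> p \<in> U"
          using W0[OF y(1)] by (auto simp: U_def p indicator_def split: if_splits)
      qed
    qed
  qed
  have "ereal (LINT p:TM|lebesgue. divergence \<phi> p) \<le> Q"
    if \<phi>: "\<phi> \<in> C1_compact_support (\<Omega>' \<times> I\<^sub>1)" "\<forall>p\<in>\<Omega>' \<times> I\<^sub>1. norm (\<phi> p) \<le> w (snd p)" for \<phi>
  proof -
    obtain D where D: "C1_deriv \<phi> D" using \<phi>(1) unfolding C1_compact_support_iff by blast
    have supp: "compact (closure {p. \<phi> p \<noteq> 0})" "closure {p. \<phi> p \<noteq> 0} \<subseteq> \<Omega>' \<times> I\<^sub>1"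
      using \<phi>(1) unfolding C1_compact_support_iff by auto
    have ne: "I\<^sub>1 \<noteq> {}" using W_reach[of 0] \<alpha>_pos by (auto simp: zero_ereal_def)
    obtain K l u where K: "compact K" "K \<subseteq> \<Omega>'" "{l..u} \<subseteq> I\<^sub>1" "l \<le> u"
      "\<And>x y. \<not> (x \<in> K \<and> y \<in> {l..u}) \<Longrightarrow> \<phi> (x, y) = 0"
    proof -
      have iv: "z \<in> I\<^sub>1" if "x \<in> I\<^sub>1" "y \<in> I\<^sub>1" "x \<le> z" "z \<le> y" for x y z
        using I1_down[OF that(2), of z] that by (auto simp: I1_mem)
      show thesis
        by (rule compact_support_box[OF supp ne], erule (3) iv, rule that)
    qed
    have \<phi>v: "norm (\<phi> p) \<le> v (snd p)" for p
    proof (cases "p \<in> \<Omega>' \<times> I\<^sub>1")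
      case True then show ?thesis using \<phi>(2) vw by auto
    next
      case False
      then have "\<not> (fst p \<in> K \<and> snd p \<in> {l..u})"
        using K(2,3) by (cases p) (simp only: mem_Sigma_iff fst_conv snd_conv, blast)
      from K(5)[OF this] have "\<phi> p = 0" by simp
      then show ?thesis using v(2) by simp
    qed
    have "(LINT p|lborel. indicator U p * divergence \<phi> p) \<le> P"
      unfolding U_def H_def by (rule rearranged_divergence_le[OF fin D K(5) \<phi>v K(1-4)])
    moreover have "(LINT p:TM|lebesgue. divergence \<phi> p) = (LINT p|lborel. indicator U p * divergence \<phi> p)"
    proof (rule set_lebesgue_integral_AE_borel[OF U div_borel[OF \<phi>(1)]])
      have d0: "divergence \<phi> p = 0" if "p \<notin> \<Omega>' \<times> I\<^sub>1" for p
      proof -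
        have p: "p \<notin> closure {p. \<phi> p \<noteq> 0}" using supp that by blast
        have z: "\<phi> q = 0" if "q \<notin> closure {p. \<phi> p \<noteq> 0}" for q
          using that closure_subset[of "{p. \<phi> p \<noteq> 0}"] by blast
        have "D p h = 0" for h
          by (rule C1_deriv_zero[OF D closed_closure z p])
        then show ?thesis by (simp add: divergence_C1_deriv[OF D])
      qed
      show "AE p in lborel. divergence \<phi> p \<noteq> 0 \<longrightarrow> (p \<in> TM \<longleftrightarrow> p \<in> U)"
        using TM_U by eventually_elim (use d0 in blast)
    qed
    ultimately show ?thesis unfolding QP by simp
  qed
  then show ?thesis unfolding Q_def[symmetric] by (subst w_perimeter_def) (intro SUP_least, auto)
qed

end
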